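(* Let $\mathbf s=(s_1,\dots,s_l)$ be a sequence in $\widehat{\mathcal S}$ such that $\widehat{\mathcal G}_{J(\mathbf s)}$ satisfies the GKM-property. Suppose that $y\to x$ is an edge of $\widehat{\mathcal G}$ with label $\alpha\in\mathsf V$ and $f\in\mathcal X(\mathbf s)$ is such that $f|_{I(\mathbf s)_y}=0$. Then $f|_{I(\mathbf s)_x}=\alpha\,g|_{I(\mathbf s)_x}$ for some $g\in\mathcal X(\mathbf s)$.
   Context: Affine setting. $R$ is an irreducible reduced finite root system in a finite-dimensional $\mathbb Q$-vector space $V$, with weight lattice $X=\{\lambda\in V:\langle\lambda,\alpha^\vee\rangle\in\mathbb Z\ \forall\alpha\in R\}$, positive roots $R^+$, simple roots $\Pi$, highest root $\tilde\alpha$. The affine Weyl group $\widehat{\mathcal W}$ is the group of transformations of $V^*$ generated by $s_{\alpha,n}(v)=v-(\langle\alpha,v\rangle-n)\alpha^\vee$ ($\alpha\in R,n\in\mathbb Z$). Affine roots: $\widehat R=R\times\mathbb Z\subset\widehat X:=X\oplus\mathbb Z\subset\widehat V:=V\oplus\mathbb Q$, with $s_{(\alpha,-n)}:=s_{\alpha,n}$; $\widehat R^+=\{(\alpha,n):n>0\}\cup\{(\alpha,0):\alpha\in R^+\}$; $\widehat\Pi=\{(\alpha,0):\alpha\in\Pi\}\cup\{(-\tilde\alpha,1)\}$; $\widehat{\mathcal S}=\{s_\gamma:\gamma\in\widehat\Pi\}$. $(\widehat{\mathcal W},\widehat{\mathcal S})$ is a Coxeter system with length $\ell$, Bruhat order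 $\le$, unit $e$. $\widehat{\mathcal W}$ acts linearly on $\widehat V$ by $s_\alpha(\beta)=\beta-\langle\{\beta\},\{\alpha\}^\vee\rangle\alpha$, where $\{(\lambda,n)\}=\lambda$. $\mathbb F$ is a field of characteristic $\neq2$, $\mathsf V=\widehat X\otimes_{\mathbb Z}\mathbb F$, $S$ is the symmetric algebra of $\mathsf V$, $\mathbb Z$-graded with $\mathsf V$ in degree $2$; $\bar\lambda:=\lambda\otimes1$ for $\lambda\in\widehat X$. The moment graph $\widehat{\mathcal G}$ has vertex poset $(\widehat{\mathcal W},\le)$ and an edge $x\to y$ labelled $\bar\alpha$ iff $x<y$ and $y=s_\alpha x$, $\alpha\in\widehat R^+$. $\widehat{\mathcal G}_\Omega$ is the full subgraph on $\Omega\subset\widehat{\mathcal W}$ (all edges between elements of $\Omega$). GKM-property: labels of any two distinct edges with a common vertex are not proportional over $\mathbb F$. Sequences. A subsequence of $\mathbf s=(s_1,\dots,s_l)$ is obtained by replacing some entries by the blank symbol $\ast$; $I(\mathbf s)$ is the set of all $2^l$ subsequences; $\operatorname{ev}(\sigma)\in\widehat{\mathcal W}$ is the ordered product of the non-blank entries of $\sigma$; $I(\mathbf s)_x=\{\sigma\in I(\mathbf s):\operatorname{ev}(\sigma)=x\}$; $J(\mathbf s)=\{\operatorname{ev}(\sigma):\sigma\in I(\mathbf s)\}$; $\mathbf s'=(s_1,\dots,s_{l-1})$. The module $\mathcal X(\mathbf s)$. For $\lambda\in\widehat X$, $c^\lambda$ acts on $f\in\bigoplus_{\sigma\in I(\mathbf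 s)}S$ by $(c^\lambda f)_\sigma=\overline{\operatorname{ev}(\sigma)(\lambda)}\,f_\sigma$. $\Delta:\bigoplus_{\sigma\in I(\mathbf s')}S\to\bigoplus_{\sigma\in I(\mathbf s)}S$ is $\Delta(f)_{\sigma\ast}=\Delta(f)_{\sigma s_l}=f_\sigma$ (appending $\ast$ or $s_l$ to $\sigma\in I(\mathbf s')$). $\mathcal X(\emptyset)=\bigoplus_{\sigma\in I(\emptyset)}S\cong S$, and $\mathcal X(\mathbf s)=\Delta(\mathcal X(\mathbf s'))+c^{\alpha_l}\Delta(\mathcal X(\mathbf s'))\subset\bigoplus_{\sigma\in I(\mathbf s)}S$ for $\mathbf s\neq\emptyset$, where $\alpha_l\in\widehat\Pi$, $s_l=s_{\alpha_l}$. *)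

theory Defs
  imports "HOL-Algebra.Algebra" "HOL-Library.Poly_Mapping" "HOL-Library.Product_Plus"
begin

text \<open>
  The ambient \<open>\<rat>\<close>-vector space \<open>V\<close> is the whole type \<open>'v\<close> with scalar multiplication \<open>smul\<close>.
  The pairing \<open>\<langle>\<mu>, \<alpha>\<^sup>\<or>\<rangle>\<close> is \<open>coroot D \<alpha> \<mu>\<close>; values of \<open>coroot D\<close> off the roots are irrelevant.
\<close>

record 'v root_datum =
  smul :: "rat \<Rightarrow> 'v \<Rightarrow> 'v"
  roots :: "'v set"
  coroot :: "'v \<Rightarrow> 'v \<Rightarrow> rat"
  simple_roots :: "'v set"
  highest :: "'v"

definition dual_space :: "'v::ab_group_add root_datum \<Rightarrow> ('v \<Rightarrow> rat) set" where
  "dual_space D = {\<phi>. Vector_Spaces.linear (smul D) (*) \<phi>}"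

definition root_system :: "'v::ab_group_add root_datum \<Rightarrow> bool" where
  "root_system D \<longleftrightarrow>
     vector_space (smul D) \<and>
     finite (roots D) \<and> 0 \<notin> roots D \<and> module.span (smul D) (roots D) = UNIV \<and>
     (\<forall>\<alpha>\<in>roots D. coroot D \<alpha> \<in> dual_space D \<and> coroot D \<alpha> \<alpha> = 2 \<and>
        (\<forall>\<beta>\<in>roots D. coroot D \<alpha> \<beta> \<in> \<int> \<and> \<beta> - smul D (coroot D \<alpha> \<beta>) \<alpha> \<in> roots D))"

definition reduced :: "'v::ab_group_add root_datum \<Rightarrow> bool" where
  "reduced D \<longleftrightarrow> (\<forall>\<alpha>\<in>roots D. \<forall>c. smul D c \<alpha> \<in> roots D \<longrightarrow> c = 1 \<or> c = -1)"

definition irreducible_roots :: "'v::ab_group_add root_datum \<Rightarrow> bool" where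
  "irreducible_roots D \<longleftrightarrow> roots D \<noteq> {} \<and>
     \<not> (\<exists>R1 R2. R1 \<noteq> {} \<and> R2 \<noteq> {} \<and> R1 \<union> R2 = roots D \<and> R1 \<inter> R2 = {} \<and>
          (\<forall>\<alpha>\<in>R1. \<forall>\<beta>\<in>R2. coroot D \<alpha> \<beta> = 0))"

definition positive_cone :: "'v::ab_group_add root_datum \<Rightarrow> 'v set" where
  "positive_cone D = {\<Sum>\<alpha>\<in>simple_roots D. smul D (of_nat (c \<alpha>)) \<alpha> | c. True}"

definition is_base :: "'v::ab_group_add root_datum \<Rightarrow> bool" where
  "is_base D \<longleftrightarrow> simple_roots D \<subseteq> roots D \<and>
     \<not> module.dependent (smul D) (simple_roots D) \<and>
     (\<forall>\<beta>\<in>roots D. \<beta> \<in> positive_cone D \<or> - \<beta> \<in> positive_cone D)"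

definition positive_roots :: "'v::ab_group_add root_datum \<Rightarrow> 'v set" where
  "positive_roots D = roots D \<inter> positive_cone D"

definition is_highest_root :: "'v::ab_group_add root_datum \<Rightarrow> bool" where
  "is_highest_root D \<longleftrightarrow>
     highest D \<in> roots D \<and> (\<forall>\<beta>\<in>roots D. highest D - \<beta> \<in> positive_cone D)"

definition irreducible_reduced_root_datum :: "'v::ab_group_add root_datum \<Rightarrow> bool" where
  "irreducible_reduced_root_datum D \<longleftrightarrow>
     root_system D \<and> reduced D \<and> irreducible_roots D \<and> is_base D \<and> is_highest_root D"

definition weights :: "'v::ab_group_add root_datum \<Rightarrow> 'v set" where
  "weights D = {\<mu>. \<forall>\<alpha>\<in>roots D. coroot D \<alpha> \<mu> \<in> \<int>}"

text \<open>
  The space \<open>V \<oplus> \<rat>\<close> is \<open>'v \<times> rat\<close>; the affine weight lattice and the affine roots are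
  subsets of it.
\<close>

definition affine_weights :: "'v::ab_group_add root_datum \<Rightarrow> ('v \<times> rat) set" where
  "affine_weights D = weights D \<times> \<int>"

definition affine_roots :: "'v::ab_group_add root_datum \<Rightarrow> ('v \<times> rat) set" where
  "affine_roots D = roots D \<times> \<int>"

definition affine_positive_roots :: "'v::ab_group_add root_datum \<Rightarrow> ('v \<times> rat) set" where
  "affine_positive_roots D =
     {(\<alpha>, n). \<alpha> \<in> roots D \<and> n \<in> \<int> \<and> n > 0} \<union> {(\<alpha>, 0) | \<alpha>. \<alpha> \<in> positive_roots D}"

definition affine_simple_roots :: "'v::ab_group_add root_datum \<Rightarrow> ('v \<times> rat) set" where
  "affine_simple_roots D = {(\<alpha>, 0) | \<alpha>. \<alpha> \<in> simple_roots D} \<union> {(- highest D, 1)}"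

type_synonym 'v transf = "('v \<Rightarrow> rat) \<Rightarrow> ('v \<Rightarrow> rat)"

definition affine_reflection :: "'v::ab_group_add root_datum \<Rightarrow> 'v \<Rightarrow> rat \<Rightarrow> 'v transf" where
  "affine_reflection D \<alpha> n = (\<lambda>v\<in>dual_space D. \<lambda>\<mu>. v \<mu> - (v \<alpha> - n) * coroot D \<alpha> \<mu>)"

text \<open>Note the sign: the affine root \<open>(\<alpha>, -n)\<close> corresponds to the reflection \<open>s\<^bsub>\<alpha>,n\<^esub>\<close>.\<close>

definition refl_of_root :: "'v::ab_group_add root_datum \<Rightarrow> 'v \<times> rat \<Rightarrow> 'v transf" where
  "refl_of_root D \<gamma> = affine_reflection D (fst \<gamma>) (- snd \<gamma>)"

definition affine_weyl :: "'v::ab_group_add root_datum \<Rightarrow> 'v transf monoid" where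
  "affine_weyl D = subgroup_generated (BijGroup (dual_space D))
     {affine_reflection D \<alpha> n | \<alpha> n. \<alpha> \<in> roots D \<and> n \<in> \<int>}"

definition simple_reflections :: "'v::ab_group_add root_datum \<Rightarrow> 'v transf set" where
  "simple_reflections D = refl_of_root D ` affine_simple_roots D"

definition simple_root_of :: "'v::ab_group_add root_datum \<Rightarrow> 'v transf \<Rightarrow> 'v \<times> rat" where
  "simple_root_of D s = (THE \<gamma>. \<gamma> \<in> affine_simple_roots D \<and> refl_of_root D \<gamma> = s)"

definition linear_reflection ::
    "'v::ab_group_add root_datum \<Rightarrow> 'v \<times> rat \<Rightarrow> 'v \<times> rat \<Rightarrow> 'v \<times> rat" where
  "linear_reflection D \<gamma> \<beta> =
     (let k = coroot D (fst \<gamma>) (fst \<beta>)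
      in (fst \<beta> - smul D k (fst \<gamma>), snd \<beta> - k * snd \<gamma>))"

text \<open>
  The action of the affine Weyl group on \<open>V \<oplus> \<rat>\<close> is the unique group action extending the
  assignment \<open>s\<^bsub>\<gamma>\<^esub> \<mapsto> linear_reflection D \<gamma>\<close>. It exists because, viewing \<open>(\<mu>, n)\<close> as the affine
  function \<open>v \<mapsto> v \<mu> + n\<close> on the dual space, \<open>linear_reflection D \<gamma>\<close> is precomposition with
  \<open>s\<^bsub>\<gamma>\<^esub>\<close>.
\<close>

definition affine_action ::
    "'v::ab_group_add root_datum \<Rightarrow> 'v transf \<Rightarrow> 'v \<times> rat \<Rightarrow> 'v \<times> rat" where
  "affine_action D = (THE \<rho>.
     group_action (affine_weyl D) UNIV \<rho> \<and> \<rho> \<in> extensional (carrier (affine_weyl D)) \<and>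
     (\<forall>\<gamma>\<in>affine_roots D. \<rho> (refl_of_root D \<gamma>) = linear_reflection D \<gamma>))"

definition word_prod :: "('a, 'b) monoid_scheme \<Rightarrow> 'a list \<Rightarrow> 'a" where
  "word_prod G ws = foldr (\<lambda>a b. a \<otimes>\<^bsub>G\<^esub> b) ws \<one>\<^bsub>G\<^esub>"

definition word_length :: "('a, 'b) monoid_scheme \<Rightarrow> 'a set \<Rightarrow> 'a \<Rightarrow> nat" where
  "word_length G S w = (LEAST k. \<exists>ws. set ws \<subseteq> S \<and> length ws = k \<and> word_prod G ws = w)"

text \<open>The strict Bruhat order of a Coxeter system \<open>(G, S)\<close>; the reflections are the conjugates of \<open>S\<close>.\<close>

definition bruhat_less :: "('a, 'b) monoid_scheme \<Rightarrow> 'a set \<Rightarrow> ('a \<times> 'a) set" where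
  "bruhat_less G S =
     {(x, t \<otimes>\<^bsub>G\<^esub> x) | x t. x \<in> carrier G \<and>
        (\<exists>g\<in>carrier G. \<exists>s\<in>S. t = g \<otimes>\<^bsub>G\<^esub> s \<otimes>\<^bsub>G\<^esub> inv\<^bsub>G\<^esub> g) \<and>
        word_length G S x < word_length G S (t \<otimes>\<^bsub>G\<^esub> x)}\<^sup>+"

text \<open>
  The \<open>\<int>\<close>-module structure on \<open>V \<oplus> \<rat>\<close>. Given an ordered \<open>\<int>\<close>-basis \<open>(b\<^sub>0, \<dots>, b\<^sub>k)\<close> of the
  affine weight lattice, the vectors \<open>b\<^sub>i \<otimes> 1\<close> form a basis of its scalar extension to the field, so
  the symmetric algebra \<open>S\<close> of that extension is the polynomial ring in the variables
  \<open>x\<^sub>i = b\<^sub>i \<otimes> 1\<close>, and \<open>\<mu> \<otimes> 1\<close> is \<open>\<Sum>\<^sub>i n\<^sub>i x\<^sub>i\<close> for \<open>\<mu> = \<Sum>\<^sub>i n\<^sub>i b\<^sub>i\<close>.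
\<close>

definition int_smul :: "'v::ab_group_add root_datum \<Rightarrow> int \<Rightarrow> 'v \<times> rat \<Rightarrow> 'v \<times> rat" where
  "int_smul D k \<mu> = (smul D (of_int k) (fst \<mu>), of_int k * snd \<mu>)"

definition affine_weight_basis ::
    "'v::ab_group_add root_datum \<Rightarrow> ('v \<times> rat) list \<Rightarrow> bool" where
  "affine_weight_basis D bs \<longleftrightarrow> distinct bs \<and>
     \<not> module.dependent (int_smul D) (set bs) \<and>
     module.span (int_smul D) (set bs) = affine_weights D"

type_synonym 'f mpoly = "(nat \<Rightarrow>\<^sub>0 nat) \<Rightarrow>\<^sub>0 'f"

definition mvar :: "nat \<Rightarrow> 'f::field mpoly" where
  "mvar i = Poly_Mapping.single (Poly_Mapping.single i 1) 1"

definition mconst :: "'f::field \<Rightarrow> 'f mpoly" where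
  "mconst c = Poly_Mapping.single 0 c"

definition sym_algebra :: "('v \<times> rat) list \<Rightarrow> 'f::field mpoly set" where
  "sym_algebra bs =
     {p. \<forall>m\<in>Poly_Mapping.keys p. Poly_Mapping.keys m \<subseteq> {..<length bs}}"

definition bar :: "'v::ab_group_add root_datum \<Rightarrow> ('v \<times> rat) list \<Rightarrow> 'v \<times> rat \<Rightarrow> 'f::field mpoly"
  where "bar D bs \<mu> =
    (\<Sum>i<length bs.
       mconst (of_int (module.representation (int_smul D) (set bs) \<mu> (bs ! i))) * mvar i)"

text \<open>
  A moment graph on the affine Weyl group is given by its set of edges \<open>(x, y, l)\<close>, standing for an
  edge \<open>x \<rightarrow> y\<close> with label \<open>l\<close>.
\<close>

definition moment_graph ::
    "'v::ab_group_add root_datum \<Rightarrow> ('v \<times> rat) list \<Rightarrow>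
     ('v transf \<times> 'v transf \<times> 'f::field mpoly) set" where
  "moment_graph D bs = {(x, y, bar D bs \<gamma>) | x y \<gamma>.
     x \<in> carrier (affine_weyl D) \<and> y \<in> carrier (affine_weyl D) \<and>
     \<gamma> \<in> affine_positive_roots D \<and>
     (x, y) \<in> bruhat_less (affine_weyl D) (simple_reflections D) \<and>
     y = refl_of_root D \<gamma> \<otimes>\<^bsub>affine_weyl D\<^esub> x}"

definition full_subgraph :: "('w \<times> 'w \<times> 'l) set \<Rightarrow> 'w set \<Rightarrow> ('w \<times> 'w \<times> 'l) set" where
  "full_subgraph E \<Omega> = {(x, y, l) \<in> E. x \<in> \<Omega> \<and> y \<in> \<Omega>}"

definition proportional :: "'f::field mpoly \<Rightarrow> 'f mpoly \<Rightarrow> bool" where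
  "proportional p q \<longleftrightarrow> (\<exists>c. p = mconst c * q) \<or> (\<exists>c. q = mconst c * p)"

definition GKM :: "('w \<times> 'w \<times> 'f::field mpoly) set \<Rightarrow> bool" where
  "GKM E \<longleftrightarrow> (\<forall>(x1, y1, l1)\<in>E. \<forall>(x2, y2, l2)\<in>E.
     (x1, y1, l1) \<noteq> (x2, y2, l2) \<and> {x1, y1} \<inter> {x2, y2} \<noteq> {} \<longrightarrow> \<not> proportional l1 l2)"

text \<open>In a subsequence, \<open>None\<close> plays the role of the blank symbol.\<close>

definition subseqs_of :: "'w list \<Rightarrow> 'w option list set" where
  "subseqs_of ss = {\<sigma>. list_all2 (\<lambda>a s. a = None \<or> a = Some s) \<sigma> ss}"

definition ev :: "'v::ab_group_add root_datum \<Rightarrow> 'v transf option list \<Rightarrow> 'v transf" where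
  "ev D \<sigma> = word_prod (affine_weyl D) (map the (filter (\<lambda>a. a \<noteq> None) \<sigma>))"

definition subseqs_at ::
    "'v::ab_group_add root_datum \<Rightarrow> 'v transf list \<Rightarrow> 'v transf \<Rightarrow> 'v transf option list set" where
  "subseqs_at D ss x = {\<sigma> \<in> subseqs_of ss. ev D \<sigma> = x}"

definition ev_set :: "'v::ab_group_add root_datum \<Rightarrow> 'v transf list \<Rightarrow> 'v transf set" where
  "ev_set D ss = ev D ` subseqs_of ss"

text \<open>
  An element of \<open>\<Oplus>\<^bsub>\<sigma> \<in> I(s)\<^esub> S\<close> is a function on option lists that vanishes off \<open>I(s)\<close>.
\<close>

definition seq_sum ::
    "('v \<times> rat) list \<Rightarrow> 'w list \<Rightarrow> ('w option list \<Rightarrow> 'f::field mpoly) set" where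
  "seq_sum bs ss = {f. (\<forall>\<sigma>\<in>subseqs_of ss. f \<sigma> \<in> sym_algebra bs) \<and> (\<forall>\<sigma>. \<sigma> \<notin> subseqs_of ss \<longrightarrow> f \<sigma> = 0)}"

definition c_op ::
    "'v::ab_group_add root_datum \<Rightarrow> ('v \<times> rat) list \<Rightarrow> 'v \<times> rat \<Rightarrow>
     ('v transf option list \<Rightarrow> 'f::field mpoly) \<Rightarrow> 'v transf option list \<Rightarrow> 'f mpoly" where
  "c_op D bs \<mu> f = (\<lambda>\<sigma>. bar D bs (affine_action D (ev D \<sigma>) \<mu>) * f \<sigma>)"

definition diag ::
    "'w list \<Rightarrow> ('w option list \<Rightarrow> 'f::field mpoly) \<Rightarrow> 'w option list \<Rightarrow> 'f mpoly" where
  "diag ss f = (\<lambda>\<sigma>. if \<sigma> \<in> subseqs_of ss then f (butlast \<sigma>) else 0)"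

function X_module ::
    "'v::ab_group_add root_datum \<Rightarrow> ('v \<times> rat) list \<Rightarrow> 'v transf list \<Rightarrow>
     ('v transf option list \<Rightarrow> 'f::field mpoly) set" where
  "X_module D bs [] = seq_sum bs []"
| "X_module D bs (ss @ [s]) =
     {\<lambda>\<sigma>. diag (ss @ [s]) f \<sigma> + c_op D bs (simple_root_of D s) (diag (ss @ [s]) g) \<sigma> | f g.
        f \<in> X_module D bs ss \<and> g \<in> X_module D bs ss}"
  by (auto, metis rev_exhaust)
termination by (relation "measure (\<lambda>(D, bs, ss). length ss)") auto

end

theory Submission
  imports Defs
begin

text \<open>
  Write \<open>s = (s', s\<^sub>l)\<close> and \<open>\<alpha> = \<alpha>\<^sub>l\<close>. Since \<open>(x s\<^sub>l)(\<alpha>) = - x(\<alpha>)\<close>, restricting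
  \<open>\<Delta>(f) + c\<^sup>\<alpha> \<Delta>(g)\<close> to \<open>I(s)\<^sub>x\<close> amounts to restricting \<open>f + x(\<alpha>) g \<in> X(s')\<close> to the
  subsequences of \<open>s'\<close> evaluating to \<open>x\<close> or \<open>x s\<^sub>l\<close>. This allows an induction that proves the claim
  together with the following property of the restrictions to \<open>I(s)\<^sub>x\<close>, which replaces freeness over
  \<open>S\<close>: if \<open>a P = b Q\<close> for nonproportional linear forms \<open>a\<close>, \<open>b\<close>, then \<open>P\<close> is divisible by \<open>b\<close> inside
  the module.

  If \<open>y = x s\<^sub>l\<close>, the quotient is an explicit multiple of \<open>g\<close>. Otherwise \<open>y s\<^sub>l \<rightarrow> x s\<^sub>l\<close> is an edge with
  the same label, so by induction the restrictions to \<open>x\<close> and to \<open>x s\<^sub>l\<close> can be divided separately. The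
  two quotients are glued along the edge \<open>u \<rightarrow> v\<close> joining \<open>x\<close> and \<open>x s\<^sub>l\<close>: by the GKM-property its label
  is coprime to that of \<open>y \<rightarrow> x\<close>, so the quotients differ at \<open>v\<close> by a multiple of the label \<open>\<beta>\<close>, and
  \<open>(\<beta> - c\<^sup>\<mu>)/2\<close> with \<open>\<mu> = u\<^sup>-\<^sup>1(\<beta>)\<close> acts by \<open>0\<close> at \<open>u\<close> and by \<open>\<beta>\<close> at \<open>v\<close>. The lower end of each edge
  used lies in \<open>J(s')\<close> by the strong exchange condition.
\<close>

section \<open>Linear forms in polynomial rings\<close>

lemma lookup_single_times:
  fixes p :: "'a::cancel_comm_monoid_add \<Rightarrow>\<^sub>0 'b::comm_semiring_1"
  shows "Poly_Mapping.lookup (Poly_Mapping.single a c * p) (a + m) = c * Poly_Mapping.lookup p m"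
  by (simp add: lookup_mult lookup_single when_mult)

lemma lookup_single_times_eq_0:
  fixes p :: "'a::cancel_comm_monoid_add \<Rightarrow>\<^sub>0 'b::comm_semiring_1"
  assumes "\<And>q. q \<in> Poly_Mapping.keys p \<Longrightarrow> m \<noteq> a + q"
  shows "Poly_Mapping.lookup (Poly_Mapping.single a c * p) m = 0"
proof -
  have "Poly_Mapping.keys (Poly_Mapping.single a c * p) \<subseteq> {a + q | q. q \<in> Poly_Mapping.keys p}"
    using keys_mult[of "Poly_Mapping.single a c" p] by (auto split: if_splits)
  then have "m \<notin> Poly_Mapping.keys (Poly_Mapping.single a c * p)"
    using assms by blast
  then show ?thesis by (simp add: in_keys_iff)
qed

lemma sym_algebra_0 [simp]: "0 \<in> sym_algebra bs"
  by (simp add: sym_algebra_def)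

lemma sym_algebra_const [simp]: "mconst c \<in> sym_algebra bs"
  by (simp add: sym_algebra_def mconst_def)

lemma mconst_1 [simp]: "mconst 1 = 1"
  by (simp add: mconst_def)

lemma mconst_0 [simp]: "mconst 0 = 0"
  by (simp add: mconst_def)

lemma mconst_mult: "mconst (a * b) = mconst a * mconst b"
  by (simp add: mconst_def mult_single)

lemma mconst_add: "mconst (a + b) = mconst a + mconst b"
  by (simp add: mconst_def single_add)

lemma mconst_diff: "mconst (a - b) = mconst a - mconst b"
  by (simp add: mconst_def single_diff)

lemma mconst_uminus: "mconst (- a) = - mconst a"
  by (simp add: mconst_def single_uminus)

lemma sym_algebra_var [simp]: "i < length bs \<Longrightarrow> mvar i \<in> sym_algebra bs"
  by (simp add: sym_algebra_def mvar_def)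

lemma sym_algebra_add [simp]:
  "p \<in> sym_algebra bs \<Longrightarrow> q \<in> sym_algebra bs \<Longrightarrow> p + q \<in> sym_algebra bs"
  unfolding sym_algebra_def using Poly_Mapping.keys_add[of p q] by blast

lemma sym_algebra_mult [simp]:
  assumes "p \<in> sym_algebra bs" "q \<in> sym_algebra bs" shows "p * q \<in> sym_algebra bs"
proof -
  have "Poly_Mapping.keys m \<subseteq> {..<length bs}" if "m \<in> Poly_Mapping.keys (p * q)" for m
  proof -
    obtain a b where "m = a + b" "a \<in> Poly_Mapping.keys p" "b \<in> Poly_Mapping.keys q"
      using keys_mult[of p q] \<open>m \<in> _\<close> by blast
    then show ?thesis
      using assms Poly_Mapping.keys_add[of a b] unfolding sym_algebra_def by blast
  qed
  then show ?thesis by (simp add: sym_algebra_def)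
qed

lemma sym_algebra_uminus [simp]: "p \<in> sym_algebra bs \<Longrightarrow> - p \<in> sym_algebra bs"
  using sym_algebra_mult[OF sym_algebra_const[of "-1"], of p bs] by (simp add: mconst_uminus)

lemma sym_algebra_diff [simp]:
  "p \<in> sym_algebra bs \<Longrightarrow> q \<in> sym_algebra bs \<Longrightarrow> p - q \<in> sym_algebra bs"
  using sym_algebra_add[of p bs "- q"] by simp

lemma sym_algebra_sum [simp]:
  "(\<And>i. i \<in> A \<Longrightarrow> f i \<in> sym_algebra bs) \<Longrightarrow> sum f A \<in> sym_algebra bs"
  by (induction A rule: infinite_finite_induct) auto

lemma sum_monomials:
  "p = (\<Sum>m\<in>Poly_Mapping.keys p. Poly_Mapping.single m (Poly_Mapping.lookup p m))"
  by (rule poly_mapping_eqI)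
     (auto simp: lookup_sum lookup_single when_def in_keys_iff)

text \<open>Coefficients range over the whole field, although labels have integral ones
  (\<open>br_lin_form\<close>): the elimination in \<open>lin_form_coprime\<close> subtracts a field
  multiple of one form from another.\<close>

definition lin_form :: "nat \<Rightarrow> (nat \<Rightarrow> 'f::field) \<Rightarrow> 'f mpoly" where
  "lin_form n c = (\<Sum>i<n. mconst (c i) * mvar i)"

lemma lin_form_in_sym_algebra [simp]: "lin_form (length bs) c \<in> sym_algebra bs"
  unfolding lin_form_def by (intro sym_algebra_sum) auto

lemma lin_form_diff: "lin_form n c - lin_form n d = lin_form n (\<lambda>i. c i - d i)"
  by (simp add: lin_form_def sum_subtractf[symmetric] mconst_diff algebra_simps)

lemma lin_form_smult: "mconst a * lin_form n c = lin_form n (\<lambda>i. a * c i)"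
  by (simp add: lin_form_def sum_distrib_left mconst_mult algebra_simps)

section \<open>Division with remainder by a linear form\<close>

definition var_free :: "nat \<Rightarrow> 'f::field mpoly \<Rightarrow> bool" where
  "var_free i p \<longleftrightarrow> (\<forall>m\<in>Poly_Mapping.keys p. Poly_Mapping.lookup m i = 0)"

lemma var_free_0 [simp]: "var_free i 0"
  by (simp add: var_free_def)

lemma var_free_add: "var_free i p \<Longrightarrow> var_free i q \<Longrightarrow> var_free i (p + q)"
  unfolding var_free_def using Poly_Mapping.keys_add[of p q] by blast

lemma var_free_mult: "var_free i p \<Longrightarrow> var_free i q \<Longrightarrow> var_free i (p * q)"
  unfolding var_free_def using keys_mult[of p q] by (fastforce simp: lookup_add)

lemma var_free_sum: "(\<And>j. j \<in> A \<Longrightarrow> var_free i (f j)) \<Longrightarrow> var_free i (sum f A)"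
  by (induction A rule: infinite_finite_induct) (auto simp: var_free_add)

lemma var_free_lin_form:
  assumes "c i = 0" shows "var_free i (lin_form n c)"
  unfolding lin_form_def
proof (rule var_free_sum)
  fix j
  show "var_free i (mconst (c j) * mvar j)"
  proof (cases "j = i")
    case False
    then show ?thesis
      by (intro var_free_mult) (auto simp: var_free_def mconst_def mvar_def lookup_single)
  qed (simp add: assms)
qed

text \<open>A form whose \<open>i\<close>-th coefficient is nonzero can be solved for the
  \<open>i\<close>-th variable, so modulo the form that variable can be eliminated. The set
  \<open>T\<close> of polynomials admitting a decomposition is closed under sums and under
  multiplication by \<open>mvar i\<close>, which gives all monomials by induction on the exponent of
  that variable.\<close>

lemma lin_form_division:
  fixes c :: "nat \<Rightarrow> 'f::field"
  assumes i: "i < length bs" and ci: "c i \<noteq> 0" and p: "p \<in> sym_algebra bs"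
  shows "\<exists>r\<in>sym_algebra bs. \<exists>p0\<in>sym_algebra bs. var_free i p0 \<and> p = lin_form (length bs) c * r + p0"
proof -
  let ?b = "lin_form (length bs) c" and ?S = "sym_algebra bs"
  define T where "T = {p. \<exists>r\<in>?S. \<exists>p0\<in>?S. var_free i p0 \<and> p = ?b * r + p0}"
  have T_add: "p + q \<in> T" if pq: "p \<in> T" "q \<in> T" for p q
  proof -
    obtain r p0 where h1: "r \<in> ?S" "p0 \<in> ?S" "var_free i p0" "p = ?b * r + p0"
      using pq(1) unfolding T_def by blast
    obtain r' q0 where h2: "r' \<in> ?S" "q0 \<in> ?S" "var_free i q0" "q = ?b * r' + q0"
      using pq(2) unfolding T_def by blast
    note h = h1 h2
    have "p + q = ?b * (r + r') + (p0 + q0)" unfolding h(4,8) by (simp add: algebra_simps)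
    then show ?thesis
      unfolding T_def using h var_free_add sym_algebra_add by blast
  qed
  have T_var: "mvar i * p \<in> T" if pT: "p \<in> T" for p
  proof -
    obtain r p0 where h: "r \<in> ?S" "p0 \<in> ?S" "var_free i p0" "p = ?b * r + p0"
      using pT unfolding T_def by blast
    \<comment> \<open>\<open>d\<close> is the value of \<open>mvar i\<close> obtained by solving
      \<open>?b = 0\<close>; it does not involve \<open>mvar i\<close>.\<close>
    define d where "d = lin_form (length bs) (\<lambda>j. if j = i then 0 else - c j / c i)"
    have "?b = mconst (c i) * mvar i + (\<Sum>j\<in>{..<length bs} - {i}. mconst (c j) * mvar j)"
      unfolding lin_form_def using i by (subst sum.remove[of _ i]) auto
    moreover have "mconst (c i) * d = - (\<Sum>j\<in>{..<length bs} - {i}. mconst (c j) * mvar j)"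
      unfolding d_def lin_form_smult unfolding lin_form_def using i ci
      by (subst sum.remove[of _ i]) (auto simp: mconst_uminus sum_negf[symmetric] intro!: sum.cong)
    ultimately have "?b = mconst (c i) * (mvar i - d)"
      by (simp add: algebra_simps)
    then have "mconst (1 / c i) * ?b = mconst (1 / c i * c i) * (mvar i - d)"
      by (simp only: mconst_mult mult.assoc)
    then have "mvar i = mconst (1 / c i) * ?b + d"
      using ci by simp
    then have "mvar i * p0 = (mconst (1 / c i) * ?b + d) * p0" by metis
    then have "mvar i * p = ?b * (mvar i * r + mconst (1 / c i) * p0) + d * p0"
      unfolding h(4) by (simp add: algebra_simps)
    moreover have "var_free i (d * p0)"
      unfolding d_def by (intro var_free_mult var_free_lin_form h) auto
    moreover have "d * p0 \<in> ?S" "mvar i * r + mconst (1 / c i) * p0 \<in> ?S"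
      using h i by (simp_all add: d_def)
    ultimately show ?thesis unfolding T_def by blast
  qed
  have T_mon: "Poly_Mapping.single m a \<in> T" if "Poly_Mapping.keys m \<subseteq> {..<length bs}" for m a
    using that
  proof (induction "Poly_Mapping.lookup m i" arbitrary: m)
    case 0
    then have "Poly_Mapping.single m a \<in> ?S" "var_free i (Poly_Mapping.single m a)"
      by (auto simp: sym_algebra_def var_free_def)
    then show ?case unfolding T_def
      by (metis (mono_tags, lifting) add_0 mem_Collect_eq mult_zero_right sym_algebra_0)
  next
    case (Suc k)
    define m' where "m' = Poly_Mapping.update i k m"
    have m: "m = Poly_Mapping.single i 1 + m'"
      by (rule poly_mapping_eqI) (auto simp: m'_def lookup_add lookup_single lookup_update when_def Suc(2)[symmetric])
    have "Poly_Mapping.keys m' \<subseteq> {..<length bs}"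
      using Suc.prems i by (auto simp: m'_def in_keys_iff lookup_update subset_iff split: if_splits)
    moreover have "k = Poly_Mapping.lookup m' i" by (simp add: m'_def lookup_update)
    ultimately have "Poly_Mapping.single m' a \<in> T" using Suc(1) by blast
    then have "mvar i * Poly_Mapping.single m' a \<in> T" by (rule T_var)
    then show ?case by (simp add: mvar_def mult_single m)
  qed
  have "(\<Sum>m\<in>A. Poly_Mapping.single m (Poly_Mapping.lookup p m)) \<in> T"
    if "finite A" "A \<subseteq> Poly_Mapping.keys p" for A
    using that
  proof (induction A)
    case empty
    have "0 \<in> T" unfolding T_def by (rule CollectI) (rule bexI[of _ 0], rule bexI[of _ 0], auto)
    then show ?case by simp
  next
    case (insert m A)
    then have "Poly_Mapping.single m (Poly_Mapping.lookup p m) \<in> T"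
      using p by (intro T_mon) (auto simp: sym_algebra_def)
    then show ?case using insert by (auto intro: T_add)
  qed
  from this[OF finite_keys order_refl] have "p \<in> T"
    by (subst sum_monomials) 
  then show ?thesis unfolding T_def by blast
qed

text \<open>The coefficient at a key of maximal degree in the \<open>i\<close>-th variable does not cancel.\<close>

lemma lin_form_mult_var_free:
  fixes c :: "nat \<Rightarrow> 'f::field"
  assumes i: "i < n" and ci: "c i \<noteq> 0" and free: "var_free i (lin_form n c * r)"
  shows "r = 0"
proof (rule ccontr)
  assume "r \<noteq> 0"
  then have "Poly_Mapping.keys r \<noteq> {}" by simp
  define d where "d = Max ((\<lambda>m. Poly_Mapping.lookup m i) ` Poly_Mapping.keys r)"
  have "d \<in> (\<lambda>m. Poly_Mapping.lookup m i) ` Poly_Mapping.keys r"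
    unfolding d_def using \<open>Poly_Mapping.keys r \<noteq> {}\<close> by (intro Max_in) auto
  then obtain m where m: "m \<in> Poly_Mapping.keys r" "Poly_Mapping.lookup m i = d" by blast
  have max: "Poly_Mapping.lookup q i \<le> d" if "q \<in> Poly_Mapping.keys r" for q
    unfolding d_def using that by (intro Max_ge) auto
  let ?k = "Poly_Mapping.single i 1 + m"
  have *: "mconst (c j) * mvar j = Poly_Mapping.single (Poly_Mapping.single j 1) (c j)" for j
    by (simp add: mconst_def mvar_def mult_single)
  have "Poly_Mapping.lookup (lin_form n c * r) ?k
      = (\<Sum>j<n. Poly_Mapping.lookup (Poly_Mapping.single (Poly_Mapping.single j 1) (c j) * r) ?k)"
    by (simp add: lin_form_def sum_distrib_right lookup_sum *)
  also have "\<dots> = (\<Sum>j<n. if j = i then c i * Poly_Mapping.lookup r m else 0)"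
  proof (rule sum.cong[OF refl])
    fix j assume "j \<in> {..<n}"
    show "Poly_Mapping.lookup (Poly_Mapping.single (Poly_Mapping.single j 1) (c j) * r) ?k
        = (if j = i then c i * Poly_Mapping.lookup r m else 0)"
    proof (cases "j = i")
      case True
      then show ?thesis by (simp add: lookup_single_times)
    next
      case False
      have "Poly_Mapping.lookup ?k i = Suc d" by (simp add: lookup_add m)
      moreover have "Poly_Mapping.lookup (Poly_Mapping.single j 1 + q) i = Poly_Mapping.lookup q i" for q
        using False by (simp add: lookup_add lookup_single)
      ultimately have "?k \<noteq> Poly_Mapping.single j 1 + q" if "q \<in> Poly_Mapping.keys r" for q
        using max[OF that] by (metis Suc_n_not_le_n)
      then show ?thesis using False by (simp add: lookup_single_times_eq_0)
    qed
  qed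
  also have "\<dots> = c i * Poly_Mapping.lookup r m" using i by simp
  finally have "?k \<in> Poly_Mapping.keys (lin_form n c * r)"
    using m ci by (simp add: in_keys_iff)
  then show False using free unfolding var_free_def by (auto simp: lookup_add)
qed

text \<open>Let \<open>b\<close> involve the \<open>i\<close>-th variable. Subtracting a multiple of
  \<open>b\<close> removes this variable from \<open>a\<close>, and the result \<open>a'\<close> is
  nonzero by nonproportionality. Dividing \<open>p\<close> by \<open>b\<close> leaves a remainder
  \<open>p0\<close> without the variable; then \<open>a' * p0\<close> is a multiple of
  \<open>b\<close> free of that variable, hence zero.\<close>

lemma lin_form_coprime:
  fixes a b :: "nat \<Rightarrow> 'f::field"
  assumes np: "\<not> proportional (lin_form (length bs) a) (lin_form (length bs) b)"
    and p: "p \<in> sym_algebra bs"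
    and eq: "lin_form (length bs) a * p = lin_form (length bs) b * q"
  shows "\<exists>r\<in>sym_algebra bs. p = lin_form (length bs) b * r"
proof -
  let ?n = "length bs"
  have "\<exists>i<?n. b i \<noteq> 0"
  proof (rule ccontr)
    assume "\<not> ?thesis"
    then have "lin_form ?n b = 0" by (auto simp: lin_form_def)
    then have "lin_form ?n b = mconst 0 * lin_form ?n a" by simp
    then show False using np unfolding proportional_def by blast
  qed
  then obtain i where i: "i < ?n" "b i \<noteq> 0" by blast
  define a' where "a' = (\<lambda>j. a j - a i / b i * b j)"
  have a': "lin_form ?n a' = lin_form ?n a - mconst (a i / b i) * lin_form ?n b"
    by (simp only: lin_form_smult lin_form_diff a'_def)
  have a'_nz: "lin_form ?n a' \<noteq> 0"
    using np unfolding a' proportional_def by (metis eq_iff_diff_eq_0)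
  obtain r p0 where r: "r \<in> sym_algebra bs" "var_free i p0" "p = lin_form ?n b * r + p0"
    using lin_form_division[where c = b, OF i p] by metis
  have "lin_form ?n a' * p0 = lin_form ?n b * (q - mconst (a i / b i) * p - lin_form ?n a' * r)"
    using eq unfolding a' r(3) by (simp add: algebra_simps)
  moreover have "var_free i (lin_form ?n a' * p0)"
    using i r by (intro var_free_mult var_free_lin_form) (auto simp: a'_def)
  ultimately have "q - mconst (a i / b i) * p - lin_form ?n a' * r = 0"
    using lin_form_mult_var_free[where n = ?n and c = b] i by metis
  then have "lin_form ?n a' * p0 = 0"
    using \<open>lin_form ?n a' * p0 = _\<close> by simp
  then have "p0 = 0" using a'_nz by simp
  then show ?thesis using r by auto
qed

section \<open>Root systems and affine roots\<close>

lemma vector_space_rat: "vector_space ((*) :: rat \<Rightarrow> rat \<Rightarrow> rat)"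
  by unfold_locales (auto simp: algebra_simps)

locale root_datum =
  fixes D :: "'v::ab_group_add root_datum"
  assumes datum: "irreducible_reduced_root_datum D"
begin

lemma is_root_system: "root_system D" and is_reduced: "reduced D"
  and base: "is_base D" and highest: "is_highest_root D"
  using datum by (auto simp: irreducible_reduced_root_datum_def)

sublocale vs: vector_space "smul D"
  using is_root_system by (simp add: root_system_def)

lemma scale_two: "smul D 2 x = x + x"
  by (metis one_add_one vs.scale_left_distrib vs.scale_one)

lemma scale_double: "smul D (c * 2) x = smul D c x + smul D c x" "smul D (2 * c) x = smul D c x + smul D c x"
  by (metis mult_2 mult_2_right vs.scale_left_distrib)+

lemma finite_roots: "finite (roots D)" and span_roots: "vs.span (roots D) = UNIV"
  using is_root_system by (auto simp: root_system_def)

lemma root_nonzero: "\<alpha> \<in> roots D \<Longrightarrow> \<alpha> \<noteq> 0"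
  using is_root_system by (auto simp: root_system_def)

lemma coroot_in_dual: "\<alpha> \<in> roots D \<Longrightarrow> coroot D \<alpha> \<in> dual_space D"
  and coroot_self: "\<alpha> \<in> roots D \<Longrightarrow> coroot D \<alpha> \<alpha> = 2"
  and coroot_int: "\<alpha> \<in> roots D \<Longrightarrow> \<beta> \<in> roots D \<Longrightarrow> coroot D \<alpha> \<beta> \<in> \<int>"
  and reflect_root:
    "\<alpha> \<in> roots D \<Longrightarrow> \<beta> \<in> roots D \<Longrightarrow> \<beta> - smul D (coroot D \<alpha> \<beta>) \<alpha> \<in> roots D"
  using is_root_system by (auto simp: root_system_def)

section \<open>Linear functionals\<close>

lemma dual_space_iff:
  "\<phi> \<in> dual_space D \<longleftrightarrow>
     (\<forall>x y. \<phi> (x + y) = \<phi> x + \<phi> y) \<and> (\<forall>c x. \<phi> (smul D c x) = c * \<phi> x)"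
  unfolding dual_space_def mem_Collect_eq Vector_Spaces.linear_iff
  using vs.vector_space_axioms vector_space_rat by auto

lemma dual_add: "\<phi> \<in> dual_space D \<Longrightarrow> \<phi> (x + y) = \<phi> x + \<phi> y"
  and dual_scale: "\<phi> \<in> dual_space D \<Longrightarrow> \<phi> (smul D c x) = c * \<phi> x"
  by (auto simp: dual_space_iff)

lemma dual_0: "\<phi> \<in> dual_space D \<Longrightarrow> \<phi> 0 = 0"
  using dual_add[of \<phi> 0 0] by simp

lemma dual_uminus: "\<phi> \<in> dual_space D \<Longrightarrow> \<phi> (- x) = - \<phi> x"
  using dual_add[of \<phi> x "- x"] by (simp add: dual_0)

lemma dual_diff: "\<phi> \<in> dual_space D \<Longrightarrow> \<phi> (x - y) = \<phi> x - \<phi> y"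
  using dual_add[of \<phi> x "- y"] by (simp add: dual_uminus)

lemma dual_sum: "\<phi> \<in> dual_space D \<Longrightarrow> \<phi> (sum f A) = (\<Sum>a\<in>A. \<phi> (f a))"
  by (induction A rule: infinite_finite_induct) (auto simp: dual_0 dual_add)

lemmas dual_simps = dual_add dual_scale dual_0 dual_uminus dual_diff dual_sum

lemma dual_extend:
  assumes "vs.independent B" shows "\<exists>\<phi>\<in>dual_space D. \<forall>x\<in>B. \<phi> x = f x"
proof -
  interpret vector_space_pair "smul D" "(*) :: rat \<Rightarrow> rat \<Rightarrow> rat"
    by (intro vector_space_pair.intro vs.vector_space_axioms vector_space_rat)
  show ?thesis
    using linear_independent_extend[OF assms, of f] unfolding dual_space_def by blast
qed

lemma dual_separates:
  assumes "\<And>\<phi>. \<phi> \<in> dual_space D \<Longrightarrow> \<phi> x = \<phi> y" shows "x = y"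
proof (rule ccontr)
  assume "x \<noteq> y"
  then have "vs.independent {x - y}" by simp
  then obtain \<phi> where "\<phi> \<in> dual_space D" "\<phi> (x - y) = 1"
    using dual_extend[of "{x - y}" "\<lambda>_. 1"] by auto
  then show False using assms[of \<phi>] by (simp add: dual_diff)
qed

lemma dual_eq_0:
  assumes "\<phi> \<in> dual_space D" "\<And>\<beta>. \<beta> \<in> roots D \<Longrightarrow> \<phi> \<beta> = 0" shows "\<phi> x = 0"
proof -
  have "x \<in> vs.span (roots D)" by (simp add: span_roots)
  then show ?thesis
    by (induction rule: vs.span_induct_alt) (use assms in \<open>auto simp: dual_simps\<close>)
qed

section \<open>Reflections and uniqueness of coroots\<close>

abbreviation reflect :: "'v \<Rightarrow> 'v \<Rightarrow> 'v" where
  "reflect \<alpha> \<mu> \<equiv> \<mu> - smul D (coroot D \<alpha> \<mu>) \<alpha>"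

lemma coroot_reflect_self: "\<alpha> \<in> roots D \<Longrightarrow> coroot D \<alpha> (reflect \<alpha> \<mu>) = - coroot D \<alpha> \<mu>"
  by (simp add: dual_simps[OF coroot_in_dual] coroot_self)

lemma reflect_reflect: "\<alpha> \<in> roots D \<Longrightarrow> reflect \<alpha> (reflect \<alpha> \<mu>) = \<mu>"
  by (simp add: coroot_reflect_self)

text \<open>
  Two reflections along \<open>\<alpha>\<close> that preserve the finite set of roots differ by a transvection, which
  would move some root to infinitely many roots unless it is trivial.
\<close>

lemma coroot_unique:
  assumes \<alpha>: "\<alpha> \<in> roots D" and \<phi>: "\<phi> \<in> dual_space D" "\<phi> \<alpha> = 2"
    and pres: "\<And>\<beta>. \<beta> \<in> roots D \<Longrightarrow> \<beta> - smul D (\<phi> \<beta>) \<alpha> \<in> roots D"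
  shows "\<phi> = coroot D \<alpha>"
proof
  fix x
  define \<psi> where "\<psi> = (\<lambda>x. \<phi> x - coroot D \<alpha> x)"
  have \<psi>: "\<psi> \<in> dual_space D"
    using \<phi> coroot_in_dual[OF \<alpha>] by (auto simp: dual_space_iff \<psi>_def algebra_simps)
  have \<psi>\<alpha>: "\<psi> \<alpha> = 0" by (simp add: \<psi>_def \<phi> coroot_self \<alpha>)
  have step: "\<beta> + smul D (\<psi> \<beta>) \<alpha> \<in> roots D" if "\<beta> \<in> roots D" for \<beta>
  proof -
    have "reflect \<alpha> (\<beta> - smul D (\<phi> \<beta>) \<alpha>) \<in> roots D"
      using pres[OF that] by (rule reflect_root[OF \<alpha>])
    also have "reflect \<alpha> (\<beta> - smul D (\<phi> \<beta>) \<alpha>) = \<beta> + smul D (\<psi> \<beta>) \<alpha>"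
      using \<alpha> by (simp add: \<psi>_def dual_simps[OF coroot_in_dual] coroot_self vs.scale_left_diff_distrib
          scale_double)
    finally show ?thesis .
  qed
  have "\<psi> \<beta> = 0" if \<beta>: "\<beta> \<in> roots D" for \<beta>
  proof (rule ccontr)
    assume nz: "\<psi> \<beta> \<noteq> 0"
    \<comment> \<open>Since \<open>\<psi> \<alpha> = 0\<close>, each application of
      \<open>step\<close> adds the same multiple of \<open>\<alpha>\<close>.\<close>
    have "\<beta> + smul D (of_nat n * \<psi> \<beta>) \<alpha> \<in> roots D" for n
    proof (induction n)
      case (Suc n)
      have "\<beta> + smul D (of_nat (Suc n) * \<psi> \<beta>) \<alpha>
          = (\<beta> + smul D (of_nat n * \<psi> \<beta>) \<alpha>) + smul D (\<psi> (\<beta> + smul D (of_nat n * \<psi> \<beta>) \<alpha>)) \<alpha>"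
        by (simp add: dual_simps[OF \<psi>] \<psi>\<alpha> algebra_simps vs.scale_left_distrib)
      then show ?case using step[OF Suc] by (simp only:)
    qed (use \<beta> in simp)
    then have "range (\<lambda>n. \<beta> + smul D (of_nat n * \<psi> \<beta>) \<alpha>) \<subseteq> roots D" by blast
    then have "finite (range (\<lambda>n. \<beta> + smul D (of_nat n * \<psi> \<beta>) \<alpha>))"
      using finite_roots finite_subset by blast
    moreover have "inj (\<lambda>n. \<beta> + smul D (of_nat n * \<psi> \<beta>) \<alpha>)"
      using nz root_nonzero[OF \<alpha>] by (auto intro!: injI)
    ultimately show False using finite_imageD infinite_UNIV_nat by blast
  qed
  then have "\<psi> x = 0" using dual_eq_0[OF \<psi>] by blast
  then show "\<phi> x = coroot D \<alpha> x" by (simp add: \<psi>_def)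
qed

text \<open>Conjugating the reflection along \<open>\<beta>\<close> by the one along
  \<open>\<alpha>\<close> preserves the roots and gives a reflection along
  \<open>reflect \<alpha> \<beta>\<close>, so \<open>coroot_unique\<close> identifies its
  functional.\<close>

lemma coroot_reflect:
  assumes \<alpha>: "\<alpha> \<in> roots D" and \<beta>: "\<beta> \<in> roots D"
  shows "coroot D (reflect \<alpha> \<beta>) \<mu> = coroot D \<beta> (reflect \<alpha> \<mu>)"
proof -
  note [simp] = dual_simps[OF coroot_in_dual[OF \<alpha>]] dual_simps[OF coroot_in_dual[OF \<beta>]]
  have "(\<lambda>\<mu>. coroot D \<beta> (reflect \<alpha> \<mu>)) = coroot D (reflect \<alpha> \<beta>)"
  proof (rule coroot_unique)
    show "reflect \<alpha> \<beta> \<in> roots D" by (rule reflect_root[OF \<alpha> \<beta>])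
    show "(\<lambda>\<mu>. coroot D \<beta> (reflect \<alpha> \<mu>)) \<in> dual_space D"
      by (simp add: dual_space_iff algebra_simps)
    show "coroot D \<beta> (reflect \<alpha> (reflect \<alpha> \<beta>)) = 2"
      by (simp only: reflect_reflect[OF \<alpha>] coroot_self[OF \<beta>])
    fix \<delta> assume \<delta>: "\<delta> \<in> roots D"
    have "reflect \<alpha> (reflect \<beta> (reflect \<alpha> \<delta>)) \<in> roots D"
      using \<alpha> \<beta> \<delta> reflect_root by blast
    also have "reflect \<alpha> (reflect \<beta> (reflect \<alpha> \<delta>))
        = \<delta> - smul D (coroot D \<beta> (reflect \<alpha> \<delta>)) (reflect \<alpha> \<beta>)"
    proof -
      define k where "k = coroot D \<beta> (reflect \<alpha> \<delta>)"
      have "reflect \<alpha> (reflect \<alpha> \<delta> - smul D k \<beta>)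
          = reflect \<alpha> (reflect \<alpha> \<delta>) - smul D k (reflect \<alpha> \<beta>)"
        by (simp add: vs.scale_left_diff_distrib vs.scale_right_diff_distrib algebra_simps)
      then show ?thesis unfolding k_def reflect_reflect[OF \<alpha>] .
    qed
    finally show "\<delta> - smul D (coroot D \<beta> (reflect \<alpha> \<delta>)) (reflect \<alpha> \<beta>) \<in> roots D" .
  qed
  then show ?thesis by metis
qed

lemma reflect_self: "\<alpha> \<in> roots D \<Longrightarrow> reflect \<alpha> \<alpha> = - \<alpha>"
proof -
  assume "\<alpha> \<in> roots D"
  then have "reflect \<alpha> \<alpha> = \<alpha> - smul D (1 + 1) \<alpha>" by (simp add: coroot_self)
  then show ?thesis by (simp only: vs.scale_left_distrib vs.scale_one) simp
qed

lemma uminus_root: "\<alpha> \<in> roots D \<Longrightarrow> - \<alpha> \<in> roots D"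
  using reflect_root[of \<alpha> \<alpha>] by (simp add: reflect_self)

lemma uminus_root_iff [simp]: "- \<alpha> \<in> roots D \<longleftrightarrow> \<alpha> \<in> roots D"
  using uminus_root[of \<alpha>] uminus_root[of "- \<alpha>"] by auto

lemma coroot_uminus: "\<alpha> \<in> roots D \<Longrightarrow> coroot D (- \<alpha>) \<mu> = - coroot D \<alpha> \<mu>"
  using coroot_reflect[of \<alpha> \<alpha> \<mu>] by (simp add: reflect_self coroot_reflect_self)

section \<open>An invariant form\<close>

text \<open>Summing over all coroots makes invariance a reindexing (\<open>inv_form_reflect\<close>)
  and positivity on roots immediate.\<close>

definition inv_form :: "'v \<Rightarrow> 'v \<Rightarrow> rat" where
  "inv_form x y = (\<Sum>\<alpha>\<in>roots D. coroot D \<alpha> x * coroot D \<alpha> y)"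

lemma inv_form_linear: "inv_form x \<in> dual_space D"
  by (simp add: dual_space_iff inv_form_def dual_simps[OF coroot_in_dual]
      algebra_simps sum.distrib sum_distrib_left)

lemma inv_form_pos: "\<alpha> \<in> roots D \<Longrightarrow> inv_form \<alpha> \<alpha> > 0"
  unfolding inv_form_def
  by (rule sum_pos2[OF finite_roots]) (auto simp: coroot_self)

lemma inv_form_reflect:
  assumes "\<alpha> \<in> roots D" shows "inv_form (reflect \<alpha> x) (reflect \<alpha> y) = inv_form x y"
proof -
  have "inv_form (reflect \<alpha> x) (reflect \<alpha> y)
      = (\<Sum>\<beta>\<in>roots D. coroot D (reflect \<alpha> \<beta>) x * coroot D (reflect \<alpha> \<beta>) y)"
    unfolding inv_form_def by (rule sum.cong[OF refl]) (simp only: coroot_reflect[OF assms])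
  also have "\<dots> = inv_form x y"
    unfolding inv_form_def
  proof (rule sum.reindex_bij_witness[of _ "reflect \<alpha>" "reflect \<alpha>"], goal_cases)
    case (1 a) show ?case using reflect_reflect assms by blast
  next
    case (2 a) then show ?case using reflect_root assms by blast
  next
    case (3 a) show ?case using reflect_reflect assms by blast
  next
    case (4 a) then show ?case using reflect_root assms by blast
  qed (simp only: reflect_reflect[OF assms])
  finally show ?thesis .
qed

text \<open>Apply the reflection along \<open>\<alpha>\<close> to both arguments:
  \<open>\<alpha>\<close> changes sign, and expanding the image of \<open>x\<close> gives the
  formula. Its use is that the form and the coroot have the same sign at \<open>x\<close>.\<close>

lemma inv_form_root:
  assumes "\<alpha> \<in> roots D" shows "2 * inv_form x \<alpha> = coroot D \<alpha> x * inv_form \<alpha> \<alpha>"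
proof -
  have sym: "inv_form a b = inv_form b a" for a b by (simp add: inv_form_def mult.commute)
  have "inv_form x \<alpha> = inv_form (reflect \<alpha> x) (- \<alpha>)"
    using inv_form_reflect[OF assms, of x \<alpha>] by (simp only: reflect_self[OF assms])
  also have "\<dots> = - inv_form \<alpha> (reflect \<alpha> x)"
    by (subst sym) (simp add: dual_simps[OF inv_form_linear] sym[of "- \<alpha>"] sym[of _ "- \<alpha>"] inv_form_def
        dual_simps[OF coroot_in_dual] sum_negf)
  also have "\<dots> = - inv_form x \<alpha> + coroot D \<alpha> x * inv_form \<alpha> \<alpha>"
    by (simp add: dual_simps[OF inv_form_linear] sym)
  finally show ?thesis by simp
qed

lemma coroot_pos_of_inv_form: "\<alpha> \<in> roots D \<Longrightarrow> inv_form x \<alpha> > 0 \<Longrightarrow> coroot D \<alpha> x > 0"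
  using inv_form_root[of \<alpha> x] inv_form_pos[of \<alpha>]
    zero_less_mult_pos2[of "coroot D \<alpha> x" "inv_form \<alpha> \<alpha>"] by linarith

section \<open>Base, positive cone and height\<close>

abbreviation "pcone \<equiv> positive_cone D"

lemma simple_root: "a \<in> simple_roots D \<Longrightarrow> a \<in> roots D"
  and independent_simple: "vs.independent (simple_roots D)"
  and pos_or_neg: "\<beta> \<in> roots D \<Longrightarrow> \<beta> \<in> pcone \<or> - \<beta> \<in> pcone"
  using base by (auto simp: is_base_def)

lemma finite_simple: "finite (simple_roots D)"
  by (rule finite_subset[OF subsetI finite_roots]) (rule simple_root)

lemma cone_add: "x \<in> pcone \<Longrightarrow> y \<in> pcone \<Longrightarrow> x + y \<in> pcone"
proof -
  assume "x \<in> pcone" "y \<in> pcone"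
  then obtain c d where "x = (\<Sum>\<alpha>\<in>simple_roots D. smul D (of_nat (c \<alpha>)) \<alpha>)"
    "y = (\<Sum>\<alpha>\<in>simple_roots D. smul D (of_nat (d \<alpha>)) \<alpha>)"
    unfolding positive_cone_def by blast
  then have "x + y = (\<Sum>\<alpha>\<in>simple_roots D. smul D (of_nat (c \<alpha> + d \<alpha>)) \<alpha>)"
    by (simp add: sum.distrib[symmetric] vs.scale_left_distrib)
  then show ?thesis
    unfolding positive_cone_def by (intro CollectI exI[of _ "\<lambda>\<alpha>. c \<alpha> + d \<alpha>"]) simp
qed

lemma cone_0: "0 \<in> pcone"
  unfolding positive_cone_def by (intro CollectI exI[of _ "\<lambda>_. 0"]) simp

lemma cone_nat: "x \<in> pcone \<Longrightarrow> smul D (of_nat n) x \<in> pcone"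
  by (induction n) (auto simp: cone_0 cone_add vs.scale_left_distrib)

lemma simple_in_cone: "a \<in> simple_roots D \<Longrightarrow> a \<in> pcone"
proof -
  assume a: "a \<in> simple_roots D"
  have "(\<Sum>\<alpha>\<in>simple_roots D. smul D (of_nat (if \<alpha> = a then 1 else 0)) \<alpha>)
      = (\<Sum>\<alpha>\<in>simple_roots D. if \<alpha> = a then a else 0)"
    by (rule sum.cong) auto
  also have "\<dots> = a" using a finite_simple by simp
  finally show ?thesis
    unfolding positive_cone_def by (intro CollectI exI[of _ "\<lambda>\<alpha>. if \<alpha> = a then 1 else 0"]) simp
qed

lemma cone_coord_ge_0:
  assumes "\<phi> \<in> dual_space D" "\<And>a. a \<in> simple_roots D \<Longrightarrow> \<phi> a \<ge> 0" "x \<in> pcone"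
  shows "\<phi> x \<ge> 0"
proof -
  obtain c where "x = (\<Sum>\<alpha>\<in>simple_roots D. smul D (of_nat (c \<alpha>)) \<alpha>)"
    using assms(3) unfolding positive_cone_def by blast
  then show ?thesis
    using assms by (auto simp: dual_simps[OF assms(1)] intro!: sum_nonneg)
qed

text \<open>The height. The choice is among functionals equal to \<open>1\<close> on all simple
  roots, which exist because the simple roots are independent.\<close>

definition ht :: "'v \<Rightarrow> rat" where
  "ht = (SOME \<phi>. \<phi> \<in> dual_space D \<and> (\<forall>a\<in>simple_roots D. \<phi> a = 1))"

lemma ht: "ht \<in> dual_space D" "a \<in> simple_roots D \<Longrightarrow> ht a = 1"
proof -
  have "\<exists>\<phi>. \<phi> \<in> dual_space D \<and> (\<forall>a\<in>simple_roots D. \<phi> a = 1)"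
    using dual_extend[OF independent_simple, of "\<lambda>_. 1"] by blast
  from someI_ex[OF this] show "ht \<in> dual_space D" "a \<in> simple_roots D \<Longrightarrow> ht a = 1"
    unfolding ht_def by auto
qed

lemma ht_cone:
  assumes "x \<in> pcone" shows "ht x \<in> \<int> \<and> ht x \<ge> 0 \<and> (ht x = 0 \<longrightarrow> x = 0)"
proof -
  obtain c where c: "x = (\<Sum>\<alpha>\<in>simple_roots D. smul D (of_nat (c \<alpha>)) \<alpha>)"
    using assms unfolding positive_cone_def by blast
  then have *: "ht x = of_nat (\<Sum>\<alpha>\<in>simple_roots D. c \<alpha>)"
    by (simp add: dual_simps[OF ht(1)] ht(2))
  have "x = 0" if "ht x = 0"
  proof -
    have "(\<Sum>\<alpha>\<in>simple_roots D. c \<alpha>) = 0" using that unfolding * by linarith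
    then show ?thesis using finite_simple by (simp add: c)
  qed
  then show ?thesis unfolding * by (simp del: of_nat_sum)
qed

text \<open>Both \<open>x\<close> and \<open>- x\<close> have nonnegative height, so the height is
  zero, and only \<open>0\<close> has height zero in the cone.\<close>

lemma cone_antisym: "x \<in> pcone \<Longrightarrow> - x \<in> pcone \<Longrightarrow> x = 0"
  using ht_cone[of x] ht_cone[of "- x"] by (simp add: dual_simps[OF ht(1)])

section \<open>The highest root\<close>

abbreviation "\<theta> \<equiv> highest D"

lemma highest_root: "\<theta> \<in> roots D" and highest_diff: "\<beta> \<in> roots D \<Longrightarrow> \<theta> - \<beta> \<in> pcone"
  using highest by (auto simp: is_highest_root_def)

text \<open>Comparing \<open>\<theta>\<close> with the root \<open>- \<theta>\<close> puts
  \<open>\<theta> + \<theta>\<close> in the cone; if \<open>- \<theta>\<close> were there too, so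
  would be their sum \<open>\<theta>\<close>.\<close>

lemma highest_in_cone: "\<theta> \<in> pcone"
proof (rule ccontr)
  assume "\<theta> \<notin> pcone"
  then have "- \<theta> \<in> pcone" using pos_or_neg[OF highest_root] by blast
  moreover have "\<theta> + \<theta> \<in> pcone" using highest_diff[of "- \<theta>"] highest_root by simp
  ultimately have "- \<theta> + (\<theta> + \<theta>) \<in> pcone" by (rule cone_add)
  then show False using \<open>\<theta> \<notin> pcone\<close> by simp
qed

text \<open>The reflection changes only the \<open>a\<close>-coordinate. If the image were negative,
  all other coordinates of \<open>\<beta>\<close> would vanish, and reducedness together with
  positivity would leave \<open>\<beta> = a\<close>.\<close>

lemma reflect_simple_pos:
  assumes a: "a \<in> simple_roots D" and \<beta>: "\<beta> \<in> roots D" "\<beta> \<in> pcone" "\<beta> \<noteq> a"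
  shows "reflect a \<beta> \<in> pcone"
proof (rule ccontr)
  assume "reflect a \<beta> \<notin> pcone"
  then have neg: "- reflect a \<beta> \<in> pcone"
    using pos_or_neg[OF reflect_root[OF simple_root[OF a] \<beta>(1)]] by blast
  obtain c where c: "\<beta> = (\<Sum>\<alpha>\<in>simple_roots D. smul D (of_nat (c \<alpha>)) \<alpha>)"
    using \<beta>(2) unfolding positive_cone_def by blast
  have "c b = 0" if b: "b \<in> simple_roots D" "b \<noteq> a" for b
  proof -
    obtain \<phi> where \<phi>: "\<phi> \<in> dual_space D" "\<And>\<alpha>. \<alpha> \<in> simple_roots D \<Longrightarrow> \<phi> \<alpha> = (if \<alpha> = b then 1 else 0)"
      using dual_extend[OF independent_simple, of "\<lambda>\<alpha>. if \<alpha> = b then 1 else 0"] by auto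
    have "\<phi> \<beta> = (\<Sum>\<alpha>\<in>simple_roots D. if \<alpha> = b then of_nat (c b) else 0)"
      unfolding c dual_sum[OF \<phi>(1)] by (rule sum.cong) (auto simp: dual_simps[OF \<phi>(1)] \<phi>(2))
    then have "\<phi> \<beta> = of_nat (c b)" using b finite_simple by simp
    moreover have "\<phi> (- reflect a \<beta>) \<ge> 0"
      by (rule cone_coord_ge_0[OF \<phi>(1) _ neg]) (simp add: \<phi>(2))
    ultimately show ?thesis using b a by (simp add: dual_simps[OF \<phi>(1)] \<phi>(2))
  qed
  then have "\<beta> = (\<Sum>\<alpha>\<in>simple_roots D. if \<alpha> = a then smul D (of_nat (c a)) a else 0)"
    unfolding c by (intro sum.cong) auto
  then have \<beta>_eq: "\<beta> = smul D (of_nat (c a)) a" using a finite_simple by simp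
  then have "of_nat (c a) = (1::rat) \<or> of_nat (c a) = (-1::rat)"
    using is_reduced simple_root[OF a] \<beta>(1) unfolding reduced_def by metis
  then have "\<beta> = a"
  proof
    assume "of_nat (c a) = (-1::rat)"
    then show ?thesis by (metis of_nat_0_le_iff not_one_le_zero neg_le_0_iff_le neg_0_le_iff_le)
  qed (use \<beta>_eq in simp)
  then show False using \<beta>(3) by blast
qed

text \<open>If the pairing were \<open>-(n + 1)\<close>, the maximality of \<open>\<theta>\<close>
  against \<open>reflect \<theta> \<beta>\<close> would put \<open>-(\<beta> + n \<theta>)\<close>
  in the cone; adding \<open>n \<theta>\<close> would make \<open>\<beta>\<close> negative.\<close>

lemma coroot_highest_ge_0:
  assumes "\<beta> \<in> roots D" "\<beta> \<in> pcone" shows "coroot D \<theta> \<beta> \<ge> 0"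
proof (rule ccontr)
  assume neg: "\<not> ?thesis"
  obtain z where z: "coroot D \<theta> \<beta> = of_int z" using coroot_int[OF highest_root assms(1)] Ints_cases by blast
  define n where "n = nat (- z - 1)"
  have n: "- coroot D \<theta> \<beta> = of_nat n + 1" using neg z by (simp add: n_def of_nat_nat)
  have "reflect \<theta> \<beta> = \<beta> + smul D (of_nat n + 1) \<theta>" by (simp add: n[symmetric])
  then have eq: "\<theta> - reflect \<theta> \<beta> = - (\<beta> + smul D (of_nat n) \<theta>)"
    by (simp add: vs.scale_left_distrib)
  have "\<theta> - reflect \<theta> \<beta> \<in> pcone"
    by (intro highest_diff reflect_root highest_root assms)
  then have "- (\<beta> + smul D (of_nat n) \<theta>) \<in> pcone" by (simp only: eq)
  then have "- (\<beta> + smul D (of_nat n) \<theta>) + smul D (of_nat n) \<theta> \<in> pcone"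
    using cone_nat[OF highest_in_cone] cone_add by blast
  then have "- \<beta> \<in> pcone" by simp
  then show False using cone_antisym assms root_nonzero by blast
qed

text \<open>If the pairing were \<open>n + 2\<close>, the maximality of \<open>\<theta>\<close>
  against the root \<open>- reflect \<theta> \<beta>\<close> would put
  \<open>\<beta> - \<theta> - n \<theta>\<close> in the cone, hence also
  \<open>\<beta> - \<theta>\<close>, and antisymmetry would give
  \<open>\<beta> = \<theta>\<close>.\<close>

lemma coroot_highest_le_1:
  assumes "\<beta> \<in> roots D" "\<beta> \<noteq> \<theta>" shows "coroot D \<theta> \<beta> \<le> 1"
proof (rule ccontr)
  assume gt: "\<not> ?thesis"
  obtain z where z: "coroot D \<theta> \<beta> = of_int z" using coroot_int[OF highest_root assms(1)] Ints_cases by blast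
  define n where "n = nat (z - 2)"
  have n: "coroot D \<theta> \<beta> = of_nat n + 2" using gt z by (simp add: n_def of_nat_nat)
  have "\<theta> - (- reflect \<theta> \<beta>) \<in> pcone"
    by (intro highest_diff uminus_root reflect_root highest_root assms)
  also have "\<theta> - (- reflect \<theta> \<beta>) = \<beta> - \<theta> - smul D (of_nat n) \<theta>"
    by (simp add: n vs.scale_left_distrib scale_two)
  finally have "\<beta> - \<theta> - smul D (of_nat n) \<theta> + smul D (of_nat n) \<theta> \<in> pcone"
    using cone_nat[OF highest_in_cone] cone_add by blast
  then have "- (\<theta> - \<beta>) \<in> pcone" by simp
  then have "\<theta> - \<beta> = 0" using cone_antisym highest_diff[OF assms(1)] by blast
  then show False using assms(2) by simp
qed

section \<open>Affine roots and their positivity\<close>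

abbreviation "AR \<equiv> affine_roots D"
abbreviation "AP \<equiv> affine_positive_roots D"
abbreviation "AS \<equiv> affine_simple_roots D"
abbreviation "LR \<equiv> linear_reflection D"
abbreviation psmul :: "rat \<Rightarrow> 'v \<times> rat \<Rightarrow> 'v \<times> rat" where
  "psmul k \<mu> \<equiv> (smul D k (fst \<mu>), k * snd \<mu>)"

lemma LR_eq: "LR \<gamma> \<mu> = \<mu> - psmul (coroot D (fst \<gamma>) (fst \<mu>)) \<gamma>"
  by (simp add: linear_reflection_def Let_def minus_prod_def)

lemma AR_iff: "\<gamma> \<in> AR \<longleftrightarrow> fst \<gamma> \<in> roots D \<and> snd \<gamma> \<in> \<int>"
  by (cases \<gamma>) (auto simp: affine_roots_def)

lemma AP_iff: "\<gamma> \<in> AP \<longleftrightarrow> \<gamma> \<in> AR \<and> (snd \<gamma> > 0 \<or> snd \<gamma> = 0 \<and> fst \<gamma> \<in> pcone)"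
  by (cases \<gamma>) (auto simp: affine_positive_roots_def positive_roots_def AR_iff)

lemma AS_subset_AP: "\<gamma> \<in> AS \<Longrightarrow> \<gamma> \<in> AP"
  by (auto simp: affine_simple_roots_def AP_iff AR_iff simple_root simple_in_cone highest_root)

lemma uminus_AR: "\<gamma> \<in> AR \<Longrightarrow> - \<gamma> \<in> AR"
  by (simp add: AR_iff)

lemma AR_pos_or_neg: "\<gamma> \<in> AR \<Longrightarrow> \<gamma> \<in> AP \<or> - \<gamma> \<in> AP"
  using pos_or_neg[of "fst \<gamma>"] by (auto simp: AP_iff AR_iff)

lemma AP_not_neg: "\<gamma> \<in> AP \<Longrightarrow> - \<gamma> \<notin> AP"
  using cone_antisym[of "fst \<gamma>"] root_nonzero by (auto simp: AP_iff AR_iff)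

lemma LR_root: assumes "\<delta> \<in> AR" "\<gamma> \<in> AR" shows "LR \<delta> \<gamma> \<in> AR"
  using assms reflect_root coroot_int by (simp add: AR_iff LR_eq)

lemma LR_self: "\<gamma> \<in> AR \<Longrightarrow> LR \<gamma> \<gamma> = - \<gamma>"
  using reflect_self[of "fst \<gamma>"] by (auto simp: AR_iff LR_eq prod_eq_iff coroot_self)

lemma LR_LR: "\<gamma> \<in> AR \<Longrightarrow> LR \<gamma> (LR \<gamma> \<mu>) = \<mu>"
  using reflect_reflect[of "fst \<gamma>" "fst \<mu>"]
  by (auto simp: AR_iff LR_eq prod_eq_iff coroot_reflect_self)

text \<open>For \<open>\<delta> = (a, 0)\<close> the level is unchanged and level zero is the
  classical statement. For \<open>\<delta> = (- \<theta>, 1)\<close> the level \<open>n\<close>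
  becomes \<open>n + coroot D \<theta> \<beta>\<close>, which the bounds on pairings with
  \<open>\<theta>\<close> keep nonnegative; where it is zero, the finite part must be
  checked.\<close>

lemma LR_simple_pos:
  assumes \<delta>: "\<delta> \<in> AS" and \<gamma>: "\<gamma> \<in> AP" "\<gamma> \<noteq> \<delta>"
  shows "LR \<delta> \<gamma> \<in> AP"
proof -
  obtain \<beta> n where \<gamma>_eq: "\<gamma> = (\<beta>, n)" by (cases \<gamma>)
  have \<beta>: "\<beta> \<in> roots D" "n \<in> \<int>" and pos: "n > 0 \<or> n = 0 \<and> \<beta> \<in> pcone"
    using \<gamma>(1) by (auto simp: \<gamma>_eq AP_iff AR_iff)
  have root: "LR \<delta> \<gamma> \<in> AR"
    using AS_subset_AP[OF \<delta>] \<gamma>(1) by (intro LR_root) (auto simp: AP_iff)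
  consider a where "a \<in> simple_roots D" "\<delta> = (a, 0)" | "\<delta> = (- \<theta>, 1)"
    using \<delta> by (auto simp: affine_simple_roots_def)
  then show ?thesis
  proof cases
    case 1
    then have "LR \<delta> \<gamma> = (reflect a \<beta>, n)" by (simp add: LR_eq \<gamma>_eq)
    then show ?thesis
      using root pos reflect_simple_pos[OF 1(1) \<beta>(1)] \<gamma>(2) by (auto simp: AP_iff \<gamma>_eq 1)
  next
    case 2
    have LR: "LR \<delta> \<gamma> = (reflect \<theta> \<beta>, n + coroot D \<theta> \<beta>)"
      by (simp add: LR_eq \<gamma>_eq 2 coroot_uminus highest_root)
    have int: "1 \<le> x" if "x \<in> \<int>" "x > 0" for x :: rat
      using that by (auto elim!: Ints_cases)
    \<comment> \<open>A negative \<open>\<beta>\<close> has level at least one and pairs with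
      \<open>\<theta>\<close> to at least \<open>-1\<close>, except for \<open>- \<theta>\<close>
      with pairing \<open>-2\<close>. There \<open>\<gamma> \<noteq> \<delta>\<close> excludes level
      one.\<close>
    consider "\<beta> \<in> pcone" "\<beta> \<noteq> \<theta>" | "\<beta> = \<theta>" | "\<beta> = - \<theta>" | "- \<beta> \<in> pcone" "\<beta> \<noteq> - \<theta>"
      using pos_or_neg[OF \<beta>(1)] by blast
    then show ?thesis
    proof cases
      case 1
      have k: "coroot D \<theta> \<beta> \<ge> 0" using coroot_highest_ge_0 \<beta> 1 by blast
      show ?thesis
      proof (cases "n + coroot D \<theta> \<beta> = 0")
        case True
        then have "coroot D \<theta> \<beta> = 0" using k pos by linarith
        then show ?thesis using LR root 1 True by (simp add: AP_iff)
      next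
        case False
        then have "n + coroot D \<theta> \<beta> > 0" using k pos by linarith
        then show ?thesis using LR root by (simp add: AP_iff)
      qed
    next
      case 2
      then show ?thesis using LR root pos by (auto simp: AP_iff coroot_self highest_root)
    next
      case 3
      have "n \<noteq> 0" using pos 3 cone_antisym[OF highest_in_cone] root_nonzero[OF highest_root] by auto
      then have "n \<ge> 1" using int \<beta> pos by auto
      moreover have "n \<noteq> 1" using \<gamma>(2) 2 3 \<gamma>_eq by simp
      ultimately have "n - 1 \<ge> 1" using int[of "n - 1"] \<beta> by simp
      moreover have "coroot D \<theta> \<beta> = -2" and "reflect \<theta> \<beta> = \<theta>"
        using 3 reflect_self[OF highest_root]
        by (auto simp: dual_simps[OF coroot_in_dual] highest_root coroot_self scale_two)
      ultimately show ?thesis using LR root highest_in_cone by (auto simp: AP_iff)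
    next
      case 4
      have "n \<noteq> 0" using pos 4 cone_antisym[of \<beta>] root_nonzero[OF \<beta>(1)] by auto
      then have n: "n \<ge> 1" using int \<beta> pos by auto
      have m: "coroot D \<theta> (- \<beta>) = - coroot D \<theta> \<beta>"
        by (simp add: dual_simps[OF coroot_in_dual] highest_root)
      have "coroot D \<theta> (- \<beta>) \<le> 1" using coroot_highest_le_1[of "- \<beta>"] \<beta> 4
        by (metis minus_minus uminus_root_iff)
      then have k: "coroot D \<theta> \<beta> \<ge> -1" using m by simp
      show ?thesis
      proof (cases "n + coroot D \<theta> \<beta> > 0")
        case True
        then show ?thesis using LR root by (simp add: AP_iff)
      next
        case False
        then have eq: "n + coroot D \<theta> \<beta> = 0" "coroot D \<theta> \<beta> = -1" using n k by linarith+
        have "\<theta> - (- \<beta>) \<in> pcone" using \<beta> by (intro highest_diff) simp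
        then show ?thesis using LR root eq by (simp add: AP_iff add.commute)
      qed
    qed
  qed
qed

text \<open>The height with respect to the affine simple roots; the factor
  \<open>1 + ht \<theta>\<close> is forced by giving \<open>(- \<theta>, 1)\<close> height
  one.\<close>

definition aht :: "'v \<times> rat \<Rightarrow> rat" where
  "aht \<mu> = ht (fst \<mu>) + snd \<mu> * (1 + ht \<theta>)"

lemma aht_simple: "\<delta> \<in> AS \<Longrightarrow> aht \<delta> = 1"
  by (auto simp: affine_simple_roots_def aht_def ht dual_simps[OF ht(1)])

lemma aht_LR: "aht (LR \<delta> \<gamma>) = aht \<gamma> - coroot D (fst \<delta>) (fst \<gamma>) * aht \<delta>"
  by (simp add: aht_def LR_eq dual_simps[OF ht(1)] algebra_simps)

text \<open>A root has height at least \<open>- ht \<theta>\<close>, which a level of at least one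
  outweighs. Nonnegativity makes \<open>aht\<close> usable as an induction measure.\<close>

lemma aht_pos:
  assumes "\<gamma> \<in> AP" shows "aht \<gamma> \<ge> 0"
proof -
  have \<theta>: "ht \<theta> \<ge> 0" using ht_cone highest_in_cone by blast
  have "ht (\<theta> - (- fst \<gamma>)) \<ge> 0"
    using assms ht_cone highest_diff[of "- fst \<gamma>"] by (simp add: AP_iff AR_iff)
  then have *: "ht (fst \<gamma>) \<ge> - ht \<theta>" by (simp add: dual_simps[OF ht(1)])
  consider "snd \<gamma> \<ge> 1" | "snd \<gamma> = 0" "fst \<gamma> \<in> pcone"
    using assms by (auto simp: AP_iff AR_iff elim!: Ints_cases)
  then show ?thesis
  proof cases
    case 1
    then have "1 * (1 + ht \<theta>) \<le> snd \<gamma> * (1 + ht \<theta>)" using \<theta> by (intro mult_right_mono) auto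
    then show ?thesis using * by (simp add: aht_def)
  next
    case 2
    then show ?thesis using ht_cone by (simp add: aht_def)
  qed
qed

text \<open>
  A positive affine root is a nonnegative combination of simple ones and has positive norm, so it
  pairs positively with one of them.
\<close>

lemma simple_descent:
  assumes \<gamma>: "\<gamma> \<in> AP" "\<gamma> \<notin> AS"
  shows "\<exists>\<delta>\<in>AS. LR \<delta> \<gamma> \<in> AP \<and> aht (LR \<delta> \<gamma>) + 1 \<le> aht \<gamma>"
proof -
  obtain \<beta> n where \<gamma>_eq: "\<gamma> = (\<beta>, n)" by (cases \<gamma>)
  have \<beta>: "\<beta> \<in> roots D" "n \<in> \<int>" and pos: "n > 0 \<or> n = 0 \<and> \<beta> \<in> pcone"
    using \<gamma>(1) by (auto simp: \<gamma>_eq AP_iff AR_iff)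
  have n0: "n \<ge> 0" using pos by auto
  \<comment> \<open>As \<open>\<gamma>\<close> equals \<open>(\<beta> + n \<theta>, 0)\<close> plus
    \<open>n\<close> times \<open>(- \<theta>, 1)\<close>, this membership yields its nonnegative
    coefficients in the affine simple roots.\<close>
  have "\<beta> + smul D n \<theta> \<in> pcone"
  proof (cases "n = 0")
    case False
    obtain z where z: "n = of_int z" using \<beta>(2) Ints_cases by blast
    define m where "m = nat (z - 1)"
    have m: "n = of_nat m + 1" using z False n0 by (simp add: m_def of_nat_nat)
    have "\<theta> - (- \<beta>) + smul D (of_nat m) \<theta> \<in> pcone"
      using \<beta> by (intro cone_add cone_nat highest_diff highest_in_cone) simp
    then show ?thesis by (simp add: m vs.scale_left_distrib algebra_simps)
  qed (use pos in simp)
  then obtain c where c: "\<beta> + smul D n \<theta> = (\<Sum>\<alpha>\<in>simple_roots D. smul D (of_nat (c \<alpha>)) \<alpha>)"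
    unfolding positive_cone_def by blast
  note lin = dual_simps[OF inv_form_linear]
  have "inv_form \<beta> \<beta> = inv_form \<beta> (\<beta> + smul D n \<theta>) + n * inv_form \<beta> (- \<theta>)"
    by (simp add: lin)
  also have "inv_form \<beta> (\<beta> + smul D n \<theta>) = (\<Sum>\<alpha>\<in>simple_roots D. of_nat (c \<alpha>) * inv_form \<beta> \<alpha>)"
    unfolding c by (simp add: lin)
  finally have sum_pos: "(\<Sum>\<alpha>\<in>simple_roots D. of_nat (c \<alpha>) * inv_form \<beta> \<alpha>) + n * inv_form \<beta> (- \<theta>) > 0"
    using inv_form_pos[OF \<beta>(1)] by simp
  have "\<exists>\<delta>\<in>AS. inv_form \<beta> (fst \<delta>) > 0"
  proof (rule ccontr)
    assume "\<not> ?thesis"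
    then have le: "inv_form \<beta> (fst \<delta>) \<le> 0" if "\<delta> \<in> AS" for \<delta> using that by force
    have "inv_form \<beta> \<alpha> \<le> 0" if "\<alpha> \<in> simple_roots D" for \<alpha>
      using le[of "(\<alpha>, 0)"] that by (auto simp: affine_simple_roots_def)
    then have "(\<Sum>\<alpha>\<in>simple_roots D. of_nat (c \<alpha>) * inv_form \<beta> \<alpha>) \<le> 0"
      by (intro sum_nonpos) (simp add: mult_nonneg_nonpos)
    moreover have "n * inv_form \<beta> (- \<theta>) \<le> 0"
      using le[of "(- \<theta>, 1)"] n0 by (simp add: affine_simple_roots_def mult_nonneg_nonpos)
    ultimately show False using sum_pos by linarith
  qed
  then obtain \<delta> where \<delta>: "\<delta> \<in> AS" "inv_form \<beta> (fst \<delta>) > 0" by blast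
  have root: "fst \<delta> \<in> roots D" using AS_subset_AP[OF \<delta>(1)] by (simp add: AP_iff AR_iff)
  have "coroot D (fst \<delta>) \<beta> > 0" by (rule coroot_pos_of_inv_form[OF root \<delta>(2)])
  then have "coroot D (fst \<delta>) \<beta> \<ge> 1" using coroot_int[OF root \<beta>(1)] by (auto elim!: Ints_cases)
  then have "aht (LR \<delta> \<gamma>) + 1 \<le> aht \<gamma>" by (simp add: aht_LR aht_simple \<delta> \<gamma>_eq)
  moreover have "LR \<delta> \<gamma> \<in> AP" using \<gamma> \<delta> by (intro LR_simple_pos) auto
  ultimately show ?thesis using \<delta>(1) by blast
qed

end

section \<open>The affine Weyl group\<close>

context root_datum
begin

abbreviation "W \<equiv> affine_weyl D"
abbreviation "T \<equiv> refl_of_root D"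

section \<open>Affine functions and reflections of the dual space\<close>

definition aff :: "'v \<times> rat \<Rightarrow> ('v \<Rightarrow> rat) \<Rightarrow> rat" where
  "aff \<mu> v = v (fst \<mu>) + snd \<mu>"

lemma aff_separates:
  assumes "\<And>v. v \<in> dual_space D \<Longrightarrow> aff \<mu> v = aff \<nu> v" shows "\<mu> = \<nu>"
proof -
  have "(\<lambda>_. 0) \<in> dual_space D" by (simp add: dual_space_iff)
  from assms[OF this] have "snd \<mu> = snd \<nu>" by (simp add: aff_def)
  moreover from this have "fst \<mu> = fst \<nu>" using assms by (intro dual_separates) (simp add: aff_def)
  ultimately show ?thesis by (simp add: prod_eq_iff)
qed

lemma T_apply:
  "v \<in> dual_space D \<Longrightarrow> T \<gamma> v = (\<lambda>\<mu>. v \<mu> - aff \<gamma> v * coroot D (fst \<gamma>) \<mu>)"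
  by (simp add: refl_of_root_def affine_reflection_def aff_def)

lemma T_dual: "\<gamma> \<in> AR \<Longrightarrow> v \<in> dual_space D \<Longrightarrow> T \<gamma> v \<in> dual_space D"
  using coroot_in_dual[of "fst \<gamma>"]
  by (simp add: T_apply AR_iff) (simp add: dual_space_iff algebra_simps)

text \<open>Precomposition with a reflection of the dual space is the linear reflection of affine
  functions; the linear action of the whole group rests on this.\<close>

lemma aff_T:
  assumes "\<gamma> \<in> AR" "v \<in> dual_space D" shows "aff \<mu> (T \<gamma> v) = aff (LR \<gamma> \<mu>) v"
  using assms by (simp add: T_apply aff_def LR_eq dual_simps[OF assms(2)] algebra_simps)

lemma T_T:
  assumes "\<gamma> \<in> AR" "v \<in> dual_space D" shows "T \<gamma> (T \<gamma> v) = v"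
proof
  fix \<mu>
  have "aff (\<mu>, 0) (T \<gamma> (T \<gamma> v)) = aff (\<mu>, 0) v"
    using assms by (simp only: aff_T T_dual LR_LR)
  then show "T \<gamma> (T \<gamma> v) \<mu> = v \<mu>" by (simp add: aff_def)
qed

lemma T_Bij:
  assumes "\<gamma> \<in> AR" shows "T \<gamma> \<in> Bij (dual_space D)"
proof -
  have "bij_betw (T \<gamma>) (dual_space D) (dual_space D)"
    by (rule bij_betw_byWitness[of _ "T \<gamma>"]) (use assms in \<open>auto simp: T_T T_dual\<close>)
  then show ?thesis
    by (simp add: Bij_def refl_of_root_def affine_reflection_def)
qed

section \<open>The group generated by the affine reflections\<close>

lemma group_W: "group W"
  unfolding affine_weyl_def by (rule group.group_subgroup_generated[OF group_BijGroup])

sublocale W: group W by (rule group_W)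

lemma generators_eq:
  "{affine_reflection D \<alpha> n | \<alpha> n. \<alpha> \<in> roots D \<and> n \<in> \<int>} = T ` AR"
proof (intro equalityI subsetI)
  fix t assume "t \<in> {affine_reflection D \<alpha> n | \<alpha> n. \<alpha> \<in> roots D \<and> n \<in> \<int>}"
  then obtain \<alpha> n where "t = affine_reflection D \<alpha> n" "\<alpha> \<in> roots D" "n \<in> \<int>" by blast
  then have "t = T (\<alpha>, - n)" "(\<alpha>, - n) \<in> AR" by (simp_all add: refl_of_root_def AR_iff)
  then show "t \<in> T ` AR" by blast
next
  fix t assume "t \<in> T ` AR"
  then obtain \<gamma> where "t = affine_reflection D (fst \<gamma>) (- snd \<gamma>)" "fst \<gamma> \<in> roots D" "snd \<gamma> \<in> \<int>"
    by (auto simp: refl_of_root_def AR_iff)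
  then show "t \<in> {affine_reflection D \<alpha> n | \<alpha> n. \<alpha> \<in> roots D \<and> n \<in> \<int>}"
    by (intro CollectI exI[of _ "fst \<gamma>"] exI[of _ "- snd \<gamma>"]) simp
qed

lemma carrier_W: "carrier W = generate (BijGroup (dual_space D)) (T ` AR)"
proof -
  have "T ` AR \<subseteq> carrier (BijGroup (dual_space D))" using T_Bij by (auto simp: BijGroup_def)
  then show ?thesis
    unfolding affine_weyl_def carrier_subgroup_generated generators_eq by (simp add: inf_absorb2)
qed

lemma T_in_W: "\<gamma> \<in> AR \<Longrightarrow> T \<gamma> \<in> carrier W"
  unfolding carrier_W by (rule generate.incl) simp

lemma W_Bij: "x \<in> carrier W \<Longrightarrow> x \<in> Bij (dual_space D)"
  unfolding affine_weyl_def
  using group.carrier_subgroup_generated_subset[OF group_BijGroup] by (auto simp: BijGroup_def)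

lemma W_dual: "x \<in> carrier W \<Longrightarrow> v \<in> dual_space D \<Longrightarrow> x v \<in> dual_space D"
  using W_Bij Bij_imp_funcset by blast

lemma W_surj: "x \<in> carrier W \<Longrightarrow> v \<in> dual_space D \<Longrightarrow> \<exists>u\<in>dual_space D. v = x u"
  using W_Bij[of x] by (auto simp: Bij_def bij_betw_def)

lemma mult_W_apply:
  "x \<in> carrier W \<Longrightarrow> y \<in> carrier W \<Longrightarrow> v \<in> dual_space D \<Longrightarrow> (x \<otimes>\<^bsub>W\<^esub> y) v = x (y v)"
  using W_Bij[of x] W_Bij[of y] by (simp add: affine_weyl_def BijGroup_def compose_def)

lemma one_W_apply: "v \<in> dual_space D \<Longrightarrow> \<one>\<^bsub>W\<^esub> v = v"
  by (simp add: affine_weyl_def BijGroup_def)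

lemma W_extI:
  assumes "x \<in> carrier W" "y \<in> carrier W" "\<And>v. v \<in> dual_space D \<Longrightarrow> x v = y v" shows "x = y"
  using assms Bij_imp_extensional W_Bij by (intro extensionalityI[of x "dual_space D"]) auto

lemma T_mult_T: "\<gamma> \<in> AR \<Longrightarrow> T \<gamma> \<otimes>\<^bsub>W\<^esub> T \<gamma> = \<one>\<^bsub>W\<^esub>"
  by (rule W_extI) (auto simp: T_in_W mult_W_apply T_T one_W_apply)

lemma inv_T: "\<gamma> \<in> AR \<Longrightarrow> inv\<^bsub>W\<^esub> T \<gamma> = T \<gamma>"
  by (intro W.inv_equality T_mult_T T_in_W)

lemma T_mult_cancel: "\<gamma> \<in> AR \<Longrightarrow> x \<in> carrier W \<Longrightarrow> T \<gamma> \<otimes>\<^bsub>W\<^esub> (T \<gamma> \<otimes>\<^bsub>W\<^esub> x) = x"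
  by (simp add: W.m_assoc[symmetric] T_in_W T_mult_T)

text \<open>The inverse of a reflection is the same reflection, so left multiplication by
  reflections reaches every element from the unit.\<close>

lemma W_induct [consumes 1, case_names one refl]:
  assumes "x \<in> carrier W" and one: "P \<one>\<^bsub>W\<^esub>"
    and refl: "\<And>\<gamma> w. \<gamma> \<in> AR \<Longrightarrow> w \<in> carrier W \<Longrightarrow> P w \<Longrightarrow> P (T \<gamma> \<otimes>\<^bsub>W\<^esub> w)"
  shows "P x"
proof -
  have mult: "a \<otimes>\<^bsub>BijGroup (dual_space D)\<^esub> b = a \<otimes>\<^bsub>W\<^esub> b" for a b
    by (simp add: affine_weyl_def)
  \<comment> \<open>Preservation of \<open>P\<close> under left multiplication by \<open>x\<close>
    is the right invariant: it composes, whereas \<open>P\<close> for two elements says nothing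
    about their product.\<close>
  have "x \<in> carrier W \<and> (\<forall>w\<in>carrier W. P w \<longrightarrow> P (x \<otimes>\<^bsub>W\<^esub> w))"
    using assms(1) unfolding carrier_W
  proof (induction rule: generate.induct)
    case one
    have "\<one>\<^bsub>BijGroup (dual_space D)\<^esub> = \<one>\<^bsub>W\<^esub>" by (simp add: affine_weyl_def)
    then show ?case unfolding carrier_W[symmetric] by simp
  next
    case (incl h)
    then show ?case unfolding carrier_W[symmetric] using refl T_in_W by auto
  next
    case (inv h)
    then obtain \<gamma> where \<gamma>: "\<gamma> \<in> AR" "h = T \<gamma>" by blast
    have "inv\<^bsub>BijGroup (dual_space D)\<^esub> h = inv\<^bsub>W\<^esub> h"
      unfolding affine_weyl_def
      by (rule group.inv_subgroup_generated[OF group_BijGroup, symmetric])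
         (use \<gamma> T_in_W in \<open>simp add: affine_weyl_def\<close>)
    then have "inv\<^bsub>BijGroup (dual_space D)\<^esub> h = T \<gamma>" using \<gamma> inv_T by simp
    then show ?case unfolding carrier_W[symmetric] using refl T_in_W \<gamma> by auto
  next
    case (eng h1 h2)
    then show ?case unfolding carrier_W[symmetric] mult by (simp add: W.m_assoc)
  qed
  then have "P (x \<otimes>\<^bsub>W\<^esub> \<one>\<^bsub>W\<^esub>)" using one by blast
  then show ?thesis using assms(1) by simp
qed

section \<open>The linear action\<close>

text \<open>Precomposition of affine functions with the inverse of \<open>x\<close>, characterised
  without the inverse. Uniqueness holds because \<open>x\<close> is onto and affine functions are
  determined by their values.\<close>

definition lact :: "'v transf \<Rightarrow> 'v \<times> rat \<Rightarrow> 'v \<times> rat" where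
  "lact x \<mu> = (THE \<nu>. \<forall>v\<in>dual_space D. aff \<nu> (x v) = aff \<mu> v)"

lemma lact_eqI:
  assumes x: "x \<in> carrier W" and \<nu>: "\<And>v. v \<in> dual_space D \<Longrightarrow> aff \<nu> (x v) = aff \<mu> v"
  shows "lact x \<mu> = \<nu>"
  unfolding lact_def
proof (rule the_equality)
  show "\<forall>v\<in>dual_space D. aff \<nu> (x v) = aff \<mu> v" using \<nu> by blast
  fix \<nu>' assume "\<forall>v\<in>dual_space D. aff \<nu>' (x v) = aff \<mu> v"
  then show "\<nu>' = \<nu>" using \<nu> W_surj[OF x] by (intro aff_separates) metis
qed

lemma lact_ex:
  assumes "x \<in> carrier W" shows "\<exists>L. \<forall>\<mu>. \<forall>v\<in>dual_space D. aff (L \<mu>) (x v) = aff \<mu> v"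
  using assms
proof (induction rule: W_induct)
  case one
  then show ?case by (intro exI[of _ "\<lambda>\<mu>. \<mu>"]) (simp add: one_W_apply)
next
  case (refl \<gamma> w)
  then obtain L where "\<And>\<mu> v. v \<in> dual_space D \<Longrightarrow> aff (L \<mu>) (w v) = aff \<mu> v" by blast
  then show ?case
    using refl by (intro exI[of _ "\<lambda>\<mu>. LR \<gamma> (L \<mu>)"]) (simp add: mult_W_apply T_in_W aff_T W_dual LR_LR)
qed

lemma aff_lact:
  "x \<in> carrier W \<Longrightarrow> v \<in> dual_space D \<Longrightarrow> aff (lact x \<mu>) (x v) = aff \<mu> v"
  using lact_ex[of x] lact_eqI[of x] by metis

lemma lact_one: "lact \<one>\<^bsub>W\<^esub> \<mu> = \<mu>"
  by (rule lact_eqI) (auto simp: one_W_apply)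

lemma lact_mult:
  "x \<in> carrier W \<Longrightarrow> y \<in> carrier W \<Longrightarrow> lact (x \<otimes>\<^bsub>W\<^esub> y) \<mu> = lact x (lact y \<mu>)"
  by (rule lact_eqI) (auto simp: mult_W_apply aff_lact W_dual)

lemma lact_T: "\<gamma> \<in> AR \<Longrightarrow> lact (T \<gamma>) \<mu> = LR \<gamma> \<mu>"
  by (rule lact_eqI) (auto simp: T_in_W aff_T LR_LR)

lemma lact_bij:
  assumes "x \<in> carrier W" shows "bij (lact x)"
  by (rule bij_betw_byWitness[of _ "lact (inv\<^bsub>W\<^esub> x)"])
     (use assms in \<open>auto simp: lact_mult[symmetric] lact_one\<close>)

lemma group_action_lact: "group_action W UNIV (restrict lact (carrier W))"
  unfolding group_action_def group_hom_def group_hom_axioms_def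
proof (intro conjI group_W group_BijGroup homI)
  fix x y assume xy: "x \<in> carrier W" "y \<in> carrier W"
  show "restrict lact (carrier W) x \<in> carrier (BijGroup UNIV)"
    using lact_bij xy by (simp add: BijGroup_def Bij_def)
  show "restrict lact (carrier W) (x \<otimes>\<^bsub>W\<^esub> y)
      = restrict lact (carrier W) x \<otimes>\<^bsub>BijGroup UNIV\<^esub> restrict lact (carrier W) y"
    using lact_bij xy by (auto simp: BijGroup_def Bij_def compose_def lact_mult)
qed

lemma group_action_unique:
  assumes \<rho>: "group_action W UNIV \<rho>" "\<And>\<gamma>. \<gamma> \<in> AR \<Longrightarrow> \<rho> (T \<gamma>) = LR \<gamma>" and x: "x \<in> carrier W"
  shows "\<rho> x = lact x"
proof -
  interpret group_action W UNIV \<rho> by (rule \<rho>)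
  show ?thesis using x
  proof (induction rule: W_induct)
    case one
    then show ?case using id_eq_one by (simp add: lact_one fun_eq_iff)
  next
    case (refl \<gamma> w)
    then show ?case
      using composition_rule[of _ "T \<gamma>" w] by (auto simp: T_in_W lact_mult lact_T \<rho>(2) fun_eq_iff)
  qed
qed

text \<open>Existence is \<open>group_action_lact\<close>. An action with the prescribed values on
  reflections is determined on the carrier because reflections generate, and extensionality fixes it
  elsewhere.\<close>

lemma affine_action_eq: "affine_action D = restrict lact (carrier W)"
  unfolding affine_action_def
proof (rule the_equality)
  show "group_action W UNIV (restrict lact (carrier W)) \<and>
      restrict lact (carrier W) \<in> extensional (carrier W) \<and>
      (\<forall>\<gamma>\<in>AR. restrict lact (carrier W) (T \<gamma>) = LR \<gamma>)"
    using group_action_lact by (simp add: T_in_W lact_T fun_eq_iff)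
next
  fix \<rho> assume \<rho>: "group_action W UNIV \<rho> \<and> \<rho> \<in> extensional (carrier W) \<and>
      (\<forall>\<gamma>\<in>AR. \<rho> (T \<gamma>) = LR \<gamma>)"
  show "\<rho> = restrict lact (carrier W)"
    by (rule extensionalityI[of _ "carrier W"]) (use \<rho> group_action_unique in auto)
qed

abbreviation "act \<equiv> affine_action D"

lemma act_one: "act \<one>\<^bsub>W\<^esub> \<mu> = \<mu>"
  by (simp add: affine_action_eq lact_one)

lemma act_mult:
  "x \<in> carrier W \<Longrightarrow> y \<in> carrier W \<Longrightarrow> act (x \<otimes>\<^bsub>W\<^esub> y) \<mu> = act x (act y \<mu>)"
  by (simp add: affine_action_eq lact_mult)

lemma act_T: "\<gamma> \<in> AR \<Longrightarrow> act (T \<gamma>) \<mu> = LR \<gamma> \<mu>"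
  by (simp add: affine_action_eq lact_T T_in_W)

lemma act_inv: "x \<in> carrier W \<Longrightarrow> act (inv\<^bsub>W\<^esub> x) (act x \<mu>) = \<mu>"
  and act_inv': "x \<in> carrier W \<Longrightarrow> act x (act (inv\<^bsub>W\<^esub> x) \<mu>) = \<mu>"
  by (simp_all add: act_mult[symmetric] act_one)

text \<open>Pull the function \<open>(\<mu>, 0)\<close> back to \<open>\<nu>\<close>; its values at
  \<open>x v\<close> and \<open>y v\<close> both equal the value of \<open>\<nu>\<close> at
  \<open>v\<close>. Identities in the group thereby become computations with weights.\<close>

lemma act_faithful:
  assumes x: "x \<in> carrier W" and y: "y \<in> carrier W" and eq: "\<And>\<mu>. act x \<mu> = act y \<mu>"
  shows "x = y"
proof (rule W_extI[OF x y])
  fix v assume v: "v \<in> dual_space D"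
  show "x v = y v"
  proof
    fix \<mu>
    define \<nu> where "\<nu> = act (inv\<^bsub>W\<^esub> x) (\<mu>, 0)"
    have \<nu>: "act x \<nu> = (\<mu>, 0)" unfolding \<nu>_def using x by (rule act_inv')
    then have \<nu>': "act y \<nu> = (\<mu>, 0)" by (simp only: eq)
    have "aff (act x \<nu>) (x v) = aff (act y \<nu>) (y v)"
      using x y v by (simp add: affine_action_eq aff_lact)
    then show "x v \<mu> = y v \<mu>" by (simp add: \<nu> \<nu>' aff_def)
  qed
qed

lemma LR_add: "\<gamma> \<in> AR \<Longrightarrow> LR \<gamma> (\<mu> + \<nu>) = LR \<gamma> \<mu> + LR \<gamma> \<nu>"
  by (auto simp: AR_iff LR_eq prod_eq_iff dual_simps[OF coroot_in_dual] vs.scale_left_distrib algebra_simps)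

lemma LR_psmul: "\<gamma> \<in> AR \<Longrightarrow> LR \<gamma> (psmul k \<mu>) = psmul k (LR \<gamma> \<mu>)"
  by (auto simp: AR_iff LR_eq prod_eq_iff dual_simps[OF coroot_in_dual] vs.scale_right_diff_distrib algebra_simps)

lemma act_add: "x \<in> carrier W \<Longrightarrow> act x (\<mu> + \<nu>) = act x \<mu> + act x \<nu>"
  by (induction rule: W_induct) (auto simp: act_one act_mult T_in_W act_T LR_add)

lemma act_psmul: "x \<in> carrier W \<Longrightarrow> act x (psmul k \<mu>) = psmul k (act x \<mu>)"
  by (induction rule: W_induct) (simp_all only: act_one act_mult T_in_W act_T LR_psmul)

lemma act_uminus: "x \<in> carrier W \<Longrightarrow> act x (- \<mu>) = - act x \<mu>"
  using act_psmul[of x "-1" \<mu>] by (simp add: uminus_prod_def)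

lemma act_diff: "x \<in> carrier W \<Longrightarrow> act x (\<mu> - \<nu>) = act x \<mu> - act x \<nu>"
  using act_add[of x \<mu> "- \<nu>"] by (simp add: act_uminus)

lemma act_root: "x \<in> carrier W \<Longrightarrow> \<gamma> \<in> AR \<Longrightarrow> act x \<gamma> \<in> AR"
  by (induction rule: W_induct) (auto simp: act_one act_mult T_in_W act_T LR_root)

text \<open>The conjugation rule for two reflections with the inverse cleared;
  \<open>coroot_reflect\<close> supplies the coroot of the conjugate.\<close>

lemma T_mult_T_commute:
  assumes \<gamma>: "\<gamma> \<in> AR" and \<delta>: "\<delta> \<in> AR"
  shows "T \<gamma> \<otimes>\<^bsub>W\<^esub> T \<delta> = T \<delta> \<otimes>\<^bsub>W\<^esub> T (LR \<delta> \<gamma>)"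
proof (rule act_faithful)
  fix \<mu>
  have c: "LR \<gamma> \<nu> = \<nu> + psmul (- coroot D (fst \<gamma>) (fst \<nu>)) \<gamma>" for \<nu>
    by (simp add: LR_eq prod_eq_iff)
  have "coroot D (fst (LR \<delta> \<gamma>)) (fst \<mu>) = coroot D (fst \<gamma>) (fst (LR \<delta> \<mu>))"
    using \<gamma> \<delta> coroot_reflect[of "fst \<delta>" "fst \<gamma>"] by (simp add: LR_eq AR_iff)
  then have "LR (LR \<delta> \<gamma>) \<mu> = \<mu> - psmul (coroot D (fst \<gamma>) (fst (LR \<delta> \<mu>))) (LR \<delta> \<gamma>)"
    unfolding LR_eq[of "LR \<delta> \<gamma>"] by simp
  also have "\<dots> = LR \<delta> (LR \<delta> \<mu>) + LR \<delta> (psmul (- coroot D (fst \<gamma>) (fst (LR \<delta> \<mu>))) \<gamma>)"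
    using \<delta> by (simp only: LR_psmul LR_LR) (simp add: prod_eq_iff)
  also have "\<dots> = LR \<delta> (LR \<gamma> (LR \<delta> \<mu>))"
    using \<delta> by (simp only: LR_add[symmetric]) (simp add: c)
  finally show "act (T \<gamma> \<otimes>\<^bsub>W\<^esub> T \<delta>) \<mu> = act (T \<delta> \<otimes>\<^bsub>W\<^esub> T (LR \<delta> \<gamma>)) \<mu>"
    using \<gamma> \<delta> by (simp add: act_mult T_in_W act_T LR_root LR_LR)
qed (use assms in \<open>auto simp: T_in_W LR_root\<close>)

text \<open>The rule that conjugating the reflection of \<open>\<delta>\<close> by \<open>x\<close>
  gives the reflection of \<open>x(\<delta>)\<close>, proved one reflection at a time.\<close>

lemma T_act:
  assumes "x \<in> carrier W" and \<delta>: "\<delta> \<in> AR" shows "T (act x \<delta>) \<otimes>\<^bsub>W\<^esub> x = x \<otimes>\<^bsub>W\<^esub> T \<delta>"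
  using assms(1)
proof (induction rule: W_induct)
  case one
  then show ?case using \<delta> by (simp add: act_one T_in_W)
next
  case (refl \<gamma> w)
  have r: "act w \<delta> \<in> AR" using refl \<delta> by (simp add: act_root)
  have "T (LR \<gamma> (act w \<delta>)) \<otimes>\<^bsub>W\<^esub> (T \<gamma> \<otimes>\<^bsub>W\<^esub> w) = (T (LR \<gamma> (act w \<delta>)) \<otimes>\<^bsub>W\<^esub> T \<gamma>) \<otimes>\<^bsub>W\<^esub> w"
    using refl r by (simp add: W.m_assoc T_in_W LR_root)
  also have "\<dots> = T \<gamma> \<otimes>\<^bsub>W\<^esub> (T (act w \<delta>) \<otimes>\<^bsub>W\<^esub> w)"
    using refl r by (simp add: T_mult_T_commute[of "LR \<gamma> (act w \<delta>)"] LR_root LR_LR W.m_assoc T_in_W)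
  finally show ?case
    using refl \<delta> r by (simp add: act_mult act_T T_in_W W.m_assoc)
qed

text \<open>Applying the common reflection to \<open>\<gamma>\<close> gives
  \<open>\<gamma> + \<gamma> = k \<delta>\<close>, and reducedness of the finite parts forces
  \<open>k\<close> to be \<open>2\<close> or \<open>-2\<close>.\<close>

lemma T_inj:
  assumes \<gamma>: "\<gamma> \<in> AR" and \<delta>: "\<delta> \<in> AR" and eq: "T \<gamma> = T \<delta>" shows "\<gamma> = \<delta> \<or> \<gamma> = - \<delta>"
proof -
  have "LR \<gamma> \<gamma> = LR \<delta> \<gamma>" using act_T[OF \<gamma>] act_T[OF \<delta>] eq by metis
  then have *: "- \<gamma> = \<gamma> - psmul (coroot D (fst \<delta>) (fst \<gamma>)) \<delta>"
    using LR_self[OF \<gamma>] by (simp only: LR_eq)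
  define k where "k = coroot D (fst \<delta>) (fst \<gamma>)"
  have "\<gamma> + \<gamma> = \<gamma> - (- \<gamma>)" by (simp only: diff_minus_eq_add)
  also have "\<dots> = psmul k \<delta>" unfolding k_def by (subst *) (simp only: diff_diff_eq2 add_diff_cancel_left')
  finally have k: "\<gamma> + \<gamma> = psmul k \<delta>" .
  then have k': "smul D 2 (fst \<gamma>) = smul D k (fst \<delta>)" "2 * snd \<gamma> = k * snd \<delta>"
    by (auto simp: prod_eq_iff scale_two)
  then have "smul D (1/2) (smul D 2 (fst \<gamma>)) = smul D (1/2) (smul D k (fst \<delta>))" by (simp only:)
  then have f: "fst \<gamma> = smul D (k / 2) (fst \<delta>)" by simp
  then have "k / 2 = 1 \<or> k / 2 = -1"
    using is_reduced \<gamma> \<delta> unfolding reduced_def AR_iff by metis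
  then have "k = 2 \<or> k = -2" by auto
  then show ?thesis using f k'(2) by (auto simp: prod_eq_iff)
qed

lemma T_mult_eq_iff:
  assumes x: "x \<in> carrier W" and \<gamma>: "\<gamma> \<in> AR" and \<delta>: "\<delta> \<in> AR"
    and eq: "T \<gamma> \<otimes>\<^bsub>W\<^esub> x = x \<otimes>\<^bsub>W\<^esub> T \<delta>"
  shows "\<gamma> = act x \<delta> \<or> \<gamma> = - act x \<delta>"
proof (rule T_inj[OF \<gamma> act_root[OF x \<delta>]])
  show "T \<gamma> = T (act x \<delta>)"
    using eq T_act[OF x \<delta>] x \<gamma> \<delta> by (metis W.right_cancel T_in_W act_root)
qed

section \<open>Generation by simple reflections\<close>

abbreviation "SR \<equiv> simple_reflections D"

lemma AS_subset_AR: "\<delta> \<in> AS \<Longrightarrow> \<delta> \<in> AR"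
  using AS_subset_AP by (simp add: AP_iff)

text \<open>The description is unique because \<open>T_inj\<close> determines the root up to sign
  and simple roots are positive.\<close>

lemma simple_root_of:
  assumes "s \<in> SR" shows "simple_root_of D s \<in> AS" "T (simple_root_of D s) = s"
proof -
  obtain \<gamma> where \<gamma>: "\<gamma> \<in> AS" "T \<gamma> = s" using assms by (auto simp: simple_reflections_def)
  have "\<gamma>' = \<gamma>" if "\<gamma>' \<in> AS" "T \<gamma>' = s" for \<gamma>'
    using T_inj[of \<gamma>' \<gamma>] that \<gamma> AS_subset_AR AS_subset_AP AP_not_neg by metis
  then have "simple_root_of D s = \<gamma>" unfolding simple_root_of_def using \<gamma> by blast
  then show "simple_root_of D s \<in> AS" "T (simple_root_of D s) = s" using \<gamma> by auto
qed

lemma simple_root_of_AR: "s \<in> SR \<Longrightarrow> simple_root_of D s \<in> AR"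
  by (intro AS_subset_AR simple_root_of)

lemma SR_in_W: "s \<in> SR \<Longrightarrow> s \<in> carrier W"
  by (metis simple_root_of(2) simple_root_of_AR T_in_W)

lemma SR_mult_SR: "s \<in> SR \<Longrightarrow> s \<otimes>\<^bsub>W\<^esub> s = \<one>\<^bsub>W\<^esub>"
  by (metis simple_root_of(2) simple_root_of_AR T_mult_T)

lemma SR_mult_cancel:
  "s \<in> SR \<Longrightarrow> x \<in> carrier W \<Longrightarrow> s \<otimes>\<^bsub>W\<^esub> (s \<otimes>\<^bsub>W\<^esub> x) = x"
  "s \<in> SR \<Longrightarrow> x \<in> carrier W \<Longrightarrow> x \<otimes>\<^bsub>W\<^esub> s \<otimes>\<^bsub>W\<^esub> s = x"
  by (simp_all add: W.m_assoc[symmetric] SR_mult_SR SR_in_W) (simp add: W.m_assoc SR_mult_SR SR_in_W)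

lemma word_prod_simps [simp]:
  "word_prod G [] = \<one>\<^bsub>G\<^esub>" "word_prod G (a # ws) = a \<otimes>\<^bsub>G\<^esub> word_prod G ws"
  by (simp_all add: word_prod_def)

lemma word_prod_closed: "set ws \<subseteq> carrier W \<Longrightarrow> word_prod W ws \<in> carrier W"
  by (induction ws) auto

lemma word_prod_append:
  "set us \<subseteq> carrier W \<Longrightarrow> set ws \<subseteq> carrier W \<Longrightarrow>
    word_prod W (us @ ws) = word_prod W us \<otimes>\<^bsub>W\<^esub> word_prod W ws"
  by (induction us) (auto simp: word_prod_closed W.m_assoc)

lemma SR_subset_W: "SR \<subseteq> carrier W" using SR_in_W by blast

text \<open>Iterate \<open>simple_descent\<close>. The rational number \<open>aht\<close> drops by
  at least one each time and stays nonnegative, so its floor serves as the measure.\<close>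

lemma affine_root_conj_simple:
  assumes "\<gamma> \<in> AP" shows "\<exists>ws \<delta>. set ws \<subseteq> SR \<and> \<delta> \<in> AS \<and> \<gamma> = act (word_prod W ws) \<delta>"
  using assms
proof (induction "nat \<lfloor>aht \<gamma>\<rfloor>" arbitrary: \<gamma> rule: less_induct)
  case less
  show ?case
  proof (cases "\<gamma> \<in> AS")
    case True
    then show ?thesis by (intro exI[of _ "[]"] exI[of _ \<gamma>]) (simp add: act_one)
  next
    case False
    then obtain \<epsilon> where \<epsilon>: "\<epsilon> \<in> AS" "LR \<epsilon> \<gamma> \<in> AP" "aht (LR \<epsilon> \<gamma>) + 1 \<le> aht \<gamma>"
      using simple_descent less.prems by blast
    have "nat \<lfloor>aht (LR \<epsilon> \<gamma>)\<rfloor> < nat \<lfloor>aht \<gamma>\<rfloor>"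
      using \<epsilon>(3) aht_pos[OF \<epsilon>(2)] by linarith
    then obtain ws \<delta> where ws: "set ws \<subseteq> SR" "\<delta> \<in> AS" "LR \<epsilon> \<gamma> = act (word_prod W ws) \<delta>"
      using less.hyps \<epsilon>(2) by blast
    have "\<gamma> = act (T \<epsilon>) (act (word_prod W ws) \<delta>)"
      using \<epsilon>(1) AS_subset_AR ws by (metis act_T LR_LR)
    also have "\<dots> = act (word_prod W (T \<epsilon> # ws)) \<delta>"
      using \<epsilon>(1) AS_subset_AR ws SR_subset_W by (simp add: act_mult T_in_W word_prod_closed)
    finally show ?thesis
      using \<epsilon>(1) ws by (intro exI[of _ "T \<epsilon> # ws"] exI[of _ \<delta>]) (simp add: simple_reflections_def)
  qed
qed

text \<open>Every affine reflection is a conjugate of a simple one, as \<open>bruhat_less\<close>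
  demands; taking a word as conjugator also shows that the simple reflections generate
  (\<open>W_word\<close>).\<close>

lemma T_conj_simple:
  assumes "\<gamma> \<in> AP"
  shows "\<exists>ws s. set ws \<subseteq> SR \<and> s \<in> SR \<and> T \<gamma> = word_prod W ws \<otimes>\<^bsub>W\<^esub> s \<otimes>\<^bsub>W\<^esub> inv\<^bsub>W\<^esub> word_prod W ws"
proof -
  obtain ws \<delta> where ws: "set ws \<subseteq> SR" "\<delta> \<in> AS" "\<gamma> = act (word_prod W ws) \<delta>"
    using affine_root_conj_simple[OF assms] by blast
  have w: "word_prod W ws \<in> carrier W" using ws SR_subset_W word_prod_closed by blast
  have "T \<gamma> \<otimes>\<^bsub>W\<^esub> word_prod W ws = word_prod W ws \<otimes>\<^bsub>W\<^esub> T \<delta>"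
    using T_act[OF w] ws AS_subset_AR by simp
  then have "T \<gamma> = word_prod W ws \<otimes>\<^bsub>W\<^esub> T \<delta> \<otimes>\<^bsub>W\<^esub> inv\<^bsub>W\<^esub> word_prod W ws"
    using w assms T_in_W by (metis AP_iff W.inv_solve_right W.m_closed W.inv_closed AS_subset_AR ws(2))
  then show ?thesis using ws by (auto simp: simple_reflections_def)
qed

lemma inv_word_prod: "set ws \<subseteq> SR \<Longrightarrow> inv\<^bsub>W\<^esub> word_prod W ws = word_prod W (rev ws)"
proof (induction ws)
  case (Cons s ws)
  then have s: "inv\<^bsub>W\<^esub> s = s" by (intro W.inv_equality) (auto simp: SR_mult_SR SR_in_W)
  have "set ws \<subseteq> carrier W" "s \<in> carrier W" using Cons SR_subset_W by auto
  then show ?case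
    using Cons s by (simp add: W.inv_mult_group word_prod_closed word_prod_append)
qed simp

lemma W_word: assumes "x \<in> carrier W" shows "\<exists>ws. set ws \<subseteq> SR \<and> word_prod W ws = x"
  using assms
proof (induction rule: W_induct)
  case one
  show ?case by (intro exI[of _ "[]"]) simp
next
  case (refl \<gamma> w)
  have pos: "\<exists>us. set us \<subseteq> SR \<and> word_prod W us = T \<gamma>" if P: "\<gamma> \<in> AP" for \<gamma>
  proof -
    obtain ws s where ws: "set ws \<subseteq> SR" "s \<in> SR"
      "T \<gamma> = word_prod W ws \<otimes>\<^bsub>W\<^esub> s \<otimes>\<^bsub>W\<^esub> inv\<^bsub>W\<^esub> word_prod W ws"
      using T_conj_simple[OF P] by blast
    have c: "set ws \<subseteq> carrier W" "s \<in> carrier W" using ws SR_subset_W by auto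
    show ?thesis
      using ws c by (intro exI[of _ "ws @ s # rev ws"])
        (simp add: word_prod_append word_prod_closed inv_word_prod W.m_assoc)
  qed
  \<comment> \<open>A reflection maps its own root to the negative, so \<open>T_act\<close>
    identifies the reflections of \<open>\<gamma>\<close> and \<open>- \<gamma>\<close>; a positive
    root can thus be chosen.\<close>
  have neg: "T (- \<gamma>) = T \<gamma>"
  proof -
    have "T (- \<gamma>) \<otimes>\<^bsub>W\<^esub> T \<gamma> = T \<gamma> \<otimes>\<^bsub>W\<^esub> T \<gamma>"
      using T_act[OF T_in_W[OF refl(1)] refl(1)] refl(1) by (simp add: act_T LR_self)
    then show ?thesis using refl(1) by (metis W.right_cancel T_in_W uminus_AR)
  qed
  have "\<exists>us. set us \<subseteq> SR \<and> word_prod W us = T \<gamma>"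
    using AR_pos_or_neg[OF refl(1)] pos[of \<gamma>] pos[of "- \<gamma>"] unfolding neg by blast
  then obtain us where us: "set us \<subseteq> SR" "word_prod W us = T \<gamma>" by blast
  obtain ws where ws: "set ws \<subseteq> SR" "word_prod W ws = w" using refl(3) by blast
  show ?case
    using us ws word_prod_append[of us ws] subset_trans[OF _ SR_subset_W]
    by (intro exI[of _ "us @ ws"]) simp
qed

section \<open>Subsequences and the strong exchange condition\<close>

lemma ev_simps:
  "ev D [] = \<one>\<^bsub>W\<^esub>" "ev D (None # \<sigma>) = ev D \<sigma>" "ev D (Some s # \<sigma>) = s \<otimes>\<^bsub>W\<^esub> ev D \<sigma>"
  by (simp_all add: ev_def)

lemma subseqs_of_Nil: "subseqs_of [] = {[]}"
  by (auto simp: subseqs_of_def)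

lemma subseqs_of_Cons: "a # \<sigma> \<in> subseqs_of (s # ss) \<longleftrightarrow> (a = None \<or> a = Some s) \<and> \<sigma> \<in> subseqs_of ss"
  by (auto simp: subseqs_of_def)

lemma subseqs_of_induct [consumes 1, case_names Nil None Some]:
  assumes "\<sigma> \<in> subseqs_of ss" "P [] []"
    "\<And>s ss \<sigma>. \<sigma> \<in> subseqs_of ss \<Longrightarrow> P ss \<sigma> \<Longrightarrow> P (s # ss) (None # \<sigma>)"
    "\<And>s ss \<sigma>. \<sigma> \<in> subseqs_of ss \<Longrightarrow> P ss \<sigma> \<Longrightarrow> P (s # ss) (Some s # \<sigma>)"
  shows "P ss \<sigma>"
proof -
  have "list_all2 (\<lambda>a s. a = None \<or> a = Some s) \<sigma> ss" using assms(1) by (simp add: subseqs_of_def)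
  then show ?thesis
    by (induction rule: list_all2_induct) (use assms in \<open>auto simp: subseqs_of_def\<close>)
qed

lemma ev_closed: "\<sigma> \<in> subseqs_of ss \<Longrightarrow> set ss \<subseteq> SR \<Longrightarrow> ev D \<sigma> \<in> carrier W"
  by (induction rule: subseqs_of_induct) (auto simp: ev_simps SR_in_W)

text \<open>Read the subsequence from the left and apply each letter to \<open>\<gamma>\<close>. The
  root stays positive until it equals the simple root of the current letter
  (\<open>LR_simple_pos\<close>); blanking that letter multiplies the product by
  \<open>T \<gamma>\<close> on the left. This must happen, since the final root is not
  positive.\<close>

lemma strong_exchange:
  assumes "\<sigma> \<in> subseqs_of ss" "set ss \<subseteq> SR" "\<gamma> \<in> AP" "act (inv\<^bsub>W\<^esub> ev D \<sigma>) \<gamma> \<notin> AP"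
  shows "\<exists>\<tau>\<in>subseqs_of ss. ev D \<tau> = T \<gamma> \<otimes>\<^bsub>W\<^esub> ev D \<sigma> \<and>
    length (filter (\<lambda>a. a \<noteq> None) \<tau>) < length (filter (\<lambda>a. a \<noteq> None) \<sigma>)"
  using assms
proof (induction arbitrary: \<gamma> rule: subseqs_of_induct)
  case Nil
  then show ?case by (simp add: ev_simps act_one)
next
  case (None s ss \<sigma>)
  then have "set ss \<subseteq> SR" "act (inv\<^bsub>W\<^esub> ev D \<sigma>) \<gamma> \<notin> AP" by (simp_all add: ev_simps)
  from None.IH[OF this(1) None.prems(2) this(2)]
  obtain \<tau> where "\<tau> \<in> subseqs_of ss" "ev D \<tau> = T \<gamma> \<otimes>\<^bsub>W\<^esub> ev D \<sigma>"
    "length (filter (\<lambda>a. a \<noteq> None) \<tau>) < length (filter (\<lambda>a. a \<noteq> None) \<sigma>)" by blast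
  then show ?case by (intro bexI[of _ "None # \<tau>"]) (auto simp: ev_simps subseqs_of_Cons)
next
  case (Some s ss \<sigma>)
  define \<delta> where "\<delta> = simple_root_of D s"
  have \<delta>: "\<delta> \<in> AS" "T \<delta> = s" "\<delta> \<in> AR"
    using simple_root_of simple_root_of_AR Some.prems by (auto simp: \<delta>_def)
  have w: "ev D \<sigma> \<in> carrier W" using ev_closed Some by simp
  have s: "s \<in> SR" "s \<in> carrier W" using Some.prems SR_in_W by auto
  have \<gamma>: "\<gamma> \<in> AR" using Some.prems by (simp add: AP_iff)
  show ?case
  proof (cases "\<gamma> = \<delta>")
    case True
    have "T \<gamma> \<otimes>\<^bsub>W\<^esub> (s \<otimes>\<^bsub>W\<^esub> ev D \<sigma>) = ev D \<sigma>"
      using T_mult_cancel[of \<delta>] \<delta> w True by simp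
    then show ?thesis
      using Some.hyps by (intro bexI[of _ "None # \<sigma>"]) (auto simp: ev_simps subseqs_of_Cons)
  next
    case False
    have P: "LR \<delta> \<gamma> \<in> AP" using LR_simple_pos \<delta> Some.prems False by blast
    have "inv\<^bsub>W\<^esub> (s \<otimes>\<^bsub>W\<^esub> ev D \<sigma>) = inv\<^bsub>W\<^esub> ev D \<sigma> \<otimes>\<^bsub>W\<^esub> T \<delta>"
      unfolding \<delta>(2)[symmetric] using w \<delta>(3) by (simp add: W.inv_mult_group T_in_W inv_T)
    then have "act (inv\<^bsub>W\<^esub> ev D \<sigma>) (LR \<delta> \<gamma>) \<notin> AP"
      using Some.prems(3) w \<delta>(3) by (simp add: ev_simps act_mult T_in_W act_T)
    then obtain \<tau> where \<tau>: "\<tau> \<in> subseqs_of ss" "ev D \<tau> = T (LR \<delta> \<gamma>) \<otimes>\<^bsub>W\<^esub> ev D \<sigma>"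
      "length (filter (\<lambda>a. a \<noteq> None) \<tau>) < length (filter (\<lambda>a. a \<noteq> None) \<sigma>)"
      using Some.IH[OF _ P] Some.prems by auto
    have "s \<otimes>\<^bsub>W\<^esub> ev D \<tau> = (T \<delta> \<otimes>\<^bsub>W\<^esub> T (LR \<delta> \<gamma>)) \<otimes>\<^bsub>W\<^esub> ev D \<sigma>"
      using \<delta> w \<gamma> s by (simp add: \<tau>(2) W.m_assoc T_in_W LR_root)
    also have "\<dots> = T \<gamma> \<otimes>\<^bsub>W\<^esub> (s \<otimes>\<^bsub>W\<^esub> ev D \<sigma>)"
      unfolding T_mult_T_commute[OF \<gamma> \<delta>(3), symmetric] using \<delta>(2) w \<gamma> s by (simp add: W.m_assoc T_in_W)
    finally show ?thesis
      using \<tau> by (intro bexI[of _ "Some s # \<tau>"]) (auto simp: ev_simps subseqs_of_Cons)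
  qed
qed

text \<open>In terms of edges: with the upper end of an edge, the set of evaluations contains the
  lower end.\<close>

lemma ev_set_exchange:
  assumes "x \<in> ev_set D ss" "set ss \<subseteq> SR" "\<gamma> \<in> AP" "act (inv\<^bsub>W\<^esub> x) \<gamma> \<notin> AP"
  shows "T \<gamma> \<otimes>\<^bsub>W\<^esub> x \<in> ev_set D ss"
proof -
  obtain \<sigma> where \<sigma>: "\<sigma> \<in> subseqs_of ss" "x = ev D \<sigma>" using assms(1) by (auto simp: ev_set_def)
  have "act (inv\<^bsub>W\<^esub> ev D \<sigma>) \<gamma> \<notin> AP" using assms(4) \<sigma>(2) by simp
  from strong_exchange[OF \<sigma>(1) assms(2,3) this]
  obtain \<tau> where "\<tau> \<in> subseqs_of ss" "ev D \<tau> = T \<gamma> \<otimes>\<^bsub>W\<^esub> x" using \<sigma>(2) by blast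
  then show ?thesis unfolding ev_set_def by (metis image_eqI)
qed

section \<open>Length and the edges of the moment graph\<close>

lemma word_length_le:
  "set ws \<subseteq> SR \<Longrightarrow> word_length W SR (word_prod W ws) \<le> length ws"
  unfolding word_length_def by (rule Least_le) blast

lemma reduced_word:
  assumes "x \<in> carrier W"
  shows "\<exists>ws. set ws \<subseteq> SR \<and> length ws = word_length W SR x \<and> word_prod W ws = x"
proof -
  obtain ws where "set ws \<subseteq> SR" "word_prod W ws = x" using W_word[OF assms] by blast
  then have "\<exists>k. \<exists>ws. set ws \<subseteq> SR \<and> length ws = k \<and> word_prod W ws = x" by blast
  then show ?thesis unfolding word_length_def by (rule LeastI_ex)
qed

text \<open>Apply \<open>strong_exchange\<close> to a reduced word, viewed as a subsequence of
  itself without blanks.\<close>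

lemma word_length_less:
  assumes x: "x \<in> carrier W" and \<gamma>: "\<gamma> \<in> AP" "act (inv\<^bsub>W\<^esub> x) \<gamma> \<notin> AP"
  shows "word_length W SR (T \<gamma> \<otimes>\<^bsub>W\<^esub> x) < word_length W SR x"
proof -
  obtain ws where ws: "set ws \<subseteq> SR" "length ws = word_length W SR x" "word_prod W ws = x"
    using reduced_word[OF x] by blast
  have "map Some ws \<in> subseqs_of ws" by (simp add: subseqs_of_def list_all2_conv_all_nth)
  moreover have "ev D (map Some ws) = x" using ws(3) by (simp add: ev_def filter_map o_def)
  ultimately obtain \<tau> where \<tau>: "\<tau> \<in> subseqs_of ws" "ev D \<tau> = T \<gamma> \<otimes>\<^bsub>W\<^esub> x"
    "length (filter (\<lambda>a. a \<noteq> None) \<tau>) < length (filter (\<lambda>a. a \<noteq> None) (map Some ws))"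
    using strong_exchange[of "map Some ws" ws \<gamma>] ws(1) \<gamma> by auto
  have "set (map the (filter (\<lambda>a. a \<noteq> None) \<tau>)) \<subseteq> set ws"
    using \<tau>(1) by (induction rule: subseqs_of_induct) auto
  then have "word_length W SR (T \<gamma> \<otimes>\<^bsub>W\<^esub> x) \<le> length (filter (\<lambda>a. a \<noteq> None) \<tau>)"
    using word_length_le[of "map the (filter (\<lambda>a. a \<noteq> None) \<tau>)"] ws(1) \<tau>(2) by (simp add: ev_def)
  also have "\<dots> < length ws" using \<tau>(3) by (simp add: filter_map o_def)
  finally show ?thesis using ws(2) by simp
qed

lemma inv_T_mult:
  "x \<in> carrier W \<Longrightarrow> \<gamma> \<in> AR \<Longrightarrow> act (inv\<^bsub>W\<^esub> (T \<gamma> \<otimes>\<^bsub>W\<^esub> x)) \<gamma> = - act (inv\<^bsub>W\<^esub> x) \<gamma>"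
  by (simp add: W.inv_mult_group T_in_W inv_T act_mult act_T LR_self act_uminus)

lemma bruhat_less_word_length:
  "(x, y) \<in> bruhat_less W SR \<Longrightarrow> word_length W SR x < word_length W SR y"
  unfolding bruhat_less_def by (induction rule: trancl_induct) (auto intro: less_trans)

text \<open>Trades the Bruhat order for the sign of a root. An edge raises the length, which
  excludes a negative root by \<open>word_length_less\<close>. Conversely, if the root is positive
  at \<open>x\<close>, it is negative at \<open>y\<close>, so \<open>x\<close> is shorter and the
  edge is a single Bruhat step.\<close>

lemma moment_graph_iff:
  "(x, y, l) \<in> moment_graph D bs \<longleftrightarrow>
    (\<exists>\<gamma>\<in>AP. l = bar D bs \<gamma> \<and> x \<in> carrier W \<and> y = T \<gamma> \<otimes>\<^bsub>W\<^esub> x \<and> act (inv\<^bsub>W\<^esub> x) \<gamma> \<in> AP)"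
proof (intro iffI)
  assume "(x, y, l) \<in> moment_graph D bs"
  then obtain \<gamma> where \<gamma>: "\<gamma> \<in> AP" "l = bar D bs \<gamma>" "x \<in> carrier W" "y = T \<gamma> \<otimes>\<^bsub>W\<^esub> x"
    "(x, y) \<in> bruhat_less W SR"
    unfolding moment_graph_def by blast
  then have "word_length W SR x < word_length W SR (T \<gamma> \<otimes>\<^bsub>W\<^esub> x)"
    using bruhat_less_word_length by blast
  then have "act (inv\<^bsub>W\<^esub> x) \<gamma> \<in> AP" using word_length_less[of x \<gamma>] \<gamma> by auto
  then show "\<exists>\<gamma>\<in>AP. l = bar D bs \<gamma> \<and> x \<in> carrier W \<and> y = T \<gamma> \<otimes>\<^bsub>W\<^esub> x \<and> act (inv\<^bsub>W\<^esub> x) \<gamma> \<in> AP"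
    using \<gamma> by blast
next
  assume "\<exists>\<gamma>\<in>AP. l = bar D bs \<gamma> \<and> x \<in> carrier W \<and> y = T \<gamma> \<otimes>\<^bsub>W\<^esub> x \<and> act (inv\<^bsub>W\<^esub> x) \<gamma> \<in> AP"
  then obtain \<gamma> where \<gamma>: "\<gamma> \<in> AP" "l = bar D bs \<gamma>" "x \<in> carrier W" "y = T \<gamma> \<otimes>\<^bsub>W\<^esub> x"
    "act (inv\<^bsub>W\<^esub> x) \<gamma> \<in> AP" by blast
  have r: "\<gamma> \<in> AR" using \<gamma>(1) by (simp add: AP_iff)
  have y: "y \<in> carrier W" "T \<gamma> \<otimes>\<^bsub>W\<^esub> y = x" using \<gamma> r by (simp_all add: T_in_W T_mult_cancel)
  have "act (inv\<^bsub>W\<^esub> y) \<gamma> \<notin> AP"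
    using inv_T_mult[OF \<gamma>(3) r] AP_not_neg \<gamma>(4,5) by simp
  then have "word_length W SR x < word_length W SR y"
    using word_length_less[OF y(1) \<gamma>(1)] y(2) by simp
  moreover obtain ws s where "set ws \<subseteq> SR" "s \<in> SR"
    "T \<gamma> = word_prod W ws \<otimes>\<^bsub>W\<^esub> s \<otimes>\<^bsub>W\<^esub> inv\<^bsub>W\<^esub> word_prod W ws"
    using T_conj_simple[OF \<gamma>(1)] by blast
  moreover have "word_prod W ws \<in> carrier W" 
    using \<open>set ws \<subseteq> SR\<close> SR_subset_W word_prod_closed by blast
  ultimately have "(x, y) \<in> bruhat_less W SR"
    unfolding bruhat_less_def \<gamma>(4) using \<gamma>(3) by (intro r_into_trancl) blast
  then show "(x, y, l) \<in> moment_graph D bs"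
    unfolding moment_graph_def using \<gamma> y by blast
qed

end

section \<open>The module of a sequence\<close>

locale root_datum_basis = root_datum D for D :: "'v::ab_group_add root_datum" +
  fixes bs :: "('v \<times> rat) list"
  assumes basis: "affine_weight_basis D bs"
begin

sublocale im: Modules.module "int_smul D"
  by unfold_locales
    (auto simp: int_smul_def vs.scale_left_distrib vs.scale_right_distrib algebra_simps)

section \<open>Weights and their images in the polynomial ring\<close>

abbreviation "AWt \<equiv> affine_weights D"
abbreviation "br \<equiv> bar D bs"

lemma int_smul_eq: "int_smul D k \<mu> = psmul (of_int k) \<mu>"
  by (simp add: int_smul_def)

lemma independent_bs: "im.independent (set bs)" and span_bs: "im.span (set bs) = AWt"
  using basis by (auto simp: affine_weight_basis_def)

lemma AWt_iff: "\<mu> \<in> AWt \<longleftrightarrow> (\<forall>\<alpha>\<in>roots D. coroot D \<alpha> (fst \<mu>) \<in> \<int>) \<and> snd \<mu> \<in> \<int>"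
  by (cases \<mu>) (auto simp: affine_weights_def weights_def)

lemma AR_subset_AWt: "\<gamma> \<in> AR \<Longrightarrow> \<gamma> \<in> AWt"
  by (simp add: AR_iff AWt_iff coroot_int)

lemma AWt_diff: "\<mu> \<in> AWt \<Longrightarrow> \<nu> \<in> AWt \<Longrightarrow> \<mu> - \<nu> \<in> AWt"
  unfolding span_bs[symmetric] by (rule im.span_diff)

lemma AWt_int_smul: "\<mu> \<in> AWt \<Longrightarrow> int_smul D k \<mu> \<in> AWt"
  unfolding span_bs[symmetric] by (rule im.span_scale)

lemma LR_int:
  assumes "\<gamma> \<in> AR" "\<mu> \<in> AWt" shows "\<exists>k. LR \<gamma> \<mu> = \<mu> - int_smul D k \<gamma>"
proof -
  have "coroot D (fst \<gamma>) (fst \<mu>) \<in> \<int>" using assms by (simp add: AR_iff AWt_iff)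
  then obtain k where "coroot D (fst \<gamma>) (fst \<mu>) = of_int k" by (auto elim: Ints_cases)
  then show ?thesis by (intro exI[of _ k]) (simp add: LR_eq int_smul_eq)
qed

lemma act_AWt: assumes "x \<in> carrier W" "\<mu> \<in> AWt" shows "act x \<mu> \<in> AWt"
  using assms(1)
proof (induction rule: W_induct)
  case (refl \<gamma> w)
  obtain k where "LR \<gamma> (act w \<mu>) = act w \<mu> - int_smul D k \<gamma>" using LR_int refl by blast
  then show ?case
    using refl AWt_diff AWt_int_smul AR_subset_AWt by (simp add: act_mult T_in_W act_T)
qed (use assms in \<open>simp add: act_one\<close>)

lemma br_lin_form: "br \<mu> = lin_form (length bs) (\<lambda>i. of_int (im.representation (set bs) \<mu> (bs ! i)))"
  by (simp add: bar_def lin_form_def)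

lemma br_in_sym_algebra [simp]: "br \<mu> \<in> sym_algebra bs"
  by (simp add: br_lin_form)

text \<open>Additivity is restricted to the lattice because \<open>representation\<close> defaults
  to zero outside the span of the basis.\<close>

lemma br_diff:
  assumes "\<mu> \<in> AWt" "\<nu> \<in> AWt" shows "br (\<mu> - \<nu>) = br \<mu> - br \<nu>"
  using assms unfolding br_lin_form lin_form_diff span_bs[symmetric]
  by (simp add: im.representation_diff[OF independent_bs])

lemma br_int_smul: "\<mu> \<in> AWt \<Longrightarrow> br (int_smul D k \<mu>) = mconst (of_int k) * br \<mu>"
  unfolding br_lin_form lin_form_smult span_bs[symmetric]
  by (simp add: im.representation_scale[OF independent_bs])

lemma br_uminus: "\<mu> \<in> AWt \<Longrightarrow> br (- \<mu>) = - br \<mu>"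
proof -
  assume "\<mu> \<in> AWt"
  moreover have "- \<mu> = int_smul D (-1) \<mu>" by (simp add: int_smul_eq prod_eq_iff)
  ultimately show ?thesis by (simp only: br_int_smul) (simp add: mconst_uminus)
qed

section \<open>Module structure by recursion on the sequence\<close>

definition lift ::
    "'v transf list \<Rightarrow> 'v transf \<Rightarrow> ('v transf option list \<Rightarrow> 'f::field mpoly) \<Rightarrow>
     ('v transf option list \<Rightarrow> 'f mpoly) \<Rightarrow> 'v transf option list \<Rightarrow> 'f mpoly" where
  "lift ss s f g = (\<lambda>\<sigma>. diag (ss @ [s]) f \<sigma> + c_op D bs (simple_root_of D s) (diag (ss @ [s]) g) \<sigma>)"

abbreviation "XM \<equiv> X_module D bs"

lemma X_snoc: "h \<in> XM (ss @ [s]) \<longleftrightarrow> (\<exists>f\<in>XM ss. \<exists>g\<in>XM ss. h = lift ss s f g)"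
  by (auto simp: lift_def)

lemma subseqs_of_snoc:
  "\<tau> \<in> subseqs_of (ss @ [s]) \<longleftrightarrow> (\<exists>\<sigma>\<in>subseqs_of ss. \<tau> = \<sigma> @ [None] \<or> \<tau> = \<sigma> @ [Some s])"
proof
  assume "\<tau> \<in> subseqs_of (ss @ [s])"
  then show "\<exists>\<sigma>\<in>subseqs_of ss. \<tau> = \<sigma> @ [None] \<or> \<tau> = \<sigma> @ [Some s]"
    by (auto simp: subseqs_of_def list_all2_append2 list_all2_Cons2)
qed (auto simp: subseqs_of_def list_all2_appendI)

lemma ev_snoc:
  assumes "\<sigma> \<in> subseqs_of ss" "set ss \<subseteq> SR"
  shows "ev D (\<sigma> @ [None]) = ev D \<sigma>"
    and "s \<in> SR \<Longrightarrow> ev D (\<sigma> @ [Some s]) = ev D \<sigma> \<otimes>\<^bsub>W\<^esub> s"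
proof -
  have "set (map the (filter (\<lambda>a. a \<noteq> None) \<sigma>)) \<subseteq> set ss"
    using assms(1) by (induction rule: subseqs_of_induct) auto
  then have "set (map the (filter (\<lambda>a. a \<noteq> None) \<sigma>)) \<subseteq> carrier W"
    using assms(2) SR_subset_W by blast
  then show "s \<in> SR \<Longrightarrow> ev D (\<sigma> @ [Some s]) = ev D \<sigma> \<otimes>\<^bsub>W\<^esub> s"
    using SR_in_W by (simp add: ev_def word_prod_append)
qed (simp add: ev_def)

lemma lift_None:
  assumes "\<sigma> \<in> subseqs_of ss" "set ss \<subseteq> SR"
  shows "lift ss s f g (\<sigma> @ [None]) = f \<sigma> + br (act (ev D \<sigma>) (simple_root_of D s)) * g \<sigma>"
proof -
  have "\<sigma> @ [None] \<in> subseqs_of (ss @ [s])" using assms(1) unfolding subseqs_of_snoc by blast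
  then show ?thesis using ev_snoc(1)[OF assms] by (simp add: lift_def diag_def c_op_def)
qed

lemma act_mult_simple:
  assumes "x \<in> carrier W" "s \<in> SR"
  shows "act (x \<otimes>\<^bsub>W\<^esub> s) (simple_root_of D s) = - act x (simple_root_of D s)"
  using assms SR_in_W[OF assms(2)] simple_root_of(2)[OF assms(2)] simple_root_of_AR[OF assms(2)]
  by (metis LR_self act_T act_mult act_uminus)

lemma br_act_mult_simple:
  assumes "x \<in> carrier W" "s \<in> SR"
  shows "br (act (x \<otimes>\<^bsub>W\<^esub> s) (simple_root_of D s)) = - br (act x (simple_root_of D s))"
  using assms by (simp add: act_mult_simple br_uminus AR_subset_AWt act_root simple_root_of_AR)

text \<open>The sign is opposite to that in \<open>lift_None\<close> because \<open>s\<close>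
  negates its simple root.\<close>

lemma lift_Some:
  assumes "\<sigma> \<in> subseqs_of ss" "set ss \<subseteq> SR" "s \<in> SR"
  shows "lift ss s f g (\<sigma> @ [Some s]) = f \<sigma> - br (act (ev D \<sigma>) (simple_root_of D s)) * g \<sigma>"
proof -
  have "\<sigma> @ [Some s] \<in> subseqs_of (ss @ [s])" using assms(1) unfolding subseqs_of_snoc by blast
  then show ?thesis
    using assms ev_snoc(2)[OF assms]
    by (simp add: lift_def diag_def c_op_def br_act_mult_simple ev_closed)
qed

lemma lift_out: "\<tau> \<notin> subseqs_of (ss @ [s]) \<Longrightarrow> lift ss s f g \<tau> = 0"
  by (simp add: lift_def diag_def c_op_def)

text \<open>The last condition reflects that elements of the direct sum are functions on all option
  lists, zero outside the index set.\<close>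

lemma eq_liftI:
  assumes "set ss \<subseteq> SR" "s \<in> SR"
    and "\<And>\<sigma>. \<sigma> \<in> subseqs_of ss \<Longrightarrow>
      h (\<sigma> @ [None]) = f \<sigma> + br (act (ev D \<sigma>) (simple_root_of D s)) * g \<sigma>"
    and "\<And>\<sigma>. \<sigma> \<in> subseqs_of ss \<Longrightarrow>
      h (\<sigma> @ [Some s]) = f \<sigma> - br (act (ev D \<sigma>) (simple_root_of D s)) * g \<sigma>"
    and "\<And>\<tau>. \<tau> \<notin> subseqs_of (ss @ [s]) \<Longrightarrow> h \<tau> = 0"
  shows "h = lift ss s f g"
proof
  fix \<tau>
  show "h \<tau> = lift ss s f g \<tau>"
  proof (cases "\<tau> \<in> subseqs_of (ss @ [s])")
    case True
    then obtain \<sigma> where "\<sigma> \<in> subseqs_of ss" "\<tau> = \<sigma> @ [None] \<or> \<tau> = \<sigma> @ [Some s]"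
      unfolding subseqs_of_snoc by blast
    then show ?thesis using assms by (auto simp: lift_None lift_Some)
  qed (use assms in \<open>simp add: lift_out\<close>)
qed

lemma X_Nil: "f \<in> XM [] \<longleftrightarrow> f [] \<in> sym_algebra bs \<and> (\<forall>\<sigma>. \<sigma> \<noteq> [] \<longrightarrow> f \<sigma> = 0)"
  by (auto simp: seq_sum_def subseqs_of_Nil)

text \<open>The recursion provides only a set; closure under the module operations is inherited from
  the shorter sequence because \<open>lift\<close> is linear in the pair of its components.\<close>

lemma X_add:
  assumes "set ss \<subseteq> SR" "f \<in> XM ss" "g \<in> XM ss" shows "(\<lambda>\<sigma>. f \<sigma> + g \<sigma>) \<in> XM ss"
  using assms
proof (induction ss arbitrary: f g rule: rev_induct)
  case (snoc s ss)
  then have S: "set ss \<subseteq> SR" "s \<in> SR" by auto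
  obtain f1 f2 where f: "f1 \<in> XM ss" "f2 \<in> XM ss" "f = lift ss s f1 f2" using snoc.prems unfolding X_snoc by blast
  obtain g1 g2 where g: "g1 \<in> XM ss" "g2 \<in> XM ss" "g = lift ss s g1 g2" using snoc.prems unfolding X_snoc by blast
  have "(\<lambda>\<sigma>. f \<sigma> + g \<sigma>) = lift ss s (\<lambda>\<sigma>. f1 \<sigma> + g1 \<sigma>) (\<lambda>\<sigma>. f2 \<sigma> + g2 \<sigma>)"
    using S by (intro eq_liftI) (auto simp: f g lift_None lift_Some lift_out algebra_simps)
  then show ?case unfolding X_snoc using snoc.IH[OF S(1)] f g by blast
qed (auto simp: seq_sum_def subseqs_of_Nil)

lemma X_scale:
  assumes "set ss \<subseteq> SR" "p \<in> sym_algebra bs" "f \<in> XM ss" shows "(\<lambda>\<sigma>. p * f \<sigma>) \<in> XM ss"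
  using assms
proof (induction ss arbitrary: f rule: rev_induct)
  case (snoc s ss)
  then have S: "set ss \<subseteq> SR" "s \<in> SR" by auto
  obtain f1 f2 where f: "f1 \<in> XM ss" "f2 \<in> XM ss" "f = lift ss s f1 f2" using snoc.prems unfolding X_snoc by blast
  have "(\<lambda>\<sigma>. p * f \<sigma>) = lift ss s (\<lambda>\<sigma>. p * f1 \<sigma>) (\<lambda>\<sigma>. p * f2 \<sigma>)"
    using S by (intro eq_liftI) (auto simp: f lift_None lift_Some lift_out algebra_simps)
  then show ?case unfolding X_snoc using snoc.IH[OF S(1) snoc.prems(2)] f by blast
qed (auto simp: seq_sum_def subseqs_of_Nil)

lemma X_diff:
  assumes "set ss \<subseteq> SR" "f \<in> XM ss" "g \<in> XM ss" shows "(\<lambda>\<sigma>. f \<sigma> - g \<sigma>) \<in> XM ss"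
  using X_add[OF assms(1,2) X_scale[OF assms(1) sym_algebra_const[of "-1"] assms(3)]]
  by (simp add: mconst_uminus)

lemma X_zero: "set ss \<subseteq> SR \<Longrightarrow> (\<lambda>\<sigma>. 0 :: 'f::field mpoly) \<in> XM ss"
proof (induction ss rule: rev_induct)
  case (snoc s ss)
  have "(\<lambda>\<sigma>. 0 :: 'f mpoly) = lift ss s (\<lambda>\<sigma>. 0) (\<lambda>\<sigma>. 0)"
    using snoc by (intro eq_liftI) auto
  moreover have "(\<lambda>\<sigma>. 0 :: 'f mpoly) \<in> XM ss" using snoc by simp
  ultimately show ?case unfolding X_snoc by blast
qed (auto simp: seq_sum_def subseqs_of_Nil)

lemma X_lift: "f \<in> XM ss \<Longrightarrow> g \<in> XM ss \<Longrightarrow> lift ss s f g \<in> XM (ss @ [s])"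
  unfolding X_snoc by blast

text \<open>
  With \<open>k = \<langle>\<mu>, \<alpha>\<^sup>\<or>\<rangle>\<close>, the weight \<open>\<mu> - k/2 \<alpha>\<close> is fixed by \<open>s\<close>, so its operator commutes with the
  diagonal embedding.
\<close>

lemma X_c_op:
  fixes f :: "'v transf option list \<Rightarrow> 'f::field mpoly"
  assumes two: "(2::'f) \<noteq> 0" and "set ss \<subseteq> SR" "\<mu> \<in> AWt" "f \<in> XM ss"
  shows "c_op D bs \<mu> f \<in> XM ss"
  using assms(2-)
proof (induction ss arbitrary: f \<mu> rule: rev_induct)
  case Nil
  then show ?case by (auto simp: seq_sum_def subseqs_of_Nil c_op_def)
next
  case (snoc s ss)
  then have S: "set ss \<subseteq> SR" "s \<in> SR" by auto
  define \<alpha> where "\<alpha> = simple_root_of D s"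
  have \<alpha>: "\<alpha> \<in> AR" "\<alpha> \<in> AWt" "T \<alpha> = s"
    using S simple_root_of_AR AR_subset_AWt simple_root_of(2) by (auto simp: \<alpha>_def)
  obtain f1 f2 where f: "f1 \<in> XM ss" "f2 \<in> XM ss" "f = lift ss s f1 f2" using snoc.prems unfolding X_snoc by blast
  obtain k where k: "LR \<alpha> \<mu> = \<mu> - int_smul D k \<alpha>" using LR_int \<alpha> snoc.prems by blast
  define h where "h = mconst (of_int k / 2 :: 'f)"
  have hh: "mconst (of_int k) = h + h"
    using two by (simp add: h_def mconst_add[symmetric] field_simps)
  have h_S: "h \<in> sym_algebra bs" by (simp add: h_def)
  \<comment> \<open>The operator of \<open>\<mu> - (k/2) \<alpha>\<close>, written as a difference
    because this combination need not be an integral weight.\<close>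
  define cu where "cu = (\<lambda>g \<sigma>. c_op D bs \<mu> g \<sigma> - h * c_op D bs \<alpha> g \<sigma>)"
  have cu_X: "cu g \<in> XM ss" if "g \<in> XM ss" for g
    unfolding cu_def using that S snoc.prems \<alpha> h_S by (intro X_diff X_scale snoc.IH) auto
  \<comment> \<open>Split the operator of \<open>\<mu>\<close> as \<open>cu\<close> plus
    \<open>h\<close> times that of \<open>\<alpha>\<close>. Squaring the latter removes the sign
    caused by \<open>s\<close>, so the square commutes with the diagonal embedding and its term
    belongs to the first component.\<close>
  have "c_op D bs \<mu> f = lift ss s (\<lambda>\<sigma>. cu f1 \<sigma> + h * c_op D bs \<alpha> (c_op D bs \<alpha> f2) \<sigma>)
      (\<lambda>\<sigma>. cu f2 \<sigma> + h * f1 \<sigma>)"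
  proof (rule eq_liftI[OF S])
    fix \<tau> assume "\<tau> \<notin> subseqs_of (ss @ [s])"
    then show "c_op D bs \<mu> f \<tau> = 0" by (simp add: f c_op_def lift_out)
  next
    fix \<sigma> assume \<sigma>: "\<sigma> \<in> subseqs_of ss"
    then show "c_op D bs \<mu> f (\<sigma> @ [None]) =
        cu f1 \<sigma> + h * c_op D bs \<alpha> (c_op D bs \<alpha> f2) \<sigma> +
        br (act (ev D \<sigma>) (simple_root_of D s)) * (cu f2 \<sigma> + h * f1 \<sigma>)"
      using S by (simp add: f c_op_def lift_None ev_snoc cu_def \<alpha>_def algebra_simps)
    have w: "ev D \<sigma> \<in> carrier W" using ev_closed \<sigma> S by blast
    have "act (ev D \<sigma> \<otimes>\<^bsub>W\<^esub> s) \<mu> = act (ev D \<sigma>) \<mu> - int_smul D k (act (ev D \<sigma>) \<alpha>)"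
      using w \<alpha> by (simp add: \<alpha>(3)[symmetric] act_mult T_in_W act_T k act_diff int_smul_eq)
        (simp add: act_psmul del: fst_conv snd_conv)
    then have e: "br (act (ev D \<sigma> \<otimes>\<^bsub>W\<^esub> s) \<mu>) = br (act (ev D \<sigma>) \<mu>) - (h + h) * br (act (ev D \<sigma>) \<alpha>)"
      using w \<alpha> snoc.prems by (simp add: br_diff br_int_smul act_AWt AWt_int_smul hh)
    show "c_op D bs \<mu> f (\<sigma> @ [Some s]) =
        cu f1 \<sigma> + h * c_op D bs \<alpha> (c_op D bs \<alpha> f2) \<sigma> -
        br (act (ev D \<sigma>) (simple_root_of D s)) * (cu f2 \<sigma> + h * f1 \<sigma>)"
      using S \<sigma> by (simp add: f c_op_def lift_Some ev_snoc e cu_def \<alpha>_def algebra_simps)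
  qed
  moreover have "(\<lambda>\<sigma>. cu f1 \<sigma> + h * c_op D bs \<alpha> (c_op D bs \<alpha> f2) \<sigma>) \<in> XM ss"
    using f S \<alpha> h_S by (intro X_add X_scale cu_X snoc.IH) auto
  moreover have "(\<lambda>\<sigma>. cu f2 \<sigma> + h * f1 \<sigma>) \<in> XM ss"
    using f S h_S by (intro X_add X_scale cu_X) auto
  ultimately show ?case unfolding X_snoc by blast
qed

section \<open>Restriction to subsequences with a given evaluation\<close>

lemma subseqs_atD: "\<sigma> \<in> subseqs_at D ss x \<Longrightarrow> \<sigma> \<in> subseqs_of ss" "\<sigma> \<in> subseqs_at D ss x \<Longrightarrow> ev D \<sigma> = x"
  by (auto simp: subseqs_at_def)

lemma subseqs_at_snoc:
  assumes "set ss \<subseteq> SR" "s \<in> SR" "x \<in> carrier W"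
  shows "\<tau> \<in> subseqs_at D (ss @ [s]) x \<longleftrightarrow>
    (\<exists>\<sigma>\<in>subseqs_at D ss x. \<tau> = \<sigma> @ [None]) \<or> (\<exists>\<sigma>\<in>subseqs_at D ss (x \<otimes>\<^bsub>W\<^esub> s). \<tau> = \<sigma> @ [Some s])"
proof -
  have "w \<otimes>\<^bsub>W\<^esub> s = x \<longleftrightarrow> w = x \<otimes>\<^bsub>W\<^esub> s" if "w \<in> carrier W" for w
    using assms that SR_mult_cancel(2) by metis
  then show ?thesis
    using assms ev_snoc ev_closed unfolding subseqs_at_def subseqs_of_snoc
    by (smt (verit) mem_Collect_eq subseqs_of_snoc)
qed

text \<open>With \<open>\<mu>\<close> the preimage of \<open>\<gamma>\<close> under
  \<open>x\<close>, the operator of \<open>\<mu>\<close> multiplies by the label at \<open>x\<close>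
  and by its negative at the other end. Half its difference from multiplication by the label
  therefore changes an element at one end only.\<close>

lemma X_bump:
  fixes P :: "'v transf option list \<Rightarrow> 'f::field mpoly"
  assumes two: "(2::'f) \<noteq> 0" and S: "set ss \<subseteq> SR" and x: "x \<in> carrier W" and \<gamma>: "\<gamma> \<in> AR" and P: "P \<in> XM ss"
  shows "\<exists>Q\<in>XM ss. (\<forall>\<sigma>\<in>subseqs_at D ss x. Q \<sigma> = 0) \<and>
    (\<forall>\<sigma>\<in>subseqs_at D ss (T \<gamma> \<otimes>\<^bsub>W\<^esub> x). Q \<sigma> = br \<gamma> * P \<sigma>)"
proof -
  define \<mu> where "\<mu> = act (inv\<^bsub>W\<^esub> x) \<gamma>"
  have \<mu>: "\<mu> \<in> AWt" using x \<gamma> by (simp add: \<mu>_def act_root AR_subset_AWt)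
  have a: "act x \<mu> = \<gamma>" using x by (simp add: \<mu>_def act_inv')
  have b: "act (T \<gamma> \<otimes>\<^bsub>W\<^esub> x) \<mu> = - \<gamma>" using x \<gamma> by (simp add: act_mult T_in_W a act_T LR_self)
  define Q where "Q = (\<lambda>\<sigma>. mconst (1/2) * (br \<gamma> * P \<sigma> - c_op D bs \<mu> P \<sigma>))"
  have "Q \<in> XM ss"
    unfolding Q_def using S P \<mu> two by (intro X_scale X_diff X_c_op) auto
  moreover have "Q \<sigma> = 0" if "\<sigma> \<in> subseqs_at D ss x" for \<sigma>
    using subseqs_atD[OF that] by (simp add: Q_def c_op_def a)
  moreover have "Q \<sigma> = br \<gamma> * P \<sigma>" if "\<sigma> \<in> subseqs_at D ss (T \<gamma> \<otimes>\<^bsub>W\<^esub> x)" for \<sigma>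
  proof -
    have "Q \<sigma> = mconst (1/2) * (br \<gamma> * P \<sigma> + br \<gamma> * P \<sigma>)"
      using subseqs_atD[OF that] \<gamma> by (simp add: Q_def c_op_def b br_uminus AR_subset_AWt)
    also have "\<dots> = mconst (1/2 + 1/2) * (br \<gamma> * P \<sigma>)"
      unfolding mconst_add by (simp add: algebra_simps)
    also have "(1/2 + 1/2 :: 'f) = 1" using two by (simp add: field_simps)
    finally show ?thesis by simp
  qed
  ultimately show ?thesis by blast
qed

end

section \<open>Divisibility along edges\<close>

context root_datum_basis
begin

text \<open>The sign in \<open>lift_Some\<close> cancels against the sign of the root at
  \<open>x s\<close>, so one function \<open>F\<close> for the shorter sequence describes both ways
  of reaching \<open>x\<close>.\<close>

lemma lift_at:
  fixes f g :: "'v transf option list \<Rightarrow> 'f::field mpoly"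
  assumes "set ss \<subseteq> SR" "s \<in> SR" "x \<in> carrier W"
  defines "F \<equiv> \<lambda>\<sigma>. f \<sigma> + br (act x (simple_root_of D s)) * g \<sigma>"
  shows "\<sigma> \<in> subseqs_at D ss x \<Longrightarrow> lift ss s f g (\<sigma> @ [None]) = F \<sigma>"
    and "\<sigma> \<in> subseqs_at D ss (x \<otimes>\<^bsub>W\<^esub> s) \<Longrightarrow> lift ss s f g (\<sigma> @ [Some s]) = F \<sigma>"
  using assms by (auto simp: subseqs_at_def lift_None lift_Some br_act_mult_simple)

lemma ball_subseqs_at_snoc:
  assumes "set ss \<subseteq> SR" "s \<in> SR" "x \<in> carrier W"
  shows "(\<forall>\<tau>\<in>subseqs_at D (ss @ [s]) x. P \<tau>) \<longleftrightarrow>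
    (\<forall>\<sigma>\<in>subseqs_at D ss x. P (\<sigma> @ [None])) \<and> (\<forall>\<sigma>\<in>subseqs_at D ss (x \<otimes>\<^bsub>W\<^esub> s). P (\<sigma> @ [Some s]))"
  unfolding Ball_def subseqs_at_snoc[OF assms] by blast

lemma ev_set_snoc:
  assumes "set ss \<subseteq> SR" shows "ev_set D ss \<subseteq> ev_set D (ss @ [s])"
proof
  fix x assume "x \<in> ev_set D ss"
  then obtain \<sigma> where "\<sigma> \<in> subseqs_of ss" "x = ev D \<sigma>" by (auto simp: ev_set_def)
  moreover from this have "\<sigma> @ [None] \<in> subseqs_of (ss @ [s])" unfolding subseqs_of_snoc by blast
  ultimately show "x \<in> ev_set D (ss @ [s])"
    using ev_snoc(1)[of \<sigma> ss] assms unfolding ev_set_def by (metis image_eqI)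
qed

lemma subseqs_at_nonempty: "subseqs_at D ss x \<noteq> {} \<longleftrightarrow> x \<in> ev_set D ss"
  by (auto simp: subseqs_at_def ev_set_def)

text \<open>Picks the lower end \<open>u\<close> of the edge joining \<open>x\<close> and
  \<open>x s\<close>. Later arguments settle \<open>u\<close> first and then correct at
  \<open>u s\<close>.\<close>

lemma simple_edge:
  assumes x: "x \<in> carrier W" and s: "s \<in> SR"
  obtains u where "u \<in> carrier W" "act u (simple_root_of D s) \<in> AP"
    "u = x \<and> u \<otimes>\<^bsub>W\<^esub> s = x \<otimes>\<^bsub>W\<^esub> s \<or> u = x \<otimes>\<^bsub>W\<^esub> s \<and> u \<otimes>\<^bsub>W\<^esub> s = x"
proof (cases "act x (simple_root_of D s) \<in> AP")
  case True
  then show ?thesis using that x by blast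
next
  case False
  then have "act (x \<otimes>\<^bsub>W\<^esub> s) (simple_root_of D s) \<in> AP"
    using AR_pos_or_neg[OF act_root[OF x simple_root_of_AR[OF s]]] by (simp add: act_mult_simple x s)
  then show ?thesis using that x s SR_in_W SR_mult_cancel(2) by (metis W.m_closed)
qed

lemma T_act_simple:
  "u \<in> carrier W \<Longrightarrow> s \<in> SR \<Longrightarrow> T (act u (simple_root_of D s)) \<otimes>\<^bsub>W\<^esub> u = u \<otimes>\<^bsub>W\<^esub> s"
  using T_act[of u "simple_root_of D s"] simple_root_of(2) simple_root_of_AR by simp

section \<open>The two divisibility properties\<close>

text \<open>The edge condition is in the form given by \<open>moment_graph_iff\<close>. All edges
  are covered because the induction passes from \<open>y\<close> to \<open>y s\<close>; the type
  argument fixes the coefficient field.\<close>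

definition edge_div :: "'f::field itself \<Rightarrow> 'v transf list \<Rightarrow> bool" where
  "edge_div _ ss \<longleftrightarrow> (\<forall>\<gamma>\<in>AP. \<forall>y\<in>carrier W. \<forall>f\<in>XM ss. act (inv\<^bsub>W\<^esub> y) \<gamma> \<in> AP \<longrightarrow>
     (\<forall>\<sigma>\<in>subseqs_at D ss y. f \<sigma> = 0) \<longrightarrow>
     (\<exists>g\<in>XM ss. \<forall>\<sigma>\<in>subseqs_at D ss (T \<gamma> \<otimes>\<^bsub>W\<^esub> y). f \<sigma> = (br \<gamma> :: 'f mpoly) * g \<sigma>))"

text \<open>Each entry separately is divisible by \<open>lin_form_coprime\<close>; the content is
  that the quotients at \<open>x\<close> come from one element of the module.\<close>

definition coprime_div :: "'f::field itself \<Rightarrow> 'v transf list \<Rightarrow> bool" where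
  "coprime_div _ ss \<longleftrightarrow> (\<forall>x\<in>carrier W. \<forall>a b. \<forall>P\<in>XM ss. \<forall>Q\<in>XM ss.
     \<not> proportional (lin_form (length bs) a) (lin_form (length bs) b) \<longrightarrow>
     (\<forall>\<sigma>\<in>subseqs_at D ss x. (lin_form (length bs) a :: 'f mpoly) * P \<sigma> = lin_form (length bs) b * Q \<sigma>) \<longrightarrow>
     (\<exists>R\<in>XM ss. \<forall>\<sigma>\<in>subseqs_at D ss x. P \<sigma> = lin_form (length bs) b * R \<sigma>))"

lemma edge_divD:
  fixes f :: "'v transf option list \<Rightarrow> 'f::field mpoly"
  assumes "edge_div TYPE('f) ss" "\<gamma> \<in> AP" "y \<in> carrier W" "act (inv\<^bsub>W\<^esub> y) \<gamma> \<in> AP" "f \<in> XM ss"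
    "\<And>\<sigma>. \<sigma> \<in> subseqs_at D ss y \<Longrightarrow> f \<sigma> = 0"
  obtains g where "g \<in> XM ss" "\<And>\<sigma>. \<sigma> \<in> subseqs_at D ss (T \<gamma> \<otimes>\<^bsub>W\<^esub> y) \<Longrightarrow> f \<sigma> = br \<gamma> * g \<sigma>"
  using assms unfolding edge_div_def by blast

lemma coprime_divD:
  fixes P :: "'v transf option list \<Rightarrow> 'f::field mpoly"
  assumes "coprime_div TYPE('f) ss" "x \<in> carrier W" "P \<in> XM ss" "Q \<in> XM ss"
    "\<not> proportional (lin_form (length bs) a) (lin_form (length bs) b)"
    "\<And>\<sigma>. \<sigma> \<in> subseqs_at D ss x \<Longrightarrow> lin_form (length bs) a * P \<sigma> = lin_form (length bs) b * Q \<sigma>"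
  obtains R where "R \<in> XM ss" "\<And>\<sigma>. \<sigma> \<in> subseqs_at D ss x \<Longrightarrow> P \<sigma> = lin_form (length bs) b * R \<sigma>"
  using assms unfolding coprime_div_def by blast

lemma simple_edge_divD:
  fixes f :: "'v transf option list \<Rightarrow> 'f::field mpoly"
  assumes "edge_div TYPE('f) ss" "s \<in> SR" "u \<in> carrier W" "act u (simple_root_of D s) \<in> AP" "f \<in> XM ss"
    "\<And>\<sigma>. \<sigma> \<in> subseqs_at D ss u \<Longrightarrow> f \<sigma> = 0"
  obtains g where "g \<in> XM ss"
    "\<And>\<sigma>. \<sigma> \<in> subseqs_at D ss (u \<otimes>\<^bsub>W\<^esub> s) \<Longrightarrow> f \<sigma> = br (act u (simple_root_of D s)) * g \<sigma>"
proof -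
  have "act (inv\<^bsub>W\<^esub> u) (act u (simple_root_of D s)) \<in> AP"
    using assms(2,3) by (simp add: act_inv AS_subset_AP simple_root_of)
  from edge_divD[OF assms(1,4,3) this assms(5,6)] that show ?thesis
    using T_act_simple[OF assms(3,2)] by metis
qed

lemma simple_bump:
  fixes P :: "'v transf option list \<Rightarrow> 'f::field mpoly"
  assumes "(2::'f) \<noteq> 0" "set ss \<subseteq> SR" "s \<in> SR" "u \<in> carrier W" "P \<in> XM ss"
  obtains Q where "Q \<in> XM ss" "\<And>\<sigma>. \<sigma> \<in> subseqs_at D ss u \<Longrightarrow> Q \<sigma> = 0"
    "\<And>\<sigma>. \<sigma> \<in> subseqs_at D ss (u \<otimes>\<^bsub>W\<^esub> s) \<Longrightarrow> Q \<sigma> = br (act u (simple_root_of D s)) * P \<sigma>"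
  using X_bump[OF assms(1,2,4) act_root[OF assms(4) simple_root_of_AR[OF assms(3)]] assms(5)]
    T_act_simple[OF assms(4,3)] that by metis

text \<open>The upper end of an edge is never the unit, so the empty sequence has no subsequence
  there.\<close>

lemma edge_div_Nil: "edge_div TYPE('f::field) []"
  unfolding edge_div_def
proof (intro ballI impI)
  fix \<gamma> y and f :: "'v transf option list \<Rightarrow> 'f mpoly"
  assume h: "\<gamma> \<in> AP" "y \<in> carrier W" "f \<in> XM []" "act (inv\<^bsub>W\<^esub> y) \<gamma> \<in> AP"
  have "T \<gamma> \<otimes>\<^bsub>W\<^esub> y \<noteq> \<one>\<^bsub>W\<^esub>"
  proof
    assume "T \<gamma> \<otimes>\<^bsub>W\<^esub> y = \<one>\<^bsub>W\<^esub>"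
    then have "act (inv\<^bsub>W\<^esub> \<one>\<^bsub>W\<^esub>) \<gamma> = - act (inv\<^bsub>W\<^esub> y) \<gamma>"
      using inv_T_mult[of y \<gamma>] h by (simp add: AP_iff)
    then show False using h AP_not_neg[of "act (inv\<^bsub>W\<^esub> y) \<gamma>"] by (simp add: act_one)
  qed
  then have "subseqs_at D [] (T \<gamma> \<otimes>\<^bsub>W\<^esub> y) = {}"
    by (auto simp: subseqs_at_def subseqs_of_Nil ev_simps)
  then show "\<exists>g\<in>XM []. \<forall>\<sigma>\<in>subseqs_at D [] (T \<gamma> \<otimes>\<^bsub>W\<^esub> y). f \<sigma> = (br \<gamma> :: 'f mpoly) * g \<sigma>"
    using h(3) by blast
qed

lemma coprime_div_Nil: "coprime_div TYPE('f::field) []"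
  unfolding coprime_div_def
proof (intro ballI allI impI)
  fix x a b and P Q :: "'v transf option list \<Rightarrow> 'f mpoly"
  assume h: "P \<in> XM []" "Q \<in> XM []"
    "\<not> proportional (lin_form (length bs) a) (lin_form (length bs) b :: 'f mpoly)"
    "\<forall>\<sigma>\<in>subseqs_at D [] x. lin_form (length bs) a * P \<sigma> = lin_form (length bs) b * Q \<sigma>"
  show "\<exists>R\<in>XM []. \<forall>\<sigma>\<in>subseqs_at D [] x. P \<sigma> = lin_form (length bs) b * R \<sigma>"
  proof (cases "[] \<in> subseqs_at D [] x")
    case True
    then have "lin_form (length bs) a * P [] = lin_form (length bs) b * Q []" using h by blast
    then obtain r where "r \<in> sym_algebra bs" "P [] = lin_form (length bs) b * r"
      using lin_form_coprime[OF h(3)] h(1) unfolding X_Nil by blast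
    then show ?thesis
      by (intro bexI[of _ "\<lambda>\<sigma>. if \<sigma> = [] then r else 0"])
         (auto simp: subseqs_at_def subseqs_of_Nil seq_sum_def)
  next
    case False
    then have "subseqs_at D [] x = {}" by (auto simp: subseqs_at_def subseqs_of_Nil)
    then show ?thesis using h(1) by blast
  qed
qed

text \<open>Pass to \<open>P1\<close> and \<open>Q1\<close> for the shorter sequence. Dividing at
  the lower end \<open>u\<close> and subtracting leaves elements that vanish at \<open>u\<close>,
  hence are multiples of the label \<open>d\<close> at \<open>u s\<close>. After cancelling
  \<open>d\<close>, divide again at \<open>u s\<close>; \<open>simple_bump\<close> puts
  \<open>d\<close> back without disturbing \<open>u\<close>.\<close>

lemma coprime_div_snoc:
  assumes two: "(2::'f::field) \<noteq> 0" and S: "set ss \<subseteq> SR" and s: "s \<in> SR"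
    and ed: "edge_div TYPE('f) ss" and cd: "coprime_div TYPE('f) ss"
  shows "coprime_div TYPE('f) (ss @ [s])"
  unfolding coprime_div_def
proof (intro ballI allI impI)
  fix x a b and P Q :: "'v transf option list \<Rightarrow> 'f mpoly"
  let ?a = "lin_form (length bs) a :: 'f mpoly" and ?b = "lin_form (length bs) b :: 'f mpoly"
  assume x: "x \<in> carrier W" and P: "P \<in> XM (ss @ [s])" and Q: "Q \<in> XM (ss @ [s])"
    and np: "\<not> proportional ?a ?b"
    and eq: "\<forall>\<sigma>\<in>subseqs_at D (ss @ [s]) x. ?a * P \<sigma> = ?b * Q \<sigma>"
  define Iat where "Iat = subseqs_at D ss"
  obtain f g where fg: "f \<in> XM ss" "g \<in> XM ss" "P = lift ss s f g" using P unfolding X_snoc by blast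
  obtain f' g' where fg': "f' \<in> XM ss" "g' \<in> XM ss" "Q = lift ss s f' g'" using Q unfolding X_snoc by blast
  define P1 where "P1 = (\<lambda>\<sigma>. f \<sigma> + br (act x (simple_root_of D s)) * g \<sigma>)"
  define Q1 where "Q1 = (\<lambda>\<sigma>. f' \<sigma> + br (act x (simple_root_of D s)) * g' \<sigma>)"
  have X1: "P1 \<in> XM ss" "Q1 \<in> XM ss"
    unfolding P1_def Q1_def using fg fg' S by (intro X_add X_scale; simp)+
  have P1: "P (\<sigma> @ [None]) = P1 \<sigma>" if "\<sigma> \<in> Iat x" for \<sigma>
    using lift_at(1)[OF S s x] that by (simp add: fg P1_def Iat_def)
  have P1': "P (\<sigma> @ [Some s]) = P1 \<sigma>" if "\<sigma> \<in> Iat (x \<otimes>\<^bsub>W\<^esub> s)" for \<sigma>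
    using lift_at(2)[OF S s x] that by (simp add: fg P1_def Iat_def)
  have Q1: "Q (\<sigma> @ [None]) = Q1 \<sigma>" if "\<sigma> \<in> Iat x" for \<sigma>
    using lift_at(1)[OF S s x] that by (simp add: fg' Q1_def Iat_def)
  have Q1': "Q (\<sigma> @ [Some s]) = Q1 \<sigma>" if "\<sigma> \<in> Iat (x \<otimes>\<^bsub>W\<^esub> s)" for \<sigma>
    using lift_at(2)[OF S s x] that by (simp add: fg' Q1_def Iat_def)
  have eq1: "?a * P1 \<sigma> = ?b * Q1 \<sigma>" if "\<sigma> \<in> Iat x \<union> Iat (x \<otimes>\<^bsub>W\<^esub> s)" for \<sigma>
    using that eq P1 P1' Q1 Q1' unfolding ball_subseqs_at_snoc[OF S s x] Iat_def by fastforce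
  obtain u where u: "u \<in> carrier W" "act u (simple_root_of D s) \<in> AP"
    "u = x \<and> u \<otimes>\<^bsub>W\<^esub> s = x \<otimes>\<^bsub>W\<^esub> s \<or> u = x \<otimes>\<^bsub>W\<^esub> s \<and> u \<otimes>\<^bsub>W\<^esub> s = x"
    using simple_edge[OF x s] by blast
  define d where "d = (br (act u (simple_root_of D s)) :: 'f mpoly)"
  have union: "Iat x \<union> Iat (x \<otimes>\<^bsub>W\<^esub> s) = Iat u \<union> Iat (u \<otimes>\<^bsub>W\<^esub> s)" using u(3) by auto
  have b_nz: "?b \<noteq> 0"
  proof
    assume "?b = 0"
    then have "?b = mconst 0 * ?a" by simp
    then show False using np unfolding proportional_def by blast
  qed
  have ab_S: "?a \<in> sym_algebra bs" "?b \<in> sym_algebra bs" by simp_all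
  have eq1_u: "?a * P1 \<sigma> = ?b * Q1 \<sigma>" if "\<sigma> \<in> Iat u" for \<sigma>
    using eq1[of \<sigma>] that unfolding union by blast
  obtain R1 where R1: "R1 \<in> XM ss" "\<And>\<sigma>. \<sigma> \<in> Iat u \<Longrightarrow> P1 \<sigma> = ?b * R1 \<sigma>"
    using coprime_divD[OF cd u(1) X1 np] eq1_u unfolding Iat_def by blast
  define P2 where "P2 = (\<lambda>\<sigma>. P1 \<sigma> - ?b * R1 \<sigma>)"
  define Q2 where "Q2 = (\<lambda>\<sigma>. Q1 \<sigma> - ?a * R1 \<sigma>)"
  have X2: "P2 \<in> XM ss" "Q2 \<in> XM ss"
    unfolding P2_def Q2_def using X1 R1 S by (intro X_diff X_scale; simp)+
  have eq2: "?a * P2 \<sigma> = ?b * Q2 \<sigma>" if "\<sigma> \<in> Iat u \<union> Iat (u \<otimes>\<^bsub>W\<^esub> s)" for \<sigma>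
    using eq1[of \<sigma>] that unfolding union by (simp add: P2_def Q2_def algebra_simps)
  have P2_0: "P2 \<sigma> = 0" if "\<sigma> \<in> Iat u" for \<sigma>
    using R1(2) that by (simp add: P2_def)
  \<comment> \<open>At \<open>u\<close> the equation reads \<open>?b * Q2 \<sigma> = 0\<close>, and
    polynomials form a domain.\<close>
  have Q2_0: "Q2 \<sigma> = 0" if "\<sigma> \<in> Iat u" for \<sigma>
    using eq2[of \<sigma>] P2_0[OF that] that b_nz by simp
  obtain P3 where P3: "P3 \<in> XM ss" "\<And>\<sigma>. \<sigma> \<in> Iat (u \<otimes>\<^bsub>W\<^esub> s) \<Longrightarrow> P2 \<sigma> = d * P3 \<sigma>"
    using simple_edge_divD[OF ed s u(1,2) X2(1)] P2_0 unfolding Iat_def d_def by blast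
  obtain Q3 where Q3: "Q3 \<in> XM ss" "\<And>\<sigma>. \<sigma> \<in> Iat (u \<otimes>\<^bsub>W\<^esub> s) \<Longrightarrow> Q2 \<sigma> = d * Q3 \<sigma>"
    using simple_edge_divD[OF ed s u(1,2) X2(2)] Q2_0 unfolding Iat_def d_def by blast
  have us: "u \<otimes>\<^bsub>W\<^esub> s \<in> carrier W" using u s SR_in_W by blast
  \<comment> \<open>The label \<open>d\<close> may vanish over the field. It cannot be cancelled
    then, but both sides are zero and any element will do.\<close>
  have "\<exists>R3\<in>XM ss. \<forall>\<sigma>\<in>Iat (u \<otimes>\<^bsub>W\<^esub> s). d * P3 \<sigma> = d * (?b * R3 \<sigma>)"
  proof (cases "d = 0")
    case False
    have "?a * P3 \<sigma> = ?b * Q3 \<sigma>" if "\<sigma> \<in> Iat (u \<otimes>\<^bsub>W\<^esub> s)" for \<sigma>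
    proof -
      have "d * (?a * P3 \<sigma>) = d * (?b * Q3 \<sigma>)"
        using eq2[of \<sigma>] that P3(2) Q3(2) by (simp add: algebra_simps)
      then show ?thesis using False by simp
    qed
    then obtain R3 where "R3 \<in> XM ss" "\<And>\<sigma>. \<sigma> \<in> Iat (u \<otimes>\<^bsub>W\<^esub> s) \<Longrightarrow> P3 \<sigma> = ?b * R3 \<sigma>"
      using coprime_divD[OF cd us P3(1) Q3(1) np] unfolding Iat_def by blast
    then show ?thesis by auto
  qed (use R1 in auto)
  then obtain R3 where R3: "R3 \<in> XM ss" "\<And>\<sigma>. \<sigma> \<in> Iat (u \<otimes>\<^bsub>W\<^esub> s) \<Longrightarrow> d * P3 \<sigma> = d * (?b * R3 \<sigma>)"
    by blast
  obtain E where E: "E \<in> XM ss" "\<And>\<sigma>. \<sigma> \<in> Iat u \<Longrightarrow> E \<sigma> = 0"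
    "\<And>\<sigma>. \<sigma> \<in> Iat (u \<otimes>\<^bsub>W\<^esub> s) \<Longrightarrow> E \<sigma> = d * R3 \<sigma>"
    using simple_bump[OF two S s u(1) R3(1)] unfolding Iat_def d_def by blast
  define R where "R = (\<lambda>\<sigma>. R1 \<sigma> + E \<sigma>)"
  have R_X: "R \<in> XM ss" unfolding R_def using S R1(1) E(1) by (rule X_add)
  have R: "P1 \<sigma> = ?b * R \<sigma>" if "\<sigma> \<in> Iat x \<union> Iat (x \<otimes>\<^bsub>W\<^esub> s)" for \<sigma>
    using that unfolding union
  proof
    assume "\<sigma> \<in> Iat u"
    then show ?thesis using R1(2) E(2) by (simp add: R_def)
  next
    assume \<sigma>: "\<sigma> \<in> Iat (u \<otimes>\<^bsub>W\<^esub> s)"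
    have "P1 \<sigma> = ?b * R1 \<sigma> + P2 \<sigma>" by (simp add: P2_def)
    also have "P2 \<sigma> = ?b * E \<sigma>" using \<sigma> P3(2) R3(2) E(3) by (simp add: algebra_simps)
    finally show ?thesis by (simp add: R_def algebra_simps)
  qed
  have z: "(\<lambda>\<sigma>. 0) \<in> XM ss" by (rule X_zero[OF S])
  \<comment> \<open>The quotient needs a diagonal part only: it restricts to \<open>R\<close> at
    \<open>x\<close> and at \<open>x s\<close> alike.\<close>
  have L: "lift ss s R (\<lambda>\<sigma>. 0) \<in> XM (ss @ [s])" by (rule X_lift[OF R_X z])
  show "\<exists>R\<in>XM (ss @ [s]). \<forall>\<sigma>\<in>subseqs_at D (ss @ [s]) x. P \<sigma> = ?b * R \<sigma>"
  proof (rule bexI[OF _ L], unfold ball_subseqs_at_snoc[OF S s x], intro conjI ballI)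
    fix \<sigma> assume "\<sigma> \<in> subseqs_at D ss x"
    then show "P (\<sigma> @ [None]) = ?b * lift ss s R (\<lambda>\<sigma>. 0) (\<sigma> @ [None])"
      using P1 R lift_at(1)[OF S s x, of \<sigma> R "\<lambda>\<sigma>. 0"] by (simp add: Iat_def)
  next
    fix \<sigma> assume "\<sigma> \<in> subseqs_at D ss (x \<otimes>\<^bsub>W\<^esub> s)"
    then show "P (\<sigma> @ [Some s]) = ?b * lift ss s R (\<lambda>\<sigma>. 0) (\<sigma> @ [Some s])"
      using P1' R lift_at(2)[OF S s x, of \<sigma> R "\<lambda>\<sigma>. 0"] by (simp add: Iat_def)
  qed
qed

section \<open>Gluing quotients and the inductive step for edges\<close>

lemma GKM_not_proportional:
  assumes "GKM (full_subgraph (moment_graph D bs :: ('v transf \<times> 'v transf \<times> 'f::field mpoly) set) \<Omega>)"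
    and "(y, v, a) \<in> moment_graph D bs" "(u, v, b) \<in> moment_graph D bs"
    and "y \<noteq> u" "y \<in> \<Omega>" "u \<in> \<Omega>" "v \<in> \<Omega>"
  shows "\<not> proportional a (b :: 'f mpoly)"
proof -
  have "(y, v, a) \<in> full_subgraph (moment_graph D bs) \<Omega>" "(u, v, b) \<in> full_subgraph (moment_graph D bs) \<Omega>"
    using assms by (auto simp: full_subgraph_def)
  then show ?thesis using assms(1,4) unfolding GKM_def by fastforce
qed

text \<open>At \<open>v = u s\<close> the difference \<open>F - \<gamma> G1\<close> is a multiple of
  the label \<open>\<beta>\<close>, because it vanishes at \<open>u\<close>; hence so is
  \<open>\<gamma> (G2 - G1)\<close>. The edges from \<open>y\<close> and \<open>u\<close> to
  \<open>v\<close> are distinct, so the labels are not proportional and \<open>G2 - G1\<close>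
  itself is \<open>\<beta> R\<close> at \<open>v\<close>. A bump of \<open>G1\<close> by this amount
  agrees with both quotients.\<close>

lemma glue:
  fixes F :: "'v transf option list \<Rightarrow> 'f::field mpoly"
  assumes two: "(2::'f::field) \<noteq> 0" and S: "set ss \<subseteq> SR" and s: "s \<in> SR"
    and ed: "edge_div TYPE('f) ss" and cd: "coprime_div TYPE('f) ss"
    and gkm: "GKM (full_subgraph (moment_graph D bs :: ('v transf \<times> 'v transf \<times> 'f mpoly) set) (ev_set D ss))"
    and u: "u \<in> carrier W" "act u (simple_root_of D s) \<in> AP"
    and y: "y \<in> carrier W" "\<gamma> \<in> AP" "act (inv\<^bsub>W\<^esub> y) \<gamma> \<in> AP" "T \<gamma> \<otimes>\<^bsub>W\<^esub> y = u \<otimes>\<^bsub>W\<^esub> s" "y \<noteq> u"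
    and X: "F \<in> XM ss" "G1 \<in> XM ss" "G2 \<in> XM ss"
    and F1: "\<And>\<sigma>. \<sigma> \<in> subseqs_at D ss u \<Longrightarrow> F \<sigma> = br \<gamma> * G1 \<sigma>"
    and F2: "\<And>\<sigma>. \<sigma> \<in> subseqs_at D ss (u \<otimes>\<^bsub>W\<^esub> s) \<Longrightarrow> F \<sigma> = br \<gamma> * G2 \<sigma>"
  shows "\<exists>G\<in>XM ss. \<forall>\<sigma>\<in>subseqs_at D ss u \<union> subseqs_at D ss (u \<otimes>\<^bsub>W\<^esub> s). F \<sigma> = br \<gamma> * G \<sigma>"
proof (cases "u \<otimes>\<^bsub>W\<^esub> s \<in> ev_set D ss")
  case False
  then have "subseqs_at D ss (u \<otimes>\<^bsub>W\<^esub> s) = {}" using subseqs_at_nonempty by blast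
  then show ?thesis using F1 X(2) by blast
next
  case True
  define \<beta> where "\<beta> = act u (simple_root_of D s)"
  define Iat where "Iat = subseqs_at D ss"
  define v where "v = u \<otimes>\<^bsub>W\<^esub> s"
  have \<beta>: "\<beta> \<in> AP" "T \<beta> \<otimes>\<^bsub>W\<^esub> u = v" "act (inv\<^bsub>W\<^esub> u) \<beta> \<in> AP"
    using u s by (simp_all add: \<beta>_def v_def T_act_simple act_inv simple_root_of AS_subset_AP)
  have v: "v \<in> carrier W" using u s SR_in_W by (simp add: v_def)
  have AR: "\<beta> \<in> AR" "\<gamma> \<in> AR" using \<beta>(1) y(2) by (simp_all add: AP_iff)
  have edges: "(y, v, br \<gamma>) \<in> moment_graph D bs" "(u, v, br \<beta>) \<in> moment_graph D bs"
    unfolding moment_graph_iff using y u \<beta> by (auto simp: v_def)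
  have "u \<in> ev_set D ss"
  proof -
    have "act (inv\<^bsub>W\<^esub> v) \<beta> \<notin> AP"
      using inv_T_mult[OF u(1) AR(1)] \<beta> AP_not_neg by simp
    moreover have "T \<beta> \<otimes>\<^bsub>W\<^esub> v = u" unfolding \<beta>(2)[symmetric] by (rule T_mult_cancel[OF AR(1) u(1)])
    ultimately show ?thesis using ev_set_exchange[of v ss \<beta>] True S \<beta>(1) by (simp add: v_def)
  qed
  moreover have "y \<in> ev_set D ss"
  proof -
    have eq: "T \<gamma> \<otimes>\<^bsub>W\<^esub> y = v" using y(4) by (simp add: v_def)
    have "act (inv\<^bsub>W\<^esub> v) \<gamma> \<notin> AP"
      using inv_T_mult[OF y(1) AR(2)] y(3) AP_not_neg eq by simp
    moreover have "T \<gamma> \<otimes>\<^bsub>W\<^esub> v = y" unfolding eq[symmetric] by (rule T_mult_cancel[OF AR(2) y(1)])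
    ultimately show ?thesis using ev_set_exchange[of v ss \<gamma>] True S y(2) by (simp add: v_def)
  qed
  ultimately have np: "\<not> proportional (br \<gamma>) (br \<beta> :: 'f mpoly)"
    using GKM_not_proportional[OF gkm edges(1) edges(2) y(5)] True by (simp add: v_def)
  define F' where "F' = (\<lambda>\<sigma>. F \<sigma> - br \<gamma> * G1 \<sigma>)"
  have X': "F' \<in> XM ss" unfolding F'_def using S X by (intro X_diff X_scale) auto
  obtain P where P: "P \<in> XM ss" "\<And>\<sigma>. \<sigma> \<in> Iat v \<Longrightarrow> F' \<sigma> = br \<beta> * P \<sigma>"
    using simple_edge_divD[OF ed s u X'] F1 unfolding Iat_def v_def \<beta>_def F'_def by (metis right_minus_eq)
  define H where "H = (\<lambda>\<sigma>. G2 \<sigma> - G1 \<sigma>)"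
  have H: "H \<in> XM ss" unfolding H_def using S X by (intro X_diff) auto
  have H_eq: "br \<gamma> * H \<sigma> = br \<beta> * P \<sigma>" if "\<sigma> \<in> Iat v" for \<sigma>
    using P(2)[OF that] F2 that by (simp add: F'_def H_def Iat_def v_def algebra_simps)
  obtain R where R: "R \<in> XM ss" "\<And>\<sigma>. \<sigma> \<in> Iat v \<Longrightarrow> H \<sigma> = br \<beta> * R \<sigma>"
    using coprime_divD[OF cd v H P(1) np[unfolded br_lin_form]] H_eq
    unfolding Iat_def br_lin_form by blast
  obtain Q where Q: "Q \<in> XM ss" "\<And>\<sigma>. \<sigma> \<in> Iat u \<Longrightarrow> Q \<sigma> = 0" "\<And>\<sigma>. \<sigma> \<in> Iat v \<Longrightarrow> Q \<sigma> = br \<beta> * R \<sigma>"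
    using simple_bump[OF two S s u(1) R(1)] unfolding Iat_def v_def \<beta>_def by blast
  have "(\<lambda>\<sigma>. G1 \<sigma> + Q \<sigma>) \<in> XM ss" using S X(2) Q(1) by (rule X_add)
  moreover have "F \<sigma> = br \<gamma> * (G1 \<sigma> + Q \<sigma>)" if "\<sigma> \<in> Iat u" for \<sigma>
    using that F1 Q(2) by (simp add: Iat_def)
  moreover have "F \<sigma> = br \<gamma> * (G1 \<sigma> + Q \<sigma>)" if "\<sigma> \<in> Iat v" for \<sigma>
    using F2 R(2)[OF that] Q(3)[OF that] that by (simp add: Iat_def v_def H_def algebra_simps)
  ultimately show ?thesis
    unfolding Iat_def v_def by (intro bexI[of _ "\<lambda>\<sigma>. G1 \<sigma> + Q \<sigma>"]) auto
qed

lemma edge_div_snoc: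
  assumes two: "(2::'f::field) \<noteq> 0" and S: "set ss \<subseteq> SR" and s: "s \<in> SR"
    and ed: "edge_div TYPE('f) ss" and cd: "coprime_div TYPE('f) ss"
    and gkm: "GKM (full_subgraph (moment_graph D bs :: ('v transf \<times> 'v transf \<times> 'f mpoly) set) (ev_set D ss))"
  shows "edge_div TYPE('f) (ss @ [s])"
  unfolding edge_div_def
proof (intro ballI impI)
  fix \<gamma> y and h :: "'v transf option list \<Rightarrow> 'f mpoly"
  assume \<gamma>: "\<gamma> \<in> AP" and y: "y \<in> carrier W" and h: "h \<in> XM (ss @ [s])"
    and pos: "act (inv\<^bsub>W\<^esub> y) \<gamma> \<in> AP" and h0: "\<forall>\<sigma>\<in>subseqs_at D (ss @ [s]) y. h \<sigma> = 0"
  define x where "x = T \<gamma> \<otimes>\<^bsub>W\<^esub> y"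
  define \<alpha> where "\<alpha> = simple_root_of D s"
  have \<alpha>: "\<alpha> \<in> AR" "\<alpha> \<in> AP" "\<alpha> \<in> AS" "T \<alpha> = s"
    using s simple_root_of simple_root_of_AR AS_subset_AP by (auto simp: \<alpha>_def)
  have \<gamma>AR: "\<gamma> \<in> AR" using \<gamma> by (simp add: AP_iff)
  have sW: "s \<in> carrier W" using s SR_in_W by blast
  have x: "x \<in> carrier W" using y \<gamma>AR by (simp add: x_def T_in_W)
  obtain f g where fg: "f \<in> XM ss" "g \<in> XM ss" "h = lift ss s f g" using h unfolding X_snoc by blast
  \<comment> \<open>The coefficient belongs to \<open>y\<close>, so that \<open>F\<close> vanishes
    at \<open>y\<close> and \<open>y s\<close>. The restriction of \<open>h\<close> to
    \<open>x\<close> involves the coefficient at \<open>x\<close> instead, which is reconciled at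
    the end of each case.\<close>
  define a where "a = (br (act y \<alpha>) :: 'f mpoly)"
  have a_S: "a \<in> sym_algebra bs" by (simp add: a_def)
  define F where "F = (\<lambda>\<sigma>. f \<sigma> + a * g \<sigma>)"
  have F_X: "F \<in> XM ss" unfolding F_def using fg S a_S by (intro X_add X_scale) auto
  have F0: "F \<sigma> = 0" if "\<sigma> \<in> subseqs_at D ss y" for \<sigma>
  proof -
    have "lift ss s f g (\<sigma> @ [None]) = 0"
      using h0 that unfolding ball_subseqs_at_snoc[OF S s y] fg(3) by blast
    then show ?thesis using lift_at(1)[OF S s y that, of f g] by (simp add: F_def a_def \<alpha>_def)
  qed
  have F0': "F \<sigma> = 0" if "\<sigma> \<in> subseqs_at D ss (y \<otimes>\<^bsub>W\<^esub> s)" for \<sigma>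
  proof -
    have "lift ss s f g (\<sigma> @ [Some s]) = 0"
      using h0 that unfolding ball_subseqs_at_snoc[OF S s y] fg(3) by blast
    then show ?thesis using lift_at(2)[OF S s y that, of f g] by (simp add: F_def a_def \<alpha>_def)
  qed
  have reduce: "\<exists>H\<in>XM (ss @ [s]). \<forall>\<sigma>\<in>subseqs_at D (ss @ [s]) x. h \<sigma> = br \<gamma> * H \<sigma>"
    if G: "G \<in> XM ss"
      "\<And>\<sigma>. \<sigma> \<in> subseqs_at D ss x \<union> subseqs_at D ss (x \<otimes>\<^bsub>W\<^esub> s) \<Longrightarrow> f \<sigma> + br (act x \<alpha>) * g \<sigma> = br \<gamma> * G \<sigma>" for G
  proof -
    have L: "lift ss s G (\<lambda>\<sigma>. 0) \<in> XM (ss @ [s])" by (rule X_lift[OF G(1) X_zero[OF S]])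
    show ?thesis
    proof (rule bexI[OF _ L], unfold ball_subseqs_at_snoc[OF S s x], intro conjI ballI)
      fix \<sigma> assume "\<sigma> \<in> subseqs_at D ss x"
      then show "h (\<sigma> @ [None]) = br \<gamma> * lift ss s G (\<lambda>\<sigma>. 0) (\<sigma> @ [None])"
        using G(2)[of \<sigma>] lift_at(1)[OF S s x, of \<sigma> f g] lift_at(1)[OF S s x, of \<sigma> G "\<lambda>\<sigma>. 0"]
        by (simp add: fg(3) \<alpha>_def)
    next
      fix \<sigma> assume "\<sigma> \<in> subseqs_at D ss (x \<otimes>\<^bsub>W\<^esub> s)"
      then show "h (\<sigma> @ [Some s]) = br \<gamma> * lift ss s G (\<lambda>\<sigma>. 0) (\<sigma> @ [Some s])"
        using G(2)[of \<sigma>] lift_at(2)[OF S s x, of \<sigma> f g] lift_at(2)[OF S s x, of \<sigma> G "\<lambda>\<sigma>. 0"]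
        by (simp add: fg(3) \<alpha>_def)
    qed
  qed
  have "\<exists>H\<in>XM (ss @ [s]). \<forall>\<sigma>\<in>subseqs_at D (ss @ [s]) x. h \<sigma> = br \<gamma> * H \<sigma>"
  proof (cases "x = y \<otimes>\<^bsub>W\<^esub> s")
    case True
    have y_eq: "x \<otimes>\<^bsub>W\<^esub> s = y" using True y s SR_mult_cancel(2) by simp
    have "\<gamma> = act y \<alpha> \<or> \<gamma> = - act y \<alpha>"
      using T_mult_eq_iff[OF y \<gamma>AR \<alpha>(1)] True by (simp add: x_def \<alpha>(4))
    then have "a = br \<gamma> \<or> a = - br \<gamma>"
      by (auto simp: a_def br_uminus AR_subset_AWt act_root y \<alpha>)
    then obtain c :: 'f where c: "a = mconst c * br \<gamma>"
      by (metis mconst_1 mconst_uminus mult_1 mult_minus_left)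
    have ax: "br (act x \<alpha>) = - a"
      unfolding True a_def \<alpha>_def by (rule br_act_mult_simple[OF y s])
    \<comment> \<open>Here \<open>x\<close> and \<open>x s\<close> are \<open>y s\<close> and
      \<open>y\<close>, so \<open>f = - a g\<close> on both. Since the coefficient at
      \<open>x\<close> is \<open>- a\<close>, the element to divide is
      \<open>- 2 a g\<close>.\<close>
    show ?thesis
    proof (rule reduce[of "\<lambda>\<sigma>. - (mconst c + mconst c) * g \<sigma>"])
      show "(\<lambda>\<sigma>. - (mconst c + mconst c) * g \<sigma>) \<in> XM ss"
        using fg S by (intro X_scale sym_algebra_uminus sym_algebra_add) auto
      fix \<sigma> assume "\<sigma> \<in> subseqs_at D ss x \<union> subseqs_at D ss (x \<otimes>\<^bsub>W\<^esub> s)"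
      then have "F \<sigma> = 0" using F0 F0' unfolding y_eq unfolding True by blast
      then have "f \<sigma> = - (a * g \<sigma>)" by (simp add: F_def add_eq_0_iff2)
      then show "f \<sigma> + br (act x \<alpha>) * g \<sigma> = br \<gamma> * (- (mconst c + mconst c) * g \<sigma>)"
        by (simp add: ax c algebra_simps)
    qed
  next
    case False
    have xs: "x \<otimes>\<^bsub>W\<^esub> s = T \<gamma> \<otimes>\<^bsub>W\<^esub> (y \<otimes>\<^bsub>W\<^esub> s)"
      using y \<gamma>AR sW by (simp add: x_def W.m_assoc T_in_W)
    have ys: "y \<otimes>\<^bsub>W\<^esub> s \<in> carrier W" using y sW by blast
    have ysx: "y \<noteq> x \<otimes>\<^bsub>W\<^esub> s" "y \<otimes>\<^bsub>W\<^esub> s \<noteq> x" using False SR_mult_cancel(2)[OF s] x by metis+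
    \<comment> \<open>\<open>\<alpha>\<close> is the only positive root that \<open>s\<close> makes
      negative; excluding it shows that \<open>y s\<close> and \<open>x s\<close> are again joined
      by an edge upwards with the same label.\<close>
    have "act (inv\<^bsub>W\<^esub> y) \<gamma> \<noteq> \<alpha>"
    proof
      assume "act (inv\<^bsub>W\<^esub> y) \<gamma> = \<alpha>"
      then have "\<gamma> = act y \<alpha>" using act_inv'[OF y, of \<gamma>] by simp
      then show False using T_act[OF y \<alpha>(1)] False by (simp add: x_def \<alpha>(4))
    qed
    then have "LR \<alpha> (act (inv\<^bsub>W\<^esub> y) \<gamma>) \<in> AP" using LR_simple_pos[OF \<alpha>(3) pos] by blast
    moreover have "act (inv\<^bsub>W\<^esub> (y \<otimes>\<^bsub>W\<^esub> s)) \<gamma> = LR \<alpha> (act (inv\<^bsub>W\<^esub> y) \<gamma>)"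
      unfolding \<alpha>(4)[symmetric] using y \<alpha>(1) by (simp add: W.inv_mult_group T_in_W inv_T act_mult act_T)
    ultimately have pos': "act (inv\<^bsub>W\<^esub> (y \<otimes>\<^bsub>W\<^esub> s)) \<gamma> \<in> AP" by simp
    obtain G1 where G1: "G1 \<in> XM ss" "\<And>\<sigma>. \<sigma> \<in> subseqs_at D ss x \<Longrightarrow> F \<sigma> = br \<gamma> * G1 \<sigma>"
      using edge_divD[OF ed \<gamma> y pos F_X F0] unfolding x_def by blast
    obtain G2 where G2: "G2 \<in> XM ss" "\<And>\<sigma>. \<sigma> \<in> subseqs_at D ss (x \<otimes>\<^bsub>W\<^esub> s) \<Longrightarrow> F \<sigma> = br \<gamma> * G2 \<sigma>"
      using edge_divD[OF ed \<gamma> ys pos' F_X F0'] unfolding xs by blast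
    obtain u where u: "u \<in> carrier W" "act u (simple_root_of D s) \<in> AP"
      "u = x \<and> u \<otimes>\<^bsub>W\<^esub> s = x \<otimes>\<^bsub>W\<^esub> s \<or> u = x \<otimes>\<^bsub>W\<^esub> s \<and> u \<otimes>\<^bsub>W\<^esub> s = x"
      using simple_edge[OF x s] by blast
    note glue' = glue[OF two S s ed cd gkm u(1,2)]
    \<comment> \<open>The second edge into \<open>u s\<close> starts at \<open>y s\<close> if
      \<open>u = x\<close> and at \<open>y\<close> if \<open>u = x s\<close>, which decides the
      roles of \<open>G1\<close> and \<open>G2\<close>.\<close>
    from u(3) have "\<exists>G\<in>XM ss. \<forall>\<sigma>\<in>subseqs_at D ss x \<union> subseqs_at D ss (x \<otimes>\<^bsub>W\<^esub> s). F \<sigma> = br \<gamma> * G \<sigma>"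
    proof
      assume ux: "u = x \<and> u \<otimes>\<^bsub>W\<^esub> s = x \<otimes>\<^bsub>W\<^esub> s"
      have "\<exists>G\<in>XM ss. \<forall>\<sigma>\<in>subseqs_at D ss u \<union> subseqs_at D ss (u \<otimes>\<^bsub>W\<^esub> s). F \<sigma> = br \<gamma> * G \<sigma>"
        by (rule glue'[OF ys \<gamma> pos' _ _ F_X G1(1) G2(1)]) (use ux xs ysx G1(2) G2(2) in simp_all)
      then show ?thesis using ux by simp
    next
      assume ux: "u = x \<otimes>\<^bsub>W\<^esub> s \<and> u \<otimes>\<^bsub>W\<^esub> s = x"
      have "\<exists>G\<in>XM ss. \<forall>\<sigma>\<in>subseqs_at D ss u \<union> subseqs_at D ss (u \<otimes>\<^bsub>W\<^esub> s). F \<sigma> = br \<gamma> * G \<sigma>"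
        by (rule glue'[OF y \<gamma> pos _ _ F_X G2(1) G1(1)]) (use ux x_def[symmetric] SR_mult_cancel(2)[OF s x] ysx G1(2) G2(2) in simp_all)
      then show ?thesis using ux SR_mult_cancel(2)[OF s x] by (simp add: Un_commute)
    qed
    then obtain G where G: "G \<in> XM ss"
      "\<And>\<sigma>. \<sigma> \<in> subseqs_at D ss x \<union> subseqs_at D ss (x \<otimes>\<^bsub>W\<^esub> s) \<Longrightarrow> F \<sigma> = br \<gamma> * G \<sigma>" by blast
    \<comment> \<open>The coefficients of \<open>g\<close> at \<open>x\<close> and at
      \<open>y\<close> differ by an integral multiple of the label; this produces the correction by
      \<open>k\<close> times \<open>g\<close> in the quotient.\<close>
    obtain k where "LR \<gamma> (act y \<alpha>) = act y \<alpha> - int_smul D k \<gamma>"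
      using LR_int[OF \<gamma>AR AR_subset_AWt[OF act_root[OF y \<alpha>(1)]]] by blast
    then have "act x \<alpha> = act y \<alpha> - int_smul D k \<gamma>"
      using y \<gamma>AR by (simp add: x_def act_mult T_in_W act_T)
    then have ax: "br (act x \<alpha>) = a - mconst (of_int k) * br \<gamma>"
      using y \<alpha> \<gamma>AR by (simp add: a_def br_diff br_int_smul AWt_int_smul AR_subset_AWt act_root)
    show ?thesis
    proof (rule reduce[of "\<lambda>\<sigma>. G \<sigma> - mconst (of_int k) * g \<sigma>"])
      show "(\<lambda>\<sigma>. G \<sigma> - mconst (of_int k) * g \<sigma>) \<in> XM ss" using fg G S by (intro X_diff X_scale) auto
      fix \<sigma> assume "\<sigma> \<in> subseqs_at D ss x \<union> subseqs_at D ss (x \<otimes>\<^bsub>W\<^esub> s)"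
      then have "f \<sigma> + a * g \<sigma> = br \<gamma> * G \<sigma>" using G(2) by (simp only: F_def)
      then have "f \<sigma> = br \<gamma> * G \<sigma> - a * g \<sigma>" by (simp add: eq_diff_eq)
      then show "f \<sigma> + br (act x \<alpha>) * g \<sigma> = br \<gamma> * (G \<sigma> - mconst (of_int k) * g \<sigma>)"
        by (simp add: ax algebra_simps)
    qed
  qed
  then show "\<exists>g\<in>XM (ss @ [s]). \<forall>\<sigma>\<in>subseqs_at D (ss @ [s]) (T \<gamma> \<otimes>\<^bsub>W\<^esub> y). h \<sigma> = br \<gamma> * g \<sigma>"
    unfolding x_def .
qed

lemma GKM_mono:
  "GKM (full_subgraph E \<Omega>) \<Longrightarrow> \<Omega>' \<subseteq> \<Omega> \<Longrightarrow> GKM (full_subgraph E \<Omega>')"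
  unfolding GKM_def full_subgraph_def by fastforce

text \<open>The induction is simultaneous because each step uses both properties of the shorter
  sequence, whose evaluations form a subset and so inherit the GKM-property.\<close>

lemma edge_div_coprime_div:
  assumes "(2::'f::field) \<noteq> 0" and "set ss \<subseteq> SR"
    and "GKM (full_subgraph (moment_graph D bs :: ('v transf \<times> 'v transf \<times> 'f mpoly) set) (ev_set D ss))"
  shows "edge_div TYPE('f) ss \<and> coprime_div TYPE('f) ss"
  using assms(2,3)
proof (induction ss rule: rev_induct)
  case Nil
  show ?case using edge_div_Nil coprime_div_Nil by blast
next
  case (snoc s ss)
  then have S: "set ss \<subseteq> SR" "s \<in> SR" by auto
  have gkm: "GKM (full_subgraph (moment_graph D bs :: ('v transf \<times> 'v transf \<times> 'f mpoly) set) (ev_set D ss))"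
    by (rule GKM_mono[OF snoc.prems(2) ev_set_snoc[OF S(1)]])
  show ?case
    using edge_div_snoc[OF assms(1) S _ _ gkm] coprime_div_snoc[OF assms(1) S] snoc.IH[OF S(1) gkm] by blast
qed

end

theorem corollary4p5p3:
  fixes D :: "'v::ab_group_add root_datum"
    and bs :: "('v \<times> rat) list"
    and ss :: "'v transf list"
    and x y :: "'v transf"
    and \<alpha> :: "'f::field mpoly"
    and f :: "'v transf option list \<Rightarrow> 'f mpoly"
  assumes "irreducible_reduced_root_datum D"
    and "affine_weight_basis D bs"
    and "CHAR('f) \<noteq> 2"
    and "set ss \<subseteq> simple_reflections D"
    and "GKM (full_subgraph (moment_graph D bs :: ('v transf \<times> 'v transf \<times> 'f mpoly) set)
               (ev_set D ss))"
    and "(y, x, \<alpha>) \<in> moment_graph D bs"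
    and "f \<in> X_module D bs ss"
    and "\<forall>\<sigma>\<in>subseqs_at D ss y. f \<sigma> = 0"
  shows "\<exists>g\<in>X_module D bs ss. \<forall>\<sigma>\<in>subseqs_at D ss x. f \<sigma> = \<alpha> * g \<sigma>"
proof -
  interpret root_datum_basis D bs
    using assms(1,2) by unfold_locales
  have two: "(2::'f) \<noteq> 0"
  proof
    assume "(2::'f) = 0"
    then have "of_nat 2 = (0::'f)" by simp
    then have "CHAR('f) dvd 2" by (simp only: of_nat_eq_0_iff_char_dvd)
    then have "CHAR('f) \<le> 2" by (rule dvd_imp_le) simp
    moreover have "CHAR('f) \<noteq> 0" using \<open>CHAR('f) dvd 2\<close> by (intro notI) simp
    moreover have "CHAR('f) \<noteq> 1" by simp
    ultimately show False using assms(3) by linarith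
  qed
  obtain \<gamma> where "\<gamma> \<in> AP" "\<alpha> = br \<gamma>" "y \<in> carrier W" "x = T \<gamma> \<otimes>\<^bsub>W\<^esub> y" "act (inv\<^bsub>W\<^esub> y) \<gamma> \<in> AP"
    using assms(6) unfolding moment_graph_iff by blast
  then show ?thesis
    using edge_div_coprime_div[OF two assms(4,5)] assms(7,8) unfolding edge_div_def by blast
qed

end
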